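(* Consider the iterates of AS-ADMM (defined in the context), with parameters chosen as $$\eta_k=\min\left\{\frac{c_1}{M_k(M_k+1)},\,c_2\right\},\qquad M_k=\max\{\lceil c_3k^{\varrho}\rceil,\,M\},$$ where $c_1,c_2,c_3>0$ and $\varrho\ge 1$ are constants and $M>0$ is a given integer. Assume that for all $k$ we have $\mathcal{D}_k\succeq\mathcal{D}_{k+1}\succeq 0$ and $\mathbb{E}\big[\|\delta_t\|_{\mathcal{H}^{-1}}^2\big]\le\sigma^2$ for some $\sigma>0$ independent of $t$ and the iteration number $k$. Let $\kappa$ be chosen large enough that $M_\kappa=\lceil c_3\kappa^{\varrho}\rceil$ and $\eta_\kappa=c_1/(M_\kappa(M_\kappa+1))\le 1/(2\nu)$, and for integers $T>0$ let $$w_T=(x_T,y_T,\lambda_T)=\frac1{1+T}\sum_{k=\kappa}^{\kappa+T}\tilde w^k .$$ Then for every $w^*\in\mathcal{W}^*$, $$\big|\mathbb{E}[F(w_T)-F(w^* )]\big|=E_\varrho(T)=\mathbb{E}\big[\|Ax_T+By_T-b\|\big],$$ where $E_\varrho(T)=\mathcal{O}(1/T)$ for $\varrho>1$ and $E_\varrho(T)=\mathcal{O}(T^{-1}\log T)$ for $\varrho=1$ (that is, each of the two expected quantities is of this order).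
   Context: Problem: $\min\{f(x)+g(y): x\in\mathcal{X},\ y\in\mathcal{Y},\ Ax+By=b\}$, where $\mathcal{X}\subset\mathbb{R}^{n_1}$, $\mathcal{Y}\subset\mathbb{R}^{n_2}$ are closed convex sets, $g:\mathcal{Y}\to\mathbb{R}\cup\{+\infty\}$ is convex (not necessarily smooth), $A\in\mathbb{R}^{n\times n_1}$, $B\in\mathbb{R}^{n\times n_2}$, $b\in\mathbb{R}^n$, and $f=\frac1N\sum_{j=1}^N f_j$ with each $f_j$ real-valued, convex, defined on an open set containing $\mathcal{X}$, and Lipschitz continuously differentiable on $\mathcal{X}$. For symmetric $G$, $\|x\|_G^2:=x^{\sf T}Gx$; $\|\cdot\|$ is the Euclidean norm; $\succeq$, $\succ$ denote the semidefinite/definite orders; $\mathbb{E}$ denotes expectation. Algorithm AS-ADMM. Parameters $\beta>0$, $s\in(0,(1+\sqrt5)/2]$, $\mathcal{H}\succ0$. Start from $(x^0,y^0,\lambda^0)\in\mathcal{X}\times\mathcal{Y}\times\mathbb{R}^n$, $\breve x^0=x^0$. For $k=0,1,\dots$: choose an integer $M_k>0$, $\eta_k>0$ and a symmetric matrix $\mathcal{M}_k$ with $\mathcal{D}_k:=\mathcal{M}_k-\beta A^{\sf T}A\succeq0$; put $h^k=-A^{\sf T}[\lambda^k-\beta(Ax^k+By^k-b)]$. Inner loop: $x_1=x^k$, $\breve x_1=\breve x^k$; for $t=1,\dots,M_k$: randomly select $\xi_t\in\{1,\dots,N\}$ with uniform probability; $\beta_t=2/(t+1)$, $\gamma_t=2/(t\eta_k)$,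 $\hat x_t=\beta_t\breve x_t+(1-\beta_t)x_t$; $d_t=\nabla f_{\xi_t}(\hat x_t)+e_t$ where $e_t$ is a random vector satisfying $\mathbb{E}[e_t]=0$; $\breve x_{t+1}=\arg\min_{x\in\mathcal{X}}\{\langle d_t+h^k,x\rangle+\frac{\gamma_t}2\|x-\breve x_t\|_{\mathcal{H}}^2+\frac12\|x-x^k\|_{\mathcal{M}_k}^2\}$; $x_{t+1}=\beta_t\breve x_{t+1}+(1-\beta_t)x_t$. Then $x^{k+1}=x_{M_k+1}$, $\breve x^{k+1}=\breve x_{M_k+1}$, $y^{k+1}\in\arg\min_{y\in\mathcal{Y}}\{g(y)+\frac\beta2\|Ax^{k+1}+By-b-\lambda^k/\beta\|^2\}$, $\lambda^{k+1}=\lambda^k-s\beta(Ax^{k+1}+By^{k+1}-b)$. In outer iteration $k$, $\delta_t:=\nabla f(\hat x_t)-d_t$. Put $\tilde w^k=(x^{k+1},y^{k+1},\tilde\lambda^k)$ with $\tilde\lambda^k=\lambda^k-\beta(Ax^{k+1}+By^k-b)$. For $w=(x,y,\lambda)$, $F(w)=f(x)+g(y)$ and $\mathcal{J}(w)=(-A^{\sf T}\lambda,\,-B^{\sf T}\lambda,\,Ax+By-b)$. Let $\Omega=\mathcal{X}\times\mathcal{Y}\times\mathbb{R}^n$ and let $\mathcal{W}^*$ be the set of $w^*\in\Omega$ with $F(w)-F(w^* )+(w-w^* )^{\sf T}\mathcal{J}(w^* )\ge0$ for all $w\in\Omega$ (the primal-dual solutions). Standing assumptions: $\mathcal{W}^*\neq\emptyset$;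 for every $z\in\mathbb{R}^{n_2}$ the problem $\min_{y\in\mathcal{Y}}\{g(y)+\frac\beta2 y^{\sf T}B^{\sf T}By+z^{\sf T}y\}$ has a minimizer; and for some $\nu>0$, $\|\nabla f_j(x_1)-\nabla f_j(x_2)\|_{\mathcal{H}^{-1}}\le\nu\|x_1-x_2\|_{\mathcal{H}}$ for all $x_1,x_2\in\mathcal{X}$ and all $j$.
   Formalization: E[e_t]=0 is taken conditionally on the past (earlier ξ, e and y^0..y^k) and ξ_t is independent of that past; with only unconditional mean zero the claim fails (e.g. e_t=ζ=±1 fixed for all t). The y^k and F(w_T) are assumed measurable. *)

theory Defs
  imports "HOL-Probability.Probability" "HOL-Library.Landau_Symbols"
begin

section \<open>Weighted norms, definiteness and gradients\<close>

definition sqnorm_wrt :: "real^'a^'a \<Rightarrow> real^'a \<Rightarrow> real" where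
  "sqnorm_wrt G x = x \<bullet> (G *v x)"

definition norm_wrt :: "real^'a^'a \<Rightarrow> real^'a \<Rightarrow> real" where
  "norm_wrt G x = sqrt (sqnorm_wrt G x)"

definition pos_def :: "real^'a^'a \<Rightarrow> bool" where
  "pos_def G \<longleftrightarrow> transpose G = G \<and> (\<forall>x. x \<noteq> 0 \<longrightarrow> 0 < x \<bullet> (G *v x))"

definition pos_semidef :: "real^'a^'a \<Rightarrow> bool" where
  "pos_semidef G \<longleftrightarrow> transpose G = G \<and> (\<forall>x. 0 \<le> x \<bullet> (G *v x))"

definition loewner_ge :: "real^'a^'a \<Rightarrow> real^'a^'a \<Rightarrow> bool" where
  "loewner_ge G G' \<longleftrightarrow> pos_semidef (G - G')"

definition gradient :: "('a::real_inner \<Rightarrow> real) \<Rightarrow> 'a \<Rightarrow> 'a" where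
  "gradient f x = (THE D. GDERIV f x :> D)"

lemma gderiv_gradient:
  fixes f :: "'a::euclidean_space \<Rightarrow> real"
  assumes "f differentiable (at x)"
  shows "GDERIV f x :> gradient f x"
proof -
  obtain L where L: "(f has_derivative L) (at x)"
    using assms by (auto simp: differentiable_def)
  interpret L: bounded_linear L
    using L by (rule has_derivative_bounded_linear)
  have "L = (\<lambda>h. h \<bullet> adjoint L 1)"
    using adjoint_works[OF L.linear_axioms, of _ 1] by auto
  then have ex: "GDERIV f x :> adjoint L 1"
    using L by (simp add: gderiv_def)
  moreover have "D = adjoint L 1" if "GDERIV f x :> D" for D
  proof -
    have "(\<lambda>h. h \<bullet> D) = (\<lambda>h. h \<bullet> adjoint L 1)"
      using that ex unfolding gderiv_def by (rule has_derivative_unique)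
    then show ?thesis
      by (metis vector_eq_ldot)
  qed
  ultimately show ?thesis
    unfolding gradient_def by (metis theI)
qed

section \<open>The separable problem and its primal-dual solutions\<close>

text \<open>Convexity on \<open>Y\<close> of a function with values in the reals and \<open>\<infinity>\<close>.\<close>

definition ext_convex_on :: "'a::real_vector set \<Rightarrow> ('a \<Rightarrow> ereal) \<Rightarrow> bool" where
  "ext_convex_on Y g \<longleftrightarrow> convex Y \<and> (\<forall>y\<in>Y. g y \<noteq> -\<infinity>) \<and>
     (\<forall>y\<in>Y. \<forall>z\<in>Y. \<forall>u v. 0 \<le> u \<and> 0 \<le> v \<and> u + v = 1 \<longrightarrow>
        g (u *\<^sub>R y + v *\<^sub>R z) \<le> ereal u * g y + ereal v * g z)"

definition objective ::
  "('a \<Rightarrow> real) \<Rightarrow> ('b \<Rightarrow> ereal) \<Rightarrow> 'a \<times> 'b \<times> 'c \<Rightarrow> ereal" where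
  "objective f g = (\<lambda>(x, y, l). ereal (f x) + g y)"

definition residual ::
  "real^'n1^'n \<Rightarrow> real^'n2^'n \<Rightarrow> real^'n \<Rightarrow> real^'n1 \<Rightarrow> real^'n2 \<Rightarrow> real^'n" where
  "residual A B b x y = A *v x + B *v y - b"

definition saddle_op ::
  "real^'n1^'n \<Rightarrow> real^'n2^'n \<Rightarrow> real^'n \<Rightarrow>
   (real^'n1) \<times> (real^'n2) \<times> (real^'n) \<Rightarrow> (real^'n1) \<times> (real^'n2) \<times> (real^'n)" where
  "saddle_op A B b =
     (\<lambda>(x, y, l). (- (transpose A *v l), - (transpose B *v l), residual A B b x y))"

text \<open>The difference \<open>F(w) - F(w\<^sup>*)\<close> presupposes that \<open>F(w\<^sup>*)\<close> is finite. The finiteness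
  conjunct matters only when \<open>g\<close> is identically \<open>\<infinity>\<close> on \<open>Y\<close>, since \<open>\<infinity> - \<infinity> = \<infinity>\<close> in
  \<^typ>\<open>ereal\<close>.\<close>

definition primal_dual_solutions ::
  "(real^'n1) set \<Rightarrow> (real^'n2) set \<Rightarrow> (real^'n1 \<Rightarrow> real) \<Rightarrow> (real^'n2 \<Rightarrow> ereal) \<Rightarrow>
   real^'n1^'n \<Rightarrow> real^'n2^'n \<Rightarrow> real^'n \<Rightarrow> ((real^'n1) \<times> (real^'n2) \<times> (real^'n)) set" where
  "primal_dual_solutions X Y f g A B b =
     {ws \<in> X \<times> Y \<times> UNIV. \<bar>objective f g ws\<bar> \<noteq> \<infinity> \<and>
        (\<forall>w \<in> X \<times> Y \<times> UNIV.
           objective f g w - objective f g ws + ereal ((w - ws) \<bullet> saddle_op A B b ws) \<ge> 0)}"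

section \<open>The algorithm AS-ADMM\<close>

text \<open>\<open>accel t u v\<close> is \<open>\<beta>\<^sub>t u + (1 - \<beta>\<^sub>t) v\<close> with \<open>\<beta>\<^sub>t = 2/(t+1)\<close>.\<close>

definition accel :: "nat \<Rightarrow> 'a::real_vector \<Rightarrow> 'a \<Rightarrow> 'a" where
  "accel t u v = (2 / (real t + 1)) *\<^sub>R u + (1 - 2 / (real t + 1)) *\<^sub>R v"

definition stoch_grad ::
  "(nat \<Rightarrow> 'a::real_inner \<Rightarrow> real) \<Rightarrow> nat \<Rightarrow> 'a \<Rightarrow> 'a \<Rightarrow> 'a" where
  "stoch_grad fs j e xh = gradient (fs j) xh + e"

text \<open>One realization of the algorithm. Outer iterates are \<open>x k\<close>, \<open>xb k\<close> (for \<open>x\<close> with a breve),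
  \<open>y k\<close>, \<open>l k\<close> (for \<open>\<lambda>\<close>); the inner iterates \<open>x\<^sub>t\<close> and \<open>x\<^sub>t\<close> with a breve of outer iteration \<open>k\<close>
  are \<open>z k t\<close> and \<open>zb k t\<close>, for \<open>1 \<le> t \<le> m k + 1\<close>; their values at other \<open>t\<close> are irrelevant.
  \<open>m k\<close> and \<open>MM k\<close> are the integer \<open>M\<^sub>k\<close> and the matrix \<open>\<M>\<^sub>k\<close>.\<close>

definition as_admm_path ::
  "(real^'n1) set \<Rightarrow> (real^'n2) set \<Rightarrow> (nat \<Rightarrow> real^'n1 \<Rightarrow> real) \<Rightarrow> (real^'n2 \<Rightarrow> ereal) \<Rightarrow>
   real^'n1^'n \<Rightarrow> real^'n2^'n \<Rightarrow> real^'n \<Rightarrow> real \<Rightarrow> real \<Rightarrow> real^'n1^'n1 \<Rightarrow>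
   (nat \<Rightarrow> nat) \<Rightarrow> (nat \<Rightarrow> real) \<Rightarrow> (nat \<Rightarrow> real^'n1^'n1) \<Rightarrow>
   real^'n1 \<Rightarrow> real^'n2 \<Rightarrow> real^'n \<Rightarrow>
   (nat \<Rightarrow> nat \<Rightarrow> nat) \<Rightarrow> (nat \<Rightarrow> nat \<Rightarrow> real^'n1) \<Rightarrow>
   (nat \<Rightarrow> real^'n1) \<Rightarrow> (nat \<Rightarrow> real^'n1) \<Rightarrow> (nat \<Rightarrow> real^'n2) \<Rightarrow> (nat \<Rightarrow> real^'n) \<Rightarrow>
   (nat \<Rightarrow> nat \<Rightarrow> real^'n1) \<Rightarrow> (nat \<Rightarrow> nat \<Rightarrow> real^'n1) \<Rightarrow> bool" where
  "as_admm_path X Y fs g A B b \<beta> s H m \<eta> MM x0 y0 l0 \<xi> e x xb y l z zb \<longleftrightarrow>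
     x 0 = x0 \<and> xb 0 = x0 \<and> y 0 = y0 \<and> l 0 = l0 \<and>
     (\<forall>k.
        z k 1 = x k \<and> zb k 1 = xb k \<and>
        (\<forall>t\<in>{1..m k}.
           (let h = - (transpose A *v (l k - \<beta> *\<^sub>R residual A B b (x k) (y k)));
                \<gamma> = 2 / (real t * \<eta> k);
                d = stoch_grad fs (\<xi> k t) (e k t) (accel t (zb k t) (z k t))
            in is_arg_min
                 (\<lambda>u. (d + h) \<bullet> u + \<gamma> / 2 * sqnorm_wrt H (u - zb k t)
                        + 1 / 2 * sqnorm_wrt (MM k) (u - x k))
                 (\<lambda>u. u \<in> X) (zb k (t + 1))) \<and>
           z k (t + 1) = accel t (zb k (t + 1)) (z k t)) \<and>
        x (k + 1) = z k (m k + 1) \<and>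
        xb (k + 1) = zb k (m k + 1) \<and>
        is_arg_min
          (\<lambda>u. g u + ereal (\<beta> / 2 * (norm (residual A B b (x (k + 1)) u - (1 / \<beta>) *\<^sub>R l k))\<^sup>2))
          (\<lambda>u. u \<in> Y) (y (k + 1)) \<and>
        l (k + 1) = l k - (s * \<beta>) *\<^sub>R residual A B b (x (k + 1)) (y (k + 1)))"

text \<open>The \<open>\<sigma>\<close>-algebra of all that is known when \<open>\<xi>\<^sub>t\<close> is drawn in outer iteration \<open>k\<close>: the earlier
  \<open>\<xi>\<close> and \<open>e\<close>, and \<open>y\<^sup>0, \<dots>, y\<^sup>k\<close>. The latter are listed because the minimizer defining \<open>y\<^sup>i\<close> need
  not be unique, so that \<open>y\<^sup>i\<close> need not be a function of the earlier \<open>\<xi>\<close> and \<open>e\<close>.\<close>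

definition history ::
  "'w measure \<Rightarrow> (nat \<Rightarrow> nat) \<Rightarrow> (nat \<Rightarrow> nat \<Rightarrow> 'w \<Rightarrow> nat) \<Rightarrow> (nat \<Rightarrow> nat \<Rightarrow> 'w \<Rightarrow> real^'n1) \<Rightarrow>
   (nat \<Rightarrow> 'w \<Rightarrow> real^'n2) \<Rightarrow> nat \<Rightarrow> nat \<Rightarrow> 'w measure" where
  "history P m \<xi> e y k t =
     (let past = {(i, r). 1 \<le> r \<and> r \<le> m i \<and> (i < k \<or> i = k \<and> r < t)}
      in sigma (space P)
           ({\<xi> i r -` S \<inter> space P | i r S. (i, r) \<in> past} \<union>
            {e i r -` S \<inter> space P | i r S. (i, r) \<in> past \<and> S \<in> sets borel} \<union>
            {y i -` S \<inter> space P | i S. i \<le> k \<and> S \<in> sets borel}))"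

text \<open>\<open>w\<^sup>k\<close> with a tilde, and its average over \<open>\<kappa> \<le> k \<le> \<kappa> + T\<close>.\<close>

definition w_tilde ::
  "real^'n1^'n \<Rightarrow> real^'n2^'n \<Rightarrow> real^'n \<Rightarrow> real \<Rightarrow>
   (nat \<Rightarrow> real^'n1) \<Rightarrow> (nat \<Rightarrow> real^'n2) \<Rightarrow> (nat \<Rightarrow> real^'n) \<Rightarrow> nat \<Rightarrow>
   (real^'n1) \<times> (real^'n2) \<times> (real^'n)" where
  "w_tilde A B b \<beta> x y l k =
     (x (k + 1), y (k + 1), l k - \<beta> *\<^sub>R residual A B b (x (k + 1)) (y k))"

definition ergodic_mean :: "(nat \<Rightarrow> 'a::real_vector) \<Rightarrow> nat \<Rightarrow> nat \<Rightarrow> 'a" where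
  "ergodic_mean w \<kappa> T = (1 / (1 + real T)) *\<^sub>R (\<Sum>k = \<kappa>..\<kappa> + T. w k)"

end

theory Submission
  imports Defs
begin

text \<open>
  The accelerated inner loop is telescoped with the weights \<open>t (t + 1)\<close>; since \<open>\<eta>\<^sub>k M\<^sub>k (M\<^sub>k + 1) = c\<^sub>1\<close>
  for \<open>k \<ge> \<kappa>\<close>, its proximal terms carry the constant factor \<open>2 / c\<^sub>1\<close> and telescope over the outer
  iterations as well. Together with the optimality of \<open>y\<^sup>k\<close> and \<open>y\<^sup>k\<^sup>+\<^sup>1\<close>, each outer iteration decreases a
  nonnegative potential by the Lagrangian gap, up to a noise term. The noise does not involve the
  multiplier, so after averaging one may choose it pathwise, opposite to the residual; this bounds both
  the objective gap and the infeasibility by the initial potential plus the accumulated noise, divided by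
  \<open>1 + T\<close>. The cross terms of the noise have mean zero because the inner iterates are measurable with
  respect to the history, and what remains is of order \<open>\<sigma>\<^sup>2 / M\<^sub>k = O(k\<^sup>-\<^sup>\<rho>)\<close>.
\<close>

section \<open>Weighted norms and variational inequalities\<close>

text \<open>Two obstacles shape the argument. The \<open>y\<close>-subproblem may have many
  minimizers, so \<open>y k\<close> need not be a function of the samples, and nothing controls it
  along the kernel of \<open>B\<close>. Its measurability is therefore read off the history, and
  second moments are carried only for \<open>B *v (y k - vs)\<close>, which is all that the residual
  and the potential involve. Secondly, the new proximal point depends on the sampled gradient, so
  the gradient error may only be paired with the old point. The discrepancy is paid by one half of
  the proximal term; the other half pays for the curvature of \<open>f\<close>, and this is where
  \<open>\<eta> k \<le> 1 / (2 * \<nu>)\<close> enters. Finally, the multiplier may be chosen after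
  the realization is known only because the initial potential is bounded uniformly over a ball of
  multipliers before expectations are taken.\<close>

lemma sym_inner_mult:
  fixes G :: "real^'a^'a"
  assumes "transpose G = G"
  shows "u \<bullet> (G *v v) = v \<bullet> (G *v u)"
  by (metis assms dot_lmul_matrix inner_commute transpose_matrix_vector)

lemma inner_transpose_mult:
  fixes A :: "real^'a^'b"
  shows "(transpose A *v l) \<bullet> u = l \<bullet> (A *v u)"
  by (simp add: dot_lmul_matrix)

lemma sqnorm_wrt_add:
  assumes "transpose G = G"
  shows "sqnorm_wrt G (u + v) = sqnorm_wrt G u + 2 * (u \<bullet> (G *v v)) + sqnorm_wrt G v"
  using sym_inner_mult[OF assms, of u v]
  by (simp add: sqnorm_wrt_def matrix_vector_right_distrib inner_add_left inner_add_right)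

lemma sqnorm_wrt_scaleR: "sqnorm_wrt G (r *\<^sub>R u) = r\<^sup>2 * sqnorm_wrt G u"
  by (simp add: sqnorm_wrt_def matrix_vector_mult_scaleR power2_eq_square)

lemma sqnorm_wrt_diff:
  assumes "transpose G = G"
  shows "sqnorm_wrt G (u - v) = sqnorm_wrt G u - 2 * (u \<bullet> (G *v v)) + sqnorm_wrt G v"
  using sym_inner_mult[OF assms, of u v]
  by (simp add: sqnorm_wrt_def matrix_vector_mult_diff_distrib inner_diff_left inner_diff_right)

lemma sqnorm_wrt_minus_commute: "sqnorm_wrt G (u - v) = sqnorm_wrt G (v - u)"
  using sqnorm_wrt_scaleR[of G "-1" "u - v"] by simp

text \<open>Polarization of \<open>u - a = (u - p) + (p - a)\<close>. It turns the gradient of a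
  proximal term at \<open>p\<close> into the difference of squared distances to \<open>u\<close>
  that later telescopes.\<close>

lemma sqnorm_wrt_three_point:
  assumes "transpose G = G"
  shows "(G *v (p - a)) \<bullet> (u - p) =
    (sqnorm_wrt G (u - a) - sqnorm_wrt G (u - p) - sqnorm_wrt G (p - a)) / 2"
  using sqnorm_wrt_add[OF assms, of "u - p" "p - a"] by (simp add: inner_commute)

lemma pos_defD: "pos_def G \<Longrightarrow> transpose G = G" "pos_def G \<Longrightarrow> 0 \<le> sqnorm_wrt G u"
  unfolding pos_def_def sqnorm_wrt_def by (auto, cases "u = 0", auto simp: less_imp_le)

lemma pos_semidefD: "pos_semidef G \<Longrightarrow> transpose G = G" "pos_semidef G \<Longrightarrow> 0 \<le> sqnorm_wrt G u"
  unfolding pos_semidef_def sqnorm_wrt_def by auto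

text \<open>By compactness the form attains a positive minimum on the unit sphere, and homogeneity
  extends the bound to all vectors. The constant found is the least eigenvalue of
  \<open>G\<close>.\<close>

lemma pos_def_bounded_below:
  fixes G :: "real^'a^'a"
  assumes "pos_def G"
  obtains c where "c > 0" "\<And>u. c * (norm u)\<^sup>2 \<le> sqnorm_wrt G u"
proof -
  have "continuous_on (sphere 0 1) (sqnorm_wrt G)"
    unfolding sqnorm_wrt_def
    by (intro continuous_intros linear_continuous_on) (simp add: bounded_linear_def)
  moreover have "sphere (0::real^'a) 1 \<noteq> {}"
    by (rule ccontr) (use vector_choose_size[of 1, where 'a="real^'a"] in auto)
  ultimately obtain v where v: "v \<in> sphere 0 1" "\<And>u. u \<in> sphere 0 1 \<Longrightarrow> sqnorm_wrt G v \<le> sqnorm_wrt G u"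
    using continuous_attains_inf[OF compact_sphere] by metis
  show thesis
  proof (rule that)
    show "sqnorm_wrt G v > 0"
      using assms v(1) unfolding pos_def_def sqnorm_wrt_def by (metis dist_0_norm mem_sphere norm_zero zero_neq_one)
    show "sqnorm_wrt G v * (norm u)\<^sup>2 \<le> sqnorm_wrt G u" for u
    proof (cases "u = 0")
      case False
      have "sqnorm_wrt G v \<le> sqnorm_wrt G ((1 / norm u) *\<^sub>R u)"
        using False by (intro v(2)) auto
      then show ?thesis
        using False by (simp add: sqnorm_wrt_scaleR field_simps)
    qed (simp add: sqnorm_wrt_def)
  qed
qed

lemma pos_def_matrix_inv:
  fixes H :: "real^'a^'a"
  assumes "pos_def H"
  shows "H *v (matrix_inv H *v a) = a"
proof -
  have "invertible H"
    unfolding invertible_left_inverse matrix_left_invertible_ker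
    using assms by (metis inner_zero_right less_irrefl pos_def_def)
  then have "H ** matrix_inv H = mat 1"
    unfolding invertible_def matrix_inv_def by (rule someI2_ex) auto
  then show ?thesis
    by (simp add: matrix_vector_mul_assoc)
qed

text \<open>Nonnegativity of the dual norm is inherited from \<open>H\<close> through this
  substitution, without a separate proof that the inverse is positive definite.\<close>

lemma sqnorm_wrt_matrix_inv:
  fixes H :: "real^'a^'a"
  assumes "pos_def H"
  shows "sqnorm_wrt (matrix_inv H) a = sqnorm_wrt H (matrix_inv H *v a)"
  by (simp add: sqnorm_wrt_def pos_def_matrix_inv[OF assms] inner_commute)

lemma norm_wrt_matrix_inv_power2:
  assumes "pos_def H"
  shows "(norm_wrt (matrix_inv H) a)\<^sup>2 = sqnorm_wrt (matrix_inv H) a"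
  using pos_defD(2)[OF assms] sqnorm_wrt_matrix_inv[OF assms, of a] by (simp add: norm_wrt_def)

text \<open>Expand the nonnegative square of \<open>u - r *\<^sub>R p\<close> with
  \<open>p = matrix_inv H *v a\<close>. The free weight \<open>r\<close> is tuned in each
  application.\<close>

lemma Young_wrt:
  fixes H :: "real^'a^'a"
  assumes "pos_def H" "r > 0"
  shows "a \<bullet> u \<le> r / 2 * (norm_wrt (matrix_inv H) a)\<^sup>2 + 1 / (2 * r) * sqnorm_wrt H u"
proof -
  define p where "p = matrix_inv H *v a"
  have sym: "transpose H = H"
    using assms(1) by (rule pos_defD)
  have "0 \<le> sqnorm_wrt H (u - r *\<^sub>R p)"
    using assms(1) by (rule pos_defD)
  also have "\<dots> = r\<^sup>2 * sqnorm_wrt H p - 2 * r * (a \<bullet> u) + sqnorm_wrt H u"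
    unfolding sqnorm_wrt_diff[OF sym] sqnorm_wrt_scaleR
    by (simp add: p_def pos_def_matrix_inv[OF assms(1)] matrix_vector_mult_scaleR inner_commute)
  finally have "2 * r * (a \<bullet> u) \<le> r\<^sup>2 * (norm_wrt (matrix_inv H) a)\<^sup>2 + sqnorm_wrt H u"
    by (simp add: norm_wrt_matrix_inv_power2[OF assms(1)] sqnorm_wrt_matrix_inv[OF assms(1)] p_def)
  then show ?thesis
    using assms(2) by (simp add: field_simps power2_eq_square)
qed

text \<open>Dividing by \<open>\<theta>\<close> and letting it tend to 0 leaves \<open>a\<close>.
  This extracts the first-order condition whenever minimality or convexity is tested along a
  segment.\<close>

lemma first_order_nonneg:
  fixes a c :: real
  assumes "\<And>\<theta>. 0 < \<theta> \<Longrightarrow> \<theta> \<le> 1 \<Longrightarrow> 0 \<le> \<theta> * a + \<theta>\<^sup>2 * c"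
  shows "0 \<le> a"
proof (rule ccontr)
  assume "\<not> 0 \<le> a"
  \<comment> \<open>For negative \<open>a\<close>, a step of at most \<open>- a / K\<close> makes
    \<open>\<theta> * \<bar>c\<bar>\<close> smaller than half of \<open>- a\<close>. The summand 1
    keeps \<open>K\<close> positive when \<open>c = 0\<close>.\<close>
  define K where "K = 2 * (\<bar>c\<bar> + 1)"
  define \<theta> where "\<theta> = min 1 (- a / K)"
  have "K > 0"
    by (simp add: K_def)
  moreover have "\<theta> \<le> - a / K"
    by (simp add: \<theta>_def)
  ultimately have *: "\<theta> * K \<le> - a"
    using pos_le_divide_eq by blast
  have "0 < \<theta>"
    using \<open>\<not> 0 \<le> a\<close> \<open>K > 0\<close> by (simp add: \<theta>_def divide_neg_pos)
  with * have \<theta>: "0 < \<theta>" "\<theta> \<le> 1" "\<theta> * (2 * (\<bar>c\<bar> + 1)) \<le> - a"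
    by (simp_all add: K_def) (simp add: \<theta>_def)
  have "0 \<le> \<theta> * (a + \<theta> * c)"
    using assms[OF \<theta>(1,2)] by (simp add: algebra_simps power2_eq_square)
  then have "0 \<le> a + \<theta> * c"
    using \<theta>(1) by (simp add: zero_le_mult_iff)
  moreover have "\<theta> * c \<le> \<theta> * \<bar>c\<bar>"
    using \<theta>(1) by (intro mult_left_mono) auto
  moreover have "\<theta> * 2 + 2 * (\<theta> * \<bar>c\<bar>) \<le> - a"
    using \<theta>(3) by (simp add: ring_distribs mult_ac)
  moreover have "0 \<le> \<theta> * \<bar>c\<bar>"
    using \<theta>(1) by simp
  ultimately show False
    using \<theta>(1) by linarith
qed

text \<open>Along the segment from \<open>p\<close> to \<open>u\<close> the objective is exactly a
  quadratic polynomial in the parameter; minimality at \<open>p\<close> forces its linear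
  coefficient to be nonnegative.\<close>

lemma arg_min_quadratic_VI:
  fixes H K :: "real^'a^'a"
  assumes "convex X" "transpose H = H" "transpose K = K"
    and min: "is_arg_min (\<lambda>u. q \<bullet> u + \<gamma> / 2 * sqnorm_wrt H (u - a) + 1 / 2 * sqnorm_wrt K (u - c))
      (\<lambda>u. u \<in> X) p"
    and "u \<in> X"
  shows "0 \<le> q \<bullet> (u - p) + \<gamma> * ((H *v (p - a)) \<bullet> (u - p)) + (K *v (p - c)) \<bullet> (u - p)"
proof (rule first_order_nonneg)
  fix \<theta> :: real assume \<theta>: "0 < \<theta>" "\<theta> \<le> 1"
  have p: "p \<in> X"
    using min by (auto simp: is_arg_min_def)
  define v where "v = p + \<theta> *\<^sub>R (u - p)"
  have "v = (1 - \<theta>) *\<^sub>R p + \<theta> *\<^sub>R u"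
    by (simp add: v_def algebra_simps)
  then have "v \<in> X"
    using \<theta> p assms(1,5) by (simp add: convex_def)
  then have "q \<bullet> p + \<gamma> / 2 * sqnorm_wrt H (p - a) + 1 / 2 * sqnorm_wrt K (p - c)
      \<le> q \<bullet> v + \<gamma> / 2 * sqnorm_wrt H (v - a) + 1 / 2 * sqnorm_wrt K (v - c)"
    using min by (auto simp: is_arg_min_def not_less)
  moreover have "v - a = (p - a) + \<theta> *\<^sub>R (u - p)" "v - c = (p - c) + \<theta> *\<^sub>R (u - p)"
    by (simp_all add: v_def)
  moreover have "(p - a) \<bullet> (H *v (u - p)) = (H *v (p - a)) \<bullet> (u - p)"
    "(p - c) \<bullet> (K *v (u - p)) = (K *v (p - c)) \<bullet> (u - p)"
    using sym_inner_mult[OF assms(2)] sym_inner_mult[OF assms(3)] by (metis inner_commute)+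
  moreover have "q \<bullet> v = q \<bullet> p + \<theta> * (q \<bullet> (u - p))"
    by (simp add: v_def inner_add_right)
  ultimately have "0 \<le> \<theta> * (q \<bullet> (u - p))
      + \<gamma> / 2 * (2 * (\<theta> * ((H *v (p - a)) \<bullet> (u - p))) + \<theta>\<^sup>2 * sqnorm_wrt H (u - p))
      + 1 / 2 * (2 * (\<theta> * ((K *v (p - c)) \<bullet> (u - p))) + \<theta>\<^sup>2 * sqnorm_wrt K (u - p))"
    by (simp add: sqnorm_wrt_add[OF assms(2)] sqnorm_wrt_add[OF assms(3)] sqnorm_wrt_scaleR
        matrix_vector_mult_scaleR) (simp add: ring_distribs add_divide_distrib)
  then show "0 \<le> \<theta> * (q \<bullet> (u - p) + \<gamma> * ((H *v (p - a)) \<bullet> (u - p)) + (K *v (p - c)) \<bullet> (u - p))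
      + \<theta>\<^sup>2 * (\<gamma> / 2 * sqnorm_wrt H (u - p) + sqnorm_wrt K (u - p) / 2)"
    by (simp add: ring_distribs mult_ac)
qed

text \<open>The two sides differ by exactly
  \<open>r * (1 - r) * sqnorm_wrt G (u - v)\<close>.\<close>

lemma sqnorm_wrt_convex:
  assumes "pos_semidef G" "0 \<le> r" "r \<le> 1"
  shows "sqnorm_wrt G (r *\<^sub>R u + (1 - r) *\<^sub>R v) \<le> r * sqnorm_wrt G u + (1 - r) * sqnorm_wrt G v"
proof -
  have sym: "transpose G = G" using assms(1) by (rule pos_semidefD)
  have "0 \<le> r * (1 - r) * sqnorm_wrt G (u - v)"
    using assms by (intro mult_nonneg_nonneg pos_semidefD) auto
  then show ?thesis
    unfolding sqnorm_wrt_add[OF sym] sqnorm_wrt_diff[OF sym] sqnorm_wrt_scaleR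
    by (simp add: matrix_vector_mult_scaleR algebra_simps power2_eq_square)
qed

text \<open>The descent lemma without integration: up to a constant, \<open>\<psi>\<close> is the
  Taylor remainder along the segment minus the claimed quadratic, and the Lipschitz bound makes its
  derivative nonpositive.\<close>

lemma smooth_upper_bound:
  fixes f :: "real^'a \<Rightarrow> real"
  assumes "convex X" "pos_def H" "\<nu> > 0"
    and deriv: "\<And>u. u \<in> X \<Longrightarrow> GDERIV f u :> G u"
    and lip: "\<And>u v. u \<in> X \<Longrightarrow> v \<in> X \<Longrightarrow>
      norm_wrt (matrix_inv H) (G u - G v) \<le> \<nu> * norm_wrt H (u - v)"
    and "u \<in> X" "v \<in> X"
  shows "f v \<le> f u + G u \<bullet> (v - u) + \<nu> / 2 * sqnorm_wrt H (v - u)"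
proof -
  define d where "d = v - u"
  define \<psi> where "\<psi> r = f (u + r *\<^sub>R d) - r * (G u \<bullet> d) - \<nu> / 2 * sqnorm_wrt H d * r\<^sup>2" for r
  have seg: "u + r *\<^sub>R d \<in> X" if "0 \<le> r" "r \<le> 1" for r
  proof -
    have "u + r *\<^sub>R d = (1 - r) *\<^sub>R u + r *\<^sub>R v"
      by (simp add: d_def algebra_simps)
    then show ?thesis
      using that assms(1,6,7) by (simp add: convex_def)
  qed
  have "\<psi> 1 \<le> \<psi> 0"
  proof (rule DERIV_nonpos_imp_nonincreasing[where a=0 and b=1 and f=\<psi>])
    fix r :: real assume r: "0 \<le> r" "r \<le> 1"
    have *: "((\<lambda>r. f (u + r *\<^sub>R d)) has_derivative (\<lambda>h. (h *\<^sub>R d) \<bullet> G (u + r *\<^sub>R d))) (at r)"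
      by (rule has_derivative_compose[where g=f and f="\<lambda>r. u + r *\<^sub>R d", OF _ deriv[OF seg[OF r], unfolded gderiv_def]])
        (auto intro!: derivative_eq_intros)
    then have *: "((\<lambda>r. f (u + r *\<^sub>R d)) has_real_derivative (d \<bullet> G (u + r *\<^sub>R d))) (at r)"
      by (simp add: has_field_derivative_def mult_commute_abs)
    have "(\<psi> has_real_derivative (G (u + r *\<^sub>R d) - G u) \<bullet> d - \<nu> * r * sqnorm_wrt H d) (at r)"
      unfolding \<psi>_def by (auto intro!: derivative_eq_intros * simp: inner_diff_left inner_diff_right inner_commute)
    moreover have "(G (u + r *\<^sub>R d) - G u) \<bullet> d \<le> \<nu> * r * sqnorm_wrt H d"
    proof (cases "r = 0")
      case False
      then have r0: "r > 0" using r by simp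
      have "norm_wrt (matrix_inv H) (G (u + r *\<^sub>R d) - G u) \<le> \<nu> * norm_wrt H (r *\<^sub>R d)"
        using lip[OF seg[OF r] assms(6)] by simp
      then have "(norm_wrt (matrix_inv H) (G (u + r *\<^sub>R d) - G u))\<^sup>2 \<le> (\<nu> * norm_wrt H (r *\<^sub>R d))\<^sup>2"
        using pos_defD(2)[OF assms(2)] sqnorm_wrt_matrix_inv[OF assms(2)]
        by (intro power_mono) (auto simp: norm_wrt_def)
      also have "\<dots> = \<nu>\<^sup>2 * r\<^sup>2 * sqnorm_wrt H d"
        using pos_defD(2)[OF assms(2)] by (simp add: norm_wrt_def power_mult_distrib sqnorm_wrt_scaleR)
      finally have *: "(norm_wrt (matrix_inv H) (G (u + r *\<^sub>R d) - G u))\<^sup>2 \<le> \<nu>\<^sup>2 * r\<^sup>2 * sqnorm_wrt H d" .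
      \<comment> \<open>The weight \<open>1 / (\<nu> * r)\<close> balances Young's inequality: both
        terms become \<open>\<nu> * r / 2 * sqnorm_wrt H d\<close>. It makes sense only for positive
        \<open>r\<close>, hence the case distinction.\<close>
      have "(G (u + r *\<^sub>R d) - G u) \<bullet> d \<le> (1 / (\<nu> * r)) / 2 * (norm_wrt (matrix_inv H) (G (u + r *\<^sub>R d) - G u))\<^sup>2
          + 1 / (2 * (1 / (\<nu> * r))) * sqnorm_wrt H d"
        using r0 assms(3) by (intro Young_wrt assms(2)) auto
      also have "\<dots> \<le> (1 / (\<nu> * r)) / 2 * (\<nu>\<^sup>2 * r\<^sup>2 * sqnorm_wrt H d) + 1 / (2 * (1 / (\<nu> * r))) * sqnorm_wrt H d"
        using r0 assms(3) by (intro add_right_mono mult_left_mono *) auto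
      also have "\<dots> = \<nu> * r * sqnorm_wrt H d"
        using r0 assms(3) by (simp add: field_simps power2_eq_square)
      finally show ?thesis .
    qed simp
    ultimately show "\<exists>y. (\<psi> has_real_derivative y) (at r) \<and> y \<le> 0"
      by (intro exI conjI) auto
  qed simp
  then show ?thesis
    by (simp add: \<psi>_def d_def)
qed

lemma norm_wrt_minus: "norm_wrt G (- u) = norm_wrt G u"
  using sqnorm_wrt_scaleR[of G "-1" u] by (simp add: norm_wrt_def)

text \<open>The gradient of \<open>- f\<close> is equally Lipschitz, so the descent lemma for
  \<open>- f\<close> bounds \<open>f\<close> from below on the segment with an error of order
  \<open>\<theta>\<^sup>2\<close>. Convexity bounds it from above, and
  \<open>first_order_nonneg\<close> compares the two.\<close>

lemma convex_gradient_inequality: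
  fixes f :: "real^'a \<Rightarrow> real"
  assumes "convex_on X f" "pos_def H" "\<nu> > 0"
    and deriv: "\<And>u. u \<in> X \<Longrightarrow> GDERIV f u :> G u"
    and lip: "\<And>u v. u \<in> X \<Longrightarrow> v \<in> X \<Longrightarrow>
      norm_wrt (matrix_inv H) (G u - G v) \<le> \<nu> * norm_wrt H (u - v)"
    and "u \<in> X" "v \<in> X"
  shows "f u + G u \<bullet> (v - u) \<le> f v"
proof -
  have X: "convex X"
    using assms(1) by (simp add: convex_on_def)
  have "0 \<le> f v - f u - G u \<bullet> (v - u)"
  proof (rule first_order_nonneg)
    fix \<theta> :: real assume \<theta>: "0 < \<theta>" "\<theta> \<le> 1"
    define w where "w = (1 - \<theta>) *\<^sub>R u + \<theta> *\<^sub>R v"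
    have wu: "w - u = \<theta> *\<^sub>R (v - u)"
      by (simp add: w_def algebra_simps)
    have "w \<in> X"
      using \<theta> X assms(6,7) by (simp add: convex_def w_def)
    then have "- f w \<le> - f u + (- G u) \<bullet> (w - u) + \<nu> / 2 * sqnorm_wrt H (w - u)"
      using assms(3,6) X
      by (intro smooth_upper_bound[where X=X and G="\<lambda>u. - G u"] assms(2))
        (auto intro!: deriv GDERIV_minus simp: norm_wrt_minus[of "matrix_inv H" "G _ - G _", simplified] lip)
    moreover have "f w \<le> (1 - \<theta>) * f u + \<theta> * f v"
      unfolding w_def using convex_onD[OF assms(1), of \<theta> u v] \<theta> assms(6,7) by simp
    ultimately show "0 \<le> \<theta> * (f v - f u - G u \<bullet> (v - u)) + \<theta>\<^sup>2 * (\<nu> / 2 * sqnorm_wrt H (v - u))"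
      unfolding wu sqnorm_wrt_scaleR inner_minus_left inner_scaleR_right by (simp add: ring_distribs mult_ac)
  qed
  then show ?thesis by simp
qed

text \<open>Only the quadratic penalty is linearized; \<open>g\<close> is nonsmooth and survives as
  a difference of values. A test point with finite value makes \<open>g p\<close> finite by
  minimality, and convexity then keeps \<open>g\<close> finite on the whole segment, so that real
  arithmetic applies.\<close>

lemma arg_min_ext_VI:
  fixes B :: "real^'b^'c" and a :: "real^'c"
  assumes g: "ext_convex_on Y g"
    and min: "is_arg_min (\<lambda>u. g u + ereal (\<beta> / 2 * (norm (B *v u + a))\<^sup>2)) (\<lambda>u. u \<in> Y) p"
    and v: "v \<in> Y" "g v \<noteq> \<infinity>"
  shows "\<bar>g p\<bar> \<noteq> \<infinity>"
    and "0 \<le> real_of_ereal (g v) - real_of_ereal (g p) + \<beta> * ((B *v p + a) \<bullet> (B *v (v - p)))"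
proof -
  have p: "p \<in> Y"
    using min by (auto simp: is_arg_min_def)
  have le: "g p + ereal (\<beta> / 2 * (norm (B *v p + a))\<^sup>2) \<le> g w + ereal (\<beta> / 2 * (norm (B *v w + a))\<^sup>2)"
    if "w \<in> Y" for w
    using min that by (auto simp: is_arg_min_def not_less)
  obtain gv where gv: "g v = ereal gv"
    using g v by (cases "g v") (auto simp: ext_convex_on_def)
  obtain gp where gp: "g p = ereal gp"
    using g p le[OF v(1)] gv by (cases "g p") (auto simp: ext_convex_on_def)
  then show "\<bar>g p\<bar> \<noteq> \<infinity>" by simp
  have "0 \<le> gv - gp + \<beta> * ((B *v p + a) \<bullet> (B *v (v - p)))"
  proof (rule first_order_nonneg)
    fix \<theta> :: real assume \<theta>: "0 < \<theta>" "\<theta> \<le> 1"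
    define w where "w = (1 - \<theta>) *\<^sub>R p + \<theta> *\<^sub>R v"
    have wY: "w \<in> Y"
      using g p v \<theta> by (simp add: w_def ext_convex_on_def convex_def)
    have "g w \<le> ereal (1 - \<theta>) * g p + ereal \<theta> * g v"
      using g p v \<theta> unfolding w_def ext_convex_on_def by (smt (verit, best))
    then obtain gw where gw: "g w = ereal gw" "gw \<le> (1 - \<theta>) * gp + \<theta> * gv"
      using g wY gp gv by (cases "g w") (auto simp: ext_convex_on_def)
    have "gp + \<beta> / 2 * (norm (B *v p + a))\<^sup>2 \<le> gw + \<beta> / 2 * (norm (B *v w + a))\<^sup>2"
      using le[OF wY] gw gp by simp
    moreover have "B *v w + a = (B *v p + a) + \<theta> *\<^sub>R (B *v (v - p))"
      by (simp add: w_def matrix_vector_right_distrib matrix_vector_mult_diff_distrib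
          matrix_vector_mult_scaleR algebra_simps)
    then have "(norm (B *v w + a))\<^sup>2 = (norm (B *v p + a))\<^sup>2
        + 2 * \<theta> * ((B *v p + a) \<bullet> (B *v (v - p))) + \<theta>\<^sup>2 * (norm (B *v (v - p)))\<^sup>2"
      by (simp only: power2_norm_eq_inner) (simp add: algebra_simps inner_commute power2_eq_square)
    ultimately have "0 \<le> gw - gp + \<beta> / 2 * (2 * \<theta> * ((B *v p + a) \<bullet> (B *v (v - p)))
        + \<theta>\<^sup>2 * (norm (B *v (v - p)))\<^sup>2)"
      by (simp add: ring_distribs)
    moreover have "gw - gp \<le> \<theta> * (gv - gp)"
      using gw(2) by (simp add: ring_distribs)
    ultimately show "0 \<le> \<theta> * (gv - gp + \<beta> * ((B *v p + a) \<bullet> (B *v (v - p))))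
        + \<theta>\<^sup>2 * (\<beta> / 2 * (norm (B *v (v - p)))\<^sup>2)"
      by (simp add: ring_distribs mult_ac)
  qed
  then show "0 \<le> real_of_ereal (g v) - real_of_ereal (g p) + \<beta> * ((B *v p + a) \<bullet> (B *v (v - p)))"
    by (simp add: gv gp)
qed

lemma ergodic_mean_fst: "fst (ergodic_mean w k T) = ergodic_mean (\<lambda>k. fst (w k)) k T"
  and ergodic_mean_snd: "snd (ergodic_mean w k T) = ergodic_mean (\<lambda>k. snd (w k)) k T"
  by (simp_all add: ergodic_mean_def fst_sum snd_sum)

lemma ergodic_mean_convex:
  assumes "convex_on C h" "\<And>k. w k \<in> C"
  shows "ergodic_mean w k T \<in> C" "h (ergodic_mean w k T) \<le> ergodic_mean (\<lambda>k. h (w k)) k T"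
proof -
  have "(\<Sum>i = k..k + T. 1 / (1 + real T)) = 1"
    by (simp add: field_simps)
  moreover have "convex C"
    using assms(1) by (simp add: convex_on_def)
  moreover have "ergodic_mean w k T = (\<Sum>i = k..k + T. (1 / (1 + real T)) *\<^sub>R w i)"
    by (simp add: ergodic_mean_def scaleR_sum_right)
  moreover have "ergodic_mean (\<lambda>k. h (w k)) k T = (\<Sum>i = k..k + T. (1 / (1 + real T)) * h (w i))"
    by (simp add: ergodic_mean_def scaleR_sum_right sum_divide_distrib)
  ultimately show "ergodic_mean w k T \<in> C" "h (ergodic_mean w k T) \<le> ergodic_mean (\<lambda>k. h (w k)) k T"
    using convex_on_sum[OF _ _ assms(1), of "{k..k + T}" "\<lambda>_. 1 / (1 + real T)" w] assms(2)
    by (auto intro!: convex_sum)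
qed

text \<open>The difference of \<open>harm n\<close> and \<open>ln n\<close> decreases in
  \<open>n\<close> and equals 1 at \<open>n = 1\<close>.\<close>

lemma harm_le_ln: "n > 0 \<Longrightarrow> harm n \<le> 1 + ln (real n)"
proof -
  assume "n > 0"
  then obtain j where n: "n = Suc j"
    by (cases n) auto
  have "harm (Suc j) - ln (real (Suc j)) \<le> harm (Suc 0) - ln (real (Suc 0))"
    using decseqD[OF decseq_harm_diff_ln, of 0 j] by simp
  then show ?thesis
    by (simp add: n harm_def)
qed

section \<open>The pathwise ergodic bound\<close>

text \<open>Only the deterministic hypotheses are collected here, so that everything proved in this
  locale holds for each single realization.\<close>

locale as_admm_problem =
  fixes X :: "(real^'n1) set" and Y :: "(real^'n2) set"
    and N :: nat and fs :: "nat \<Rightarrow> real^'n1 \<Rightarrow> real" and f :: "real^'n1 \<Rightarrow> real"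
    and g :: "real^'n2 \<Rightarrow> ereal"
    and A :: "real^'n1^'n" and B :: "real^'n2^'n" and b :: "real^'n"
    and \<beta> s \<nu> c1 c2 c3 \<rho> :: real and M \<kappa> :: nat
    and H :: "real^'n1^'n1" and MM D :: "nat \<Rightarrow> real^'n1^'n1"
    and m :: "nat \<Rightarrow> nat" and \<eta> :: "nat \<Rightarrow> real"
    and x0 :: "real^'n1" and y0 :: "real^'n2" and l0 :: "real^'n"
  assumes closed_X: "closed X" and convex_X: "convex X" and convex_Y: "convex Y"
    and convex_g: "ext_convex_on Y g"
    and N_pos: "N > 0"
    and convex_fs: "\<And>j. j \<in> {1..N} \<Longrightarrow> convex_on X (fs j)"
    and differentiable_fs: "\<And>j u. j \<in> {1..N} \<Longrightarrow> u \<in> X \<Longrightarrow> fs j differentiable (at u)"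
    and f_eq: "\<And>u. f u = (1 / real N) * (\<Sum>j = 1..N. fs j u)"
    and \<beta>_pos: "\<beta> > 0" and s_pos: "0 < s" and s_le: "s \<le> (1 + sqrt 5) / 2" and pos_def_H: "pos_def H"
    and \<nu>_pos: "\<nu> > 0"
    and lipschitz_fs: "\<And>j u v. j \<in> {1..N} \<Longrightarrow> u \<in> X \<Longrightarrow> v \<in> X \<Longrightarrow>
           norm_wrt (matrix_inv H) (gradient (fs j) u - gradient (fs j) v)
             \<le> \<nu> * norm_wrt H (u - v)"
    and c1_pos: "c1 > 0" and c2_pos: "c2 > 0" and c3_pos: "c3 > 0" and \<rho>_ge: "\<rho> \<ge> 1" and M_pos: "M > 0"
    and m_eq: "\<And>k. m k = max (nat \<lceil>c3 * real k powr \<rho>\<rceil>) M"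
    and \<eta>_eq: "\<And>k. \<eta> k = min (c1 / (real (m k) * (real (m k) + 1))) c2"
    and sym_MM: "\<And>k. transpose (MM k) = MM k"
    and D_eq: "\<And>k. D k = MM k - \<beta> *\<^sub>R (transpose A ** A)"
    and D_mono: "\<And>k. loewner_ge (D k) (D (k + 1))" and D_psd: "\<And>k. pos_semidef (D k)"
    and x0_in: "x0 \<in> X" and y0_in: "y0 \<in> Y"
    and m_\<kappa>: "m \<kappa> = nat \<lceil>c3 * real \<kappa> powr \<rho>\<rceil>"
    and \<eta>_\<kappa>: "\<eta> \<kappa> = c1 / (real (m \<kappa>) * (real (m \<kappa>) + 1))" and \<eta>_\<kappa>_le: "\<eta> \<kappa> \<le> 1 / (2 * \<nu>)"
begin

abbreviation path where
  "path \<equiv> as_admm_path X Y fs g A B b \<beta> s H m \<eta> MM x0 y0 l0"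

text \<open>With \<open>r\<close> the residual at \<open>(u, v)\<close>, this is the gradient in
  \<open>u\<close> of the augmented coupling term
  \<open>- (l \<bullet> r) + \<beta> / 2 * (norm r)\<^sup>2\<close>.\<close>

abbreviation hvec :: "real^'n1 \<Rightarrow> real^'n2 \<Rightarrow> real^'n \<Rightarrow> real^'n1" where
  "hvec u v l \<equiv> - (transpose A *v (l - \<beta> *\<^sub>R residual A B b u v))"

lemma m_pos: "m k > 0"
  using M_pos by (simp add: m_eq)

lemma \<eta>_pos: "\<eta> k > 0"
  using c1_pos c2_pos m_pos[of k] by (simp add: \<eta>_eq)

text \<open>At 0 the power vanishes, which would make \<open>m \<kappa>\<close> zero although it is
  at least \<open>M\<close>. Hence \<open>y \<kappa>\<close> is already the outcome of a
  minimization, as \<open>y_monotone\<close> requires.\<close>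

lemma \<kappa>_pos: "\<kappa> \<ge> 1"
proof (rule ccontr)
  assume "\<not> \<kappa> \<ge> 1"
  then have "\<kappa> = 0"
    by simp
  then have "m \<kappa> = 0"
    using \<rho>_ge by (subst m_\<kappa>) simp
  then show False
    using m_pos[of \<kappa>] by simp
qed

lemma m_mono: "j \<le> k \<Longrightarrow> m j \<le> m k"
  using c3_pos \<rho>_ge unfolding m_eq
  by (intro max.mono nat_mono ceiling_mono mult_left_mono powr_mono2) auto

lemma m_ge: "c3 * real k powr \<rho> \<le> real (m k)"
  unfolding m_eq by linarith

text \<open>The quotient decreases as \<open>m k\<close> grows and is at most \<open>c2\<close> at
  \<kappa>, so the cap \<open>c2\<close> is inactive from \<kappa> on, and the bound by
  \<open>1 / (2 * \<nu>)\<close> persists.\<close>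

lemma \<eta>_tail:
  assumes "\<kappa> \<le> k"
  shows "\<eta> k = c1 / (real (m k) * (real (m k) + 1))" "\<eta> k \<le> 1 / (2 * \<nu>)"
proof -
  have "c1 / (real (m k) * (real (m k) + 1)) \<le> c1 / (real (m \<kappa>) * (real (m \<kappa>) + 1))"
    using m_mono[OF assms] m_pos[of \<kappa>] c1_pos m_pos[of k]
    by (intro divide_left_mono mult_mono mult_pos_pos) auto
  also have "\<dots> \<le> c2"
    using \<eta>_\<kappa> \<eta>_eq[of \<kappa>] by simp
  finally show "\<eta> k = c1 / (real (m k) * (real (m k) + 1))"
    by (simp add: \<eta>_eq)
  then show "\<eta> k \<le> 1 / (2 * \<nu>)"
    using \<eta>_\<kappa> \<eta>_\<kappa>_le \<open>c1 / (real (m k) * (real (m k) + 1)) \<le> c1 / (real (m \<kappa>) * (real (m \<kappa>) + 1))\<close> by simp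
qed

text \<open>The \<open>D\<close>-part telescopes over the outer iterations because \<open>D\<close>
  is nonincreasing; the part with \<open>A\<close> cancels against residual terms in
  \<open>outer_step\<close>.\<close>

lemma MM_eq: "sqnorm_wrt (MM k) u = sqnorm_wrt (D k) u + \<beta> * (norm (A *v u))\<^sup>2"
proof -
  have "MM k = D k + \<beta> *\<^sub>R (transpose A ** A)"
    by (simp add: D_eq)
  then have "sqnorm_wrt (MM k) u = sqnorm_wrt (D k) u + \<beta> * (u \<bullet> ((transpose A ** A) *v u))"
    by (simp add: sqnorm_wrt_def matrix_vector_mult_add_rdistrib inner_add_right scaleR_matrix_vector_assoc[symmetric])
  moreover have "u \<bullet> ((transpose A ** A) *v u) = (norm (A *v u))\<^sup>2"
    by (metis inner_commute inner_transpose_mult matrix_vector_mul_assoc power2_norm_eq_inner)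
  ultimately show ?thesis by simp
qed

lemma MM_psd: "pos_semidef (MM k)"
  using sym_MM MM_eq[of k] pos_semidefD(2)[OF D_psd] \<beta>_pos
  by (auto simp: pos_semidef_def sqnorm_wrt_def)

lemma D_antimono: "sqnorm_wrt (D (Suc k)) u \<le> sqnorm_wrt (D k) u"
  using D_mono[of k]
  by (auto simp: loewner_ge_def pos_semidef_def sqnorm_wrt_def matrix_vector_mult_diff_rdistrib inner_diff_right)

lemma GDERIV_fs: "j \<in> {1..N} \<Longrightarrow> u \<in> X \<Longrightarrow> GDERIV (fs j) u :> gradient (fs j) u"
  by (intro gderiv_gradient differentiable_fs)

lemma gradient_f:
  assumes "u \<in> X"
  shows "gradient f u = (1 / real N) *\<^sub>R (\<Sum>j = 1..N. gradient (fs j) u)"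
proof -
  have "((\<lambda>u. (1 / real N) * (\<Sum>j = 1..N. fs j u)) has_derivative
      (\<lambda>h. (1 / real N) * (\<Sum>j = 1..N. h \<bullet> gradient (fs j) u))) (at u)"
    using GDERIV_fs assms unfolding gderiv_def
    by (intro has_derivative_mult_right has_derivative_sum) auto
  then have G: "GDERIV f u :> (1 / real N) *\<^sub>R (\<Sum>j = 1..N. gradient (fs j) u)"
    unfolding gderiv_def f_eq[abs_def] by (simp add: inner_sum_right)
  then have "f differentiable (at u)"
    by (auto simp: gderiv_def differentiable_def)
  from gderiv_gradient[OF this] G show ?thesis
    unfolding gderiv_def by (metis has_derivative_unique vector_eq_ldot)
qed

lemma f_upper_bound:
  assumes "u \<in> X" "v \<in> X"
  shows "f v \<le> f u + gradient f u \<bullet> (v - u) + \<nu> / 2 * sqnorm_wrt H (v - u)"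
proof -
  have "(\<Sum>j = 1..N. fs j v) \<le>
      (\<Sum>j = 1..N. fs j u + gradient (fs j) u \<bullet> (v - u) + \<nu> / 2 * sqnorm_wrt H (v - u))"
    using assms GDERIV_fs lipschitz_fs \<nu>_pos
    by (intro sum_mono smooth_upper_bound[OF convex_X pos_def_H]) auto
  also have "\<dots> = (\<Sum>j = 1..N. fs j u) + (\<Sum>j = 1..N. gradient (fs j) u) \<bullet> (v - u)
      + real N * (\<nu> / 2 * sqnorm_wrt H (v - u))"
    by (simp add: sum.distrib inner_sum_left)
  finally have "(1 / real N) * (\<Sum>j = 1..N. fs j v) \<le> (1 / real N) * ((\<Sum>j = 1..N. fs j u)
      + (\<Sum>j = 1..N. gradient (fs j) u) \<bullet> (v - u) + real N * (\<nu> / 2 * sqnorm_wrt H (v - u)))"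
    by (intro mult_left_mono) auto
  also have "\<dots> = f u + gradient f u \<bullet> (v - u) + \<nu> / 2 * sqnorm_wrt H (v - u)"
    using N_pos by (simp add: f_eq gradient_f[OF assms(1)] field_simps)
  finally show ?thesis
    by (simp add: f_eq)
qed

lemma f_lower_bound:
  assumes "u \<in> X" "v \<in> X"
  shows "f u + gradient f u \<bullet> (v - u) \<le> f v"
proof -
  have "(\<Sum>j = 1..N. fs j u + gradient (fs j) u \<bullet> (v - u)) \<le> (\<Sum>j = 1..N. fs j v)"
    using assms GDERIV_fs lipschitz_fs \<nu>_pos convex_fs
    by (intro sum_mono convex_gradient_inequality[where X=X and H=H and \<nu>=\<nu>] pos_def_H) auto
  then have "(1 / real N) * (\<Sum>j = 1..N. fs j u + gradient (fs j) u \<bullet> (v - u))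
      \<le> (1 / real N) * (\<Sum>j = 1..N. fs j v)"
    by (intro mult_left_mono) auto
  then show ?thesis
    by (simp add: f_eq gradient_f[OF assms(1)] sum.distrib inner_sum_left ring_distribs)
qed

lemma convex_f: "convex_on X f"
proof -
  have "convex_on X (\<lambda>u. \<Sum>j\<in>J. fs j u)" if "finite J" "J \<subseteq> {1..N}" for J
    using that
  proof (induction J)
    case empty
    show ?case by (simp add: convex_on_const[unfolded convex_on_def] convex_on_def convex_X)
  next
    case (insert j J)
    then show ?case
      using convex_on_add[of X "fs j" "\<lambda>u. \<Sum>j\<in>J. fs j u"] convex_fs[of j] by simp
  qed
  then have "convex_on X (\<lambda>u. (1 / real N) * (\<Sum>j = 1..N. fs j u))"
    by (intro convex_on_cmul) auto
  then show ?thesis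
    by (simp add: f_eq[abs_def])
qed

section \<open>The accelerated inner loop\<close>

lemma accel_in_X:
  assumes "t \<ge> 1" "u \<in> X" "v \<in> X"
  shows "accel t u v \<in> X"
  unfolding accel_def using assms by (intro convexD_alt[OF convex_X, of v u, simplified add.commute]) auto

text \<open>Here \<open>u\<close> is the comparison point and \<open>c\<close> the proximal center.
  The extra term in \<open>v - u\<close> is the strong convexity gain of the proximal term at its
  minimizer. Everything is convex in \<open>v\<close>, so averaging with the previous inner iterate
  is allowed.\<close>

definition model :: "nat \<Rightarrow> real^'n1 \<Rightarrow> real^'n1 \<Rightarrow> real^'n1 \<Rightarrow> real^'n1 \<Rightarrow> real" where
  "model k h c u v = f v - f u + h \<bullet> (v - u) + sqnorm_wrt (MM k) (v - u) / 2 + sqnorm_wrt (MM k) (v - c) / 2"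

text \<open>With \<open>r = 2 / (t + 1)\<close>, the averaging gives
  \<open>model(z') \<le> (1 - r) * model(z) + r * R\<close>. Multiplication by
  \<open>t * (t + 1)\<close> turns \<open>1 - r\<close> into \<open>t * (t - 1)\<close>, the weight
  of the previous step, and \<open>r\<close> into \<open>2 * t\<close>, which cancels the
  \<open>t\<close> in the proximal weight and leaves the constant
  \<open>2 / \<eta> k\<close>.\<close>

lemma inner_step:
  fixes h c d a z u :: "real^'n1" and t k :: nat
  defines "xh \<equiv> accel t a z"
  defines "\<delta> \<equiv> gradient f xh - d"
  assumes t: "t \<ge> 1" and \<eta>: "\<eta> k \<le> 1 / (2 * \<nu>)"
    and in_X: "a \<in> X" "z \<in> X" "u \<in> X"
    and min: "is_arg_min (\<lambda>u. (d + h) \<bullet> u + 2 / (real t * \<eta> k) / 2 * sqnorm_wrt H (u - a)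
        + 1 / 2 * sqnorm_wrt (MM k) (u - c)) (\<lambda>u. u \<in> X) a'"
    and z': "z' = accel t a' z"
  shows "real t * (real t + 1) * model k h c u z' \<le> real t * (real t - 1) * model k h c u z
    + 2 / \<eta> k * (sqnorm_wrt H (u - a) - sqnorm_wrt H (u - a')) + real t * sqnorm_wrt (MM k) (u - c)
    + (2 * real t * (\<delta> \<bullet> (a - u)) + (real t)\<^sup>2 * \<eta> k * (norm_wrt (matrix_inv H) \<delta>)\<^sup>2)"
proof -
  define r where "r = 2 / (real t + 1)"
  have r: "0 \<le> r" "r \<le> 1"
    using t by (auto simp: r_def)
  have a': "a' \<in> X"
    using min by (auto simp: is_arg_min_def)
  have xh: "xh \<in> X" and z'X: "z' \<in> X"
    using accel_in_X t in_X a' by (auto simp: xh_def z')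
  have z'_eq: "z' = r *\<^sub>R a' + (1 - r) *\<^sub>R z" and xh_eq: "xh = r *\<^sub>R a + (1 - r) *\<^sub>R z"
    by (simp_all add: z' xh_def accel_def r_def)
  define G where "G = gradient f xh"
  define S where "S = sqnorm_wrt H (a' - a)"
  define K where "K = sqnorm_wrt (MM k)"
  have "f z' \<le> f xh + G \<bullet> (z' - xh) + \<nu> / 2 * sqnorm_wrt H (z' - xh)"
    unfolding G_def by (intro f_upper_bound xh z'X)
  also have "z' - xh = r *\<^sub>R (a' - a)"
    by (simp add: z'_eq xh_eq algebra_simps)
  also have "sqnorm_wrt H (r *\<^sub>R (a' - a)) = r\<^sup>2 * S"
    by (simp add: sqnorm_wrt_scaleR S_def)
  \<comment> \<open>The directions to \<open>z\<close> and \<open>u\<close> are treated by convexity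
    of \<open>f\<close> at \<open>xh\<close>; only the direction \<open>a' - u\<close> is left for
    the optimality of the proximal point.\<close>
  also have "r *\<^sub>R (a' - a) = (1 - r) *\<^sub>R (z - xh) + r *\<^sub>R (u - xh) + r *\<^sub>R (a' - u)"
    by (simp add: xh_eq algebra_simps)
  finally have 1: "f z' \<le> f xh + ((1 - r) * (G \<bullet> (z - xh)) + r * (G \<bullet> (u - xh)) + r * (G \<bullet> (a' - u)))
      + \<nu> / 2 * (r\<^sup>2 * S)"
    by (simp add: inner_add_right)
  have "(1 - r) * (f xh + G \<bullet> (z - xh)) \<le> (1 - r) * f z" "r * (f xh + G \<bullet> (u - xh)) \<le> r * f u"
    unfolding G_def using r xh in_X by (intro mult_left_mono f_lower_bound; simp)+
  with 1 have 2: "f z' \<le> (1 - r) * f z + r * f u + r * (G \<bullet> (a' - u)) + \<nu> / 2 * (r\<^sup>2 * S)"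
    by (simp add: ring_distribs)
  have "0 \<le> (d + h) \<bullet> (u - a') + 2 / (real t * \<eta> k) * ((H *v (a' - a)) \<bullet> (u - a'))
      + (MM k *v (a' - c)) \<bullet> (u - a')"
    by (rule arg_min_quadratic_VI[OF convex_X pos_defD(1)[OF pos_def_H] sym_MM min in_X(3)])
  moreover have half: "2 / w * (y / 2) = 1 / w * y" for w y :: real
    by simp
  ultimately have 3: "0 \<le> (d + h) \<bullet> (u - a')
      + 1 / (real t * \<eta> k) * (sqnorm_wrt H (u - a) - sqnorm_wrt H (u - a') - S)
      + (K (u - c) - K (u - a') - K (a' - c)) / 2"
    unfolding sqnorm_wrt_three_point[OF pos_defD(1)[OF pos_def_H]] sqnorm_wrt_three_point[OF sym_MM]
      half S_def K_def by blast
  have t\<eta>: "real t * \<eta> k > 0"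
    using t \<eta>_pos[of k] by simp
  \<comment> \<open>The new point \<open>a'\<close> depends on \<open>d\<close>, so \<delta> is
    paired with the old point \<open>a\<close>, where the cross term will have mean zero. The
    remainder \<open>\<delta> \<bullet> (a' - a)\<close> uses up half of the proximal gain
    \<open>1 / (real t * \<eta> k) * S\<close>.\<close>
  have "\<delta> \<bullet> (a' - a) \<le> real t * \<eta> k / 2 * (norm_wrt (matrix_inv H) \<delta>)\<^sup>2 + 1 / (2 * (real t * \<eta> k)) * S"
    unfolding S_def by (rule Young_wrt[OF pos_def_H t\<eta>])
  moreover have "G \<bullet> (a' - u) = - (d \<bullet> (u - a')) + \<delta> \<bullet> (a - u) + \<delta> \<bullet> (a' - a)"
    by (simp add: \<delta>_def G_def inner_diff_left inner_diff_right)
  ultimately have 4: "G \<bullet> (a' - u) \<le> - (d \<bullet> (u - a')) + \<delta> \<bullet> (a - u)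
      + real t * \<eta> k / 2 * (norm_wrt (matrix_inv H) \<delta>)\<^sup>2 + 1 / (2 * (real t * \<eta> k)) * S"
    by simp
  have S0: "S \<ge> 0"
    unfolding S_def using pos_def_H by (rule pos_defD)
  \<comment> \<open>The other half of the proximal gain absorbs the curvature term, since
    \<open>2 * \<nu> * t * \<eta> k \<le> t + 1\<close>.\<close>
  have "\<nu> * \<eta> k \<le> 1 / 2"
    using \<eta> \<nu>_pos by (simp add: field_simps)
  then have "(\<nu> * \<eta> k) * (2 * real t) \<le> 1 / 2 * (2 * real t)"
    by (intro mult_right_mono) auto
  then have "\<nu> * (real t * (\<eta> k * 2)) \<le> 1 + real t"
    by (simp add: mult_ac)
  then have "\<nu> * r \<le> 1 / (real t * \<eta> k)"
    using t \<eta>_pos[of k] by (simp add: r_def field_simps)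
  then have 5: "\<nu> / 2 * r * S \<le> 1 / (2 * (real t * \<eta> k)) * S"
    using S0 by (intro mult_right_mono) auto
  have Ku: "K (z' - w) \<le> r * K (a' - w) + (1 - r) * K (z - w)" for w
  proof -
    have "z' - w = r *\<^sub>R (a' - w) + (1 - r) *\<^sub>R (z - w)"
      by (simp add: z'_eq algebra_simps)
    then show ?thesis
      unfolding K_def using sqnorm_wrt_convex[OF MM_psd r] by simp
  qed
  have hz: "h \<bullet> (z' - u) = r * (h \<bullet> (a' - u)) + (1 - r) * (h \<bullet> (z - u))"
    by (simp add: z'_eq inner_diff_right inner_add_right algebra_simps)
  define R where "R = 1 / (real t * \<eta> k) * (sqnorm_wrt H (u - a) - sqnorm_wrt H (u - a'))
      + K (u - c) / 2 + \<delta> \<bullet> (a - u) + real t * \<eta> k / 2 * (norm_wrt (matrix_inv H) \<delta>)\<^sup>2"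
  have "G \<bullet> (a' - u) + h \<bullet> (a' - u) + K (a' - u) / 2 + K (a' - c) / 2 + \<nu> / 2 * r * S \<le> R"
  proof -
    have "(d + h) \<bullet> (u - a') = d \<bullet> (u - a') - h \<bullet> (a' - u)"
      by (simp add: inner_diff_right inner_add_left)
    moreover have "K (u - a') = K (a' - u)"
      unfolding K_def by (rule sqnorm_wrt_minus_commute)
    moreover have "1 / (real t * \<eta> k) * S = 1 / (2 * (real t * \<eta> k)) * S + 1 / (2 * (real t * \<eta> k)) * S"
      using t\<eta> by (simp add: field_simps)
    ultimately show ?thesis
      using 3 4 5 unfolding R_def right_diff_distrib add_divide_distrib diff_divide_distrib by linarith
  qed
  then have "r * (G \<bullet> (a' - u) + h \<bullet> (a' - u) + K (a' - u) / 2 + K (a' - c) / 2 + \<nu> / 2 * r * S) \<le> r * R"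
    using r by (intro mult_left_mono) auto
  then have "model k h c u z' \<le> (1 - r) * model k h c u z + r * R"
    using 2 Ku[of u] Ku[of c] unfolding model_def hz K_def[symmetric]
    by (simp add: ring_distribs add_divide_distrib diff_divide_distrib power2_eq_square mult_ac)
  then have "real t * (real t + 1) * model k h c u z' \<le> real t * (real t + 1) * ((1 - r) * model k h c u z + r * R)"
    by (intro mult_left_mono) auto
  also have "\<dots> = (real t * ((real t + 1) * (1 - r))) * model k h c u z + real t * ((real t + 1) * r) * R"
    by (simp only: ring_distribs mult_ac)
  also have "(real t + 1) * r = 2"
    by (simp add: r_def field_simps)
  also have "(real t + 1) * (1 - r) = real t - 1"
    by (simp add: r_def field_simps)
  also have "real t * 2 * R = 2 / \<eta> k * (sqnorm_wrt H (u - a) - sqnorm_wrt H (u - a')) + real t * K (u - c)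
    + (2 * real t * (\<delta> \<bullet> (a - u)) + (real t)\<^sup>2 * \<eta> k * (norm_wrt (matrix_inv H) \<delta>)\<^sup>2)"
  proof -
    have "real t * 2 * (1 / (real t * \<eta> k)) = 2 / \<eta> k"
      using t\<eta> t by simp
    then have "real t * 2 * (1 / (real t * \<eta> k) * w) = 2 / \<eta> k * w" for w
      by (metis mult.assoc)
    then show ?thesis
      unfolding R_def distrib_left by (simp add: power2_eq_square)
  qed
  finally show ?thesis
    by (simp add: K_def)
qed

definition sgrad where
  "sgrad \<xi> e z zb k t = stoch_grad fs (\<xi> k t) (e k t) (accel t (zb k t) (z k t))" for k t :: nat

definition grad_error where
  "grad_error \<xi> e z zb k t = gradient f (accel t (zb k t) (z k t)) - sgrad \<xi> e z zb k t" for k t :: nat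

lemma pathD:
  assumes "path \<xi> e x xb y l z zb"
  shows "x 0 = x0" "xb 0 = x0" "y 0 = y0" "l 0 = l0"
    and "z k 1 = x k" "zb k 1 = xb k"
    and "t \<in> {1..m k} \<Longrightarrow> is_arg_min (\<lambda>u. (sgrad \<xi> e z zb k t + hvec (x k) (y k) (l k)) \<bullet> u
           + 2 / (real t * \<eta> k) / 2 * sqnorm_wrt H (u - zb k t)
           + 1 / 2 * sqnorm_wrt (MM k) (u - x k)) (\<lambda>u. u \<in> X) (zb k (t + 1))"
    and "t \<in> {1..m k} \<Longrightarrow> z k (t + 1) = accel t (zb k (t + 1)) (z k t)"
    and "x (Suc k) = z k (m k + 1)" "xb (Suc k) = zb k (m k + 1)"
    and "is_arg_min (\<lambda>u. g u + ereal (\<beta> / 2 * (norm (residual A B b (x (Suc k)) u - (1 / \<beta>) *\<^sub>R l k))\<^sup>2))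
          (\<lambda>u. u \<in> Y) (y (Suc k))"
    and "l (Suc k) = l k - (s * \<beta>) *\<^sub>R residual A B b (x (Suc k)) (y (Suc k))"
  using assms unfolding as_admm_path_def Let_def sgrad_def Suc_eq_plus1 by blast+

lemma path_in_X:
  assumes "path \<xi> e x xb y l z zb"
  shows "x k \<in> X" "xb k \<in> X" "t \<in> {1..m k + 1} \<Longrightarrow> z k t \<in> X" "t \<in> {1..m k + 1} \<Longrightarrow> zb k t \<in> X"
proof -
  note p = pathD[OF assms]
  have inner: "z k t \<in> X \<and> zb k t \<in> X" if "x k \<in> X" "xb k \<in> X" "t \<in> {1..m k + 1}" for k t
    using that(3)
  proof (induction t)
    case (Suc t)
    show ?case
    proof (cases "t = 0")
      case True
      then show ?thesis
        using that p(5,6)[of k] by simp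
    next
      case False
      then have t: "t \<in> {1..m k}"
        using Suc.prems by simp
      have "zb k (t + 1) \<in> X"
        using p(7)[OF t] by (simp add: is_arg_min_def)
      then show ?thesis
        using p(8)[OF t] Suc.IH t accel_in_X[of t "zb k (t + 1)" "z k t"] by simp
    qed
  qed simp
  have outer: "x k \<in> X \<and> xb k \<in> X" for k
  proof (induction k)
    case 0
    then show ?case
      using p(1,2) x0_in by simp
  next
    case (Suc k)
    then show ?case
      using inner[of k "m k + 1"] p(9,10)[of k] by simp
  qed
  from outer show "x k \<in> X" "xb k \<in> X" by auto
  from inner outer show "t \<in> {1..m k + 1} \<Longrightarrow> z k t \<in> X" "t \<in> {1..m k + 1} \<Longrightarrow> zb k t \<in> X" by auto
qed

lemma path_y_in_Y:
  assumes "path \<xi> e x xb y l z zb"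
  shows "y k \<in> Y"
  using pathD(3)[OF assms] pathD(11)[OF assms, of "k - 1"] y0_in
  by (cases k) (auto simp: is_arg_min_def)

text \<open>The first summand is linear in the error and paired with a point known before the sample
  is drawn; the second is the quadratic cost of Young's inequality.\<close>

definition noise_term where
  "noise_term \<xi> e z zb k u t = 2 * real t * (grad_error \<xi> e z zb k t \<bullet> (zb k t - u))
     + (real t)\<^sup>2 * \<eta> k * (norm_wrt (matrix_inv H) (grad_error \<xi> e z zb k t))\<^sup>2" for k t :: nat

definition noise where
  "noise \<xi> e z zb u k = (\<Sum>t = 1..m k. noise_term \<xi> e z zb k u t) / (real (m k) * (real (m k) + 1))" for k :: nat

lemma inner_loop:
  assumes path: "path \<xi> e x xb y l z zb" and k: "\<kappa> \<le> k" and u: "u \<in> X"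
  shows "model k (hvec (x k) (y k) (l k)) (x k) u (x (Suc k))
    \<le> 2 / c1 * (sqnorm_wrt H (u - xb k) - sqnorm_wrt H (u - xb (Suc k)))
      + sqnorm_wrt (MM k) (u - x k) / 2 + noise \<xi> e z zb u k"
proof -
  note p = pathD[OF path]
  let ?\<Psi> = "\<lambda>t. model k (hvec (x k) (y k) (l k)) (x k) u (z k t)"
  \<comment> \<open>The weight on the left is 0 for \<open>t = 0\<close>, so the model value at the
    starting point \<open>x k\<close> never enters. The factor \<open>t * (t + 1) / 2\<close> of the
    proximal term is the sum of the first \<open>t\<close> integers.\<close>
  have sum: "real t * (real t + 1) * ?\<Psi> (t + 1)
      \<le> 2 / \<eta> k * (sqnorm_wrt H (u - xb k) - sqnorm_wrt H (u - zb k (t + 1)))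
        + real t * (real t + 1) * (sqnorm_wrt (MM k) (u - x k) / 2) + (\<Sum>r = 1..t. noise_term \<xi> e z zb k u r)"
    if "t \<le> m k" for t
    using that
  proof (induction t)
    case 0
    then show ?case
      using p(6)[of k] by simp
  next
    case (Suc t)
    let ?t = "Suc t"
    have t: "?t \<in> {1..m k}" "t \<le> m k"
      using Suc.prems by auto
    have "real ?t * (real ?t + 1) * ?\<Psi> (?t + 1) \<le> real ?t * (real ?t - 1) * ?\<Psi> ?t
        + 2 / \<eta> k * (sqnorm_wrt H (u - zb k ?t) - sqnorm_wrt H (u - zb k (?t + 1)))
        + real ?t * sqnorm_wrt (MM k) (u - x k) + noise_term \<xi> e z zb k u ?t"
      unfolding noise_term_def grad_error_def
      using t path_in_X[OF path] u p(7)[OF t(1)] p(8)[OF t(1)] \<eta>_tail(2)[OF k]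
      by (intro inner_step) auto
    also have "real ?t * (real ?t - 1) * ?\<Psi> ?t = real t * (real t + 1) * ?\<Psi> (t + 1)"
      by simp
    also note Suc.IH[OF t(2)]
    finally show ?case
      by (simp add: ring_distribs add_divide_distrib diff_divide_distrib)
  qed
  have M: "real (m k) * (real (m k) + 1) > 0"
    using m_pos[of k] by simp
  have "real (m k) * (real (m k) + 1) * ?\<Psi> (m k + 1)
      \<le> 2 / \<eta> k * (sqnorm_wrt H (u - xb k) - sqnorm_wrt H (u - zb k (m k + 1)))
        + real (m k) * (real (m k) + 1) * (sqnorm_wrt (MM k) (u - x k) / 2)
        + (\<Sum>r = 1..m k. noise_term \<xi> e z zb k u r)"
    by (rule sum) simp
  also have "2 / \<eta> k = real (m k) * (real (m k) + 1) * (2 / c1)"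
    using c1_pos M by (simp add: \<eta>_tail(1)[OF k])
  also have "(\<Sum>r = 1..m k. noise_term \<xi> e z zb k u r) = real (m k) * (real (m k) + 1) * noise \<xi> e z zb u k"
    using M by (simp add: noise_def)
  finally have "real (m k) * (real (m k) + 1) * ?\<Psi> (m k + 1) \<le> real (m k) * (real (m k) + 1) *
      (2 / c1 * (sqnorm_wrt H (u - xb k) - sqnorm_wrt H (u - xb (Suc k)))
      + sqnorm_wrt (MM k) (u - x k) / 2 + noise \<xi> e z zb u k)"
    using p(10)[of k] by (simp only: distrib_left mult.assoc)
  then show ?thesis
    using M p(9)[of k] by (simp only: mult_le_cancel_left_pos)
qed

section \<open>The y-step, the multiplier step and the decrease of the potential\<close>

abbreviation gr :: "real^'n2 \<Rightarrow> real" where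
  "gr v \<equiv> real_of_ereal (g v)"

text \<open>Optimality of the new \<open>y\<close>, with the penalty gradient rewritten through the
  residual. The vector \<open>l k - \<beta> *\<^sub>R residual ...\<close> is the multiplier that a
  full step (\<open>s = 1\<close>) would produce; the relaxation \<open>s\<close> enters only
  through the true update.\<close>

lemma y_step:
  assumes path: "path \<xi> e x xb y l z zb" and v: "v \<in> Y" "g v \<noteq> \<infinity>"
  shows "\<bar>g (y (Suc k))\<bar> \<noteq> \<infinity>"
    and "gr (y (Suc k)) - gr v \<le>
      (l k - \<beta> *\<^sub>R residual A B b (x (Suc k)) (y (Suc k))) \<bullet> (B *v (y (Suc k) - v))"
proof -
  have *: "residual A B b (x (Suc k)) u - (1 / \<beta>) *\<^sub>R l k = B *v u + (A *v x (Suc k) - b - (1 / \<beta>) *\<^sub>R l k)" for u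
    by (simp add: residual_def)
  note min = pathD(11)[OF path, of k, unfolded *]
  show "\<bar>g (y (Suc k))\<bar> \<noteq> \<infinity>"
    by (rule arg_min_ext_VI(1)[OF convex_g min v])
  have "0 \<le> gr v - gr (y (Suc k)) + \<beta> * ((B *v y (Suc k) + (A *v x (Suc k) - b - (1 / \<beta>) *\<^sub>R l k)) \<bullet> (B *v (v - y (Suc k))))"
    by (rule arg_min_ext_VI(2)[OF convex_g min v])
  also have "B *v (v - y (Suc k)) = - (B *v (y (Suc k) - v))"
    by (simp add: matrix_vector_mult_diff_distrib)
  also have "\<beta> * ((B *v y (Suc k) + (A *v x (Suc k) - b - (1 / \<beta>) *\<^sub>R l k)) \<bullet> - (B *v (y (Suc k) - v)))
      = (\<beta> *\<^sub>R (B *v y (Suc k) + (A *v x (Suc k) - b - (1 / \<beta>) *\<^sub>R l k))) \<bullet> - (B *v (y (Suc k) - v))"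
    by simp
  also have "\<beta> *\<^sub>R (B *v y (Suc k) + (A *v x (Suc k) - b - (1 / \<beta>) *\<^sub>R l k))
      = - (l k - \<beta> *\<^sub>R residual A B b (x (Suc k)) (y (Suc k)))"
    using \<beta>_pos by (simp add: residual_def algebra_simps)
  finally show "gr (y (Suc k)) - gr v \<le>
      (l k - \<beta> *\<^sub>R residual A B b (x (Suc k)) (y (Suc k))) \<bullet> (B *v (y (Suc k) - v))"
    unfolding inner_minus_left inner_minus_right by simp
qed

text \<open>Comparing two consecutive \<open>y\<close>-subproblems replaces the new residual by the old one.\<close>

lemma y_monotone:
  assumes path: "path \<xi> e x xb y l z zb" and v: "v \<in> Y" "g v \<noteq> \<infinity>" and k: "k \<ge> 1"
  shows "(B *v (y (Suc k) - y k)) \<bullet> residual A B b (x (Suc k)) (y (Suc k))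
    \<le> (1 - s) * ((B *v (y (Suc k) - y k)) \<bullet> residual A B b (x k) (y k))"
proof -
  obtain j where j: "k = Suc j"
    using k by (cases k) auto
  define d where "d = B *v (y (Suc k) - y k)"
  define r where "r = residual A B b (x k) (y k)"
  define r' where "r' = residual A B b (x (Suc k)) (y (Suc k))"
  have yk: "y k \<in> Y" "g (y k) \<noteq> \<infinity>" "y (Suc k) \<in> Y" "g (y (Suc k)) \<noteq> \<infinity>"
    using path_y_in_Y[OF path] y_step(1)[OF path v, of k] y_step(1)[OF path v, of j] j by auto
  have "gr (y (Suc k)) - gr (y k) \<le> (l k - \<beta> *\<^sub>R r') \<bullet> d"
    using y_step(2)[OF path yk(1,2), of k] by (simp add: d_def r'_def)
  moreover have "gr (y k) - gr (y (Suc k)) \<le> (l j - \<beta> *\<^sub>R r) \<bullet> (B *v (y k - y (Suc k)))"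
    using y_step(2)[OF path yk(3,4), of j] j by (simp add: r_def)
  moreover have "B *v (y k - y (Suc k)) = - d"
    by (simp add: d_def matrix_vector_mult_diff_distrib)
  \<comment> \<open>Expressing the older multiplier by the newer one cancels the multipliers and
    leaves the factor \<open>1 - s\<close> on the old residual.\<close>
  moreover have "l j = l k + (s * \<beta>) *\<^sub>R r"
    using pathD(12)[OF path, of j] j by (simp add: r_def)
  ultimately have "0 \<le> (l k - \<beta> *\<^sub>R r') \<bullet> d - (l k + (s * \<beta>) *\<^sub>R r - \<beta> *\<^sub>R r) \<bullet> d"
    by simp
  also have "\<dots> = \<beta> * ((1 - s) * (d \<bullet> r) - d \<bullet> r')"
    by (simp add: inner_diff_left inner_add_left inner_commute algebra_simps)
  finally show ?thesis
    using \<beta>_pos by (simp add: zero_le_mult_iff d_def r_def r'_def)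
qed

text \<open>The last summand absorbs the cross term left by \<open>y_monotone\<close>; this needs
  \<open>(1 - s)\<^sup>2 \<le> 2 - s\<close>, which for \<open>s > 0\<close> holds exactly up to the golden ratio.\<close>

definition potential where
  "potential x xb y l u v \<Lambda> k = 2 / c1 * sqnorm_wrt H (u - xb k) + sqnorm_wrt (D k) (u - x k) / 2
     + \<beta> / 2 * (norm (B *v (y k - v)))\<^sup>2 + 1 / (2 * s * \<beta>) * (norm (l k - \<Lambda>))\<^sup>2
     + \<beta> * (2 - s) / 2 * (norm (residual A B b (x k) (y k)))\<^sup>2" for k :: nat

lemma golden_ratio_bound: "(1 - s)\<^sup>2 \<le> 2 - s" "s < 2"
proof -
  have "sqrt 5 < 3"
    by (rule real_less_lsqrt) auto
  then show "s < 2"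
    using s_le by simp
  \<comment> \<open>The factors come from the two roots of \<open>s\<^sup>2 - s - 1\<close>; their
    product is \<open>1 + s - s\<^sup>2\<close>, that is
    \<open>(2 - s) - (1 - s)\<^sup>2\<close>.\<close>
  have "0 \<le> ((1 + sqrt 5) / 2 - s) * (s + (sqrt 5 - 1) / 2)"
    using s_le s_pos by (intro mult_nonneg_nonneg) auto
  also have "\<dots> = (sqrt 5 * sqrt 5 - 1) / 4 + s - s * s"
    by (simp add: field_simps)
  finally show "(1 - s)\<^sup>2 \<le> 2 - s"
    by (simp add: power2_eq_square algebra_simps)
qed

lemma potential_nonneg: "0 \<le> potential x xb y l u v \<Lambda> k"
  unfolding potential_def using c1_pos \<beta>_pos s_pos golden_ratio_bound(2)
  by (intro add_nonneg_nonneg mult_nonneg_nonneg divide_nonneg_pos pos_defD(2)[OF pos_def_H] pos_semidefD(2)[OF D_psd]) auto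

text \<open>Adding the two optimality conditions leaves
  \<open>- \<beta> * (norm r')\<^sup>2\<close>, which splits exactly: \<open>s * \<beta> / 2\<close>
  of it pays for the multiplier update, \<open>\<beta> * (2 - s) / 2\<close> for the residual term
  of the next potential. What remains is the cross term of \<open>dy\<close> with \<open>r'\<close>,
  controlled by the change in \<open>y\<close> and the residual term of the current
  potential.\<close>

lemma outer_step:
  assumes path: "path \<xi> e x xb y l z zb" and k: "\<kappa> \<le> k" and u: "u \<in> X"
    and v: "v \<in> Y" "g v \<noteq> \<infinity>" and feasible: "residual A B b u v = 0"
  shows "f (x (Suc k)) + gr (y (Suc k)) - f u - gr v
      - \<Lambda> \<bullet> residual A B b (x (Suc k)) (y (Suc k))
    \<le> potential x xb y l u v \<Lambda> k - potential x xb y l u v \<Lambda> (Suc k) + noise \<xi> e z zb u k"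
proof -
  define r where "r = residual A B b (x k) (y k)"
  define r' where "r' = residual A B b (x (Suc k)) (y (Suc k))"
  define a where "a = A *v (x (Suc k) - u)"
  define c where "c = B *v (y (Suc k) - v)"
  define dx where "dx = A *v (x (Suc k) - x k)"
  define dy where "dy = B *v (y (Suc k) - y k)"
  define \<mu> where "\<mu> = l k - \<Lambda>"
  have r': "r' = a + c"
    using feasible unfolding r'_def a_def c_def residual_def
    by (simp add: matrix_vector_mult_diff_distrib algebra_simps)
  have r: "r = r' - dx - dy"
    unfolding r_def r'_def dx_def dy_def residual_def by (simp add: matrix_vector_mult_diff_distrib)
  have Aux: "A *v (u - x k) = dx - a"
    by (simp add: dx_def a_def matrix_vector_mult_diff_distrib)
  have Aux': "norm (A *v (u - x (Suc k))) = norm a"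
    unfolding a_def matrix_vector_mult_diff_distrib by (rule norm_minus_commute)
  have Byv: "B *v (y k - v) = c - dy"
    by (simp add: dy_def c_def matrix_vector_mult_diff_distrib)
  have lk': "l (Suc k) - \<Lambda> = \<mu> - (s * \<beta>) *\<^sub>R r'"
    using pathD(12)[OF path, of k] by (simp add: \<mu>_def r'_def)
  have x_part: "f (x (Suc k)) - f u - (l k - \<beta> *\<^sub>R r) \<bullet> a + sqnorm_wrt (D k) (u - x (Suc k)) / 2
      + \<beta> / 2 * (norm a)\<^sup>2 + sqnorm_wrt (D k) (x (Suc k) - x k) / 2 + \<beta> / 2 * (norm dx)\<^sup>2
    \<le> 2 / c1 * (sqnorm_wrt H (u - xb k) - sqnorm_wrt H (u - xb (Suc k)))
      + sqnorm_wrt (D k) (u - x k) / 2 + \<beta> / 2 * (norm (dx - a))\<^sup>2 + noise \<xi> e z zb u k"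
    using inner_loop[OF path k u]
    unfolding model_def inner_minus_left inner_transpose_mult MM_eq Aux Aux'
      a_def[symmetric] dx_def[symmetric] r_def[symmetric]
      sqnorm_wrt_minus_commute[of _ "x (Suc k)" u]
    by (simp add: add_divide_distrib Aux')
  have y_part: "gr (y (Suc k)) - gr v \<le> (l k - \<beta> *\<^sub>R r') \<bullet> c"
    using y_step(2)[OF path v, of k] by (simp add: c_def r'_def)
  have mono: "dy \<bullet> r' \<le> (1 - s) * (dy \<bullet> r)"
    using y_monotone[OF path v, of k] k \<kappa>_pos by (simp add: dy_def r_def r'_def)
  have D1: "sqnorm_wrt (D (Suc k)) (u - x (Suc k)) \<le> sqnorm_wrt (D k) (u - x (Suc k))"
    by (rule D_antimono)
  have D2: "0 \<le> sqnorm_wrt (D k) (x (Suc k) - x k)"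
    by (rule pos_semidefD(2)[OF D_psd])
  have young: "dy \<bullet> r' \<le> (norm dy)\<^sup>2 / 2 + (2 - s) / 2 * (norm r)\<^sup>2"
  proof -
    have "0 \<le> (norm (dy - (1 - s) *\<^sub>R r))\<^sup>2"
      by simp
    also have "\<dots> = (norm dy)\<^sup>2 - 2 * ((1 - s) * (dy \<bullet> r)) + (1 - s)\<^sup>2 * (norm r)\<^sup>2"
      unfolding power2_norm_eq_inner
      by (simp only: inner_diff_left inner_diff_right inner_scaleR_left inner_scaleR_right inner_commute[of r dy])
        (simp add: power2_eq_square right_diff_distrib)
    finally have "2 * ((1 - s) * (dy \<bullet> r)) \<le> (norm dy)\<^sup>2 + (1 - s)\<^sup>2 * (norm r)\<^sup>2"
      by simp
    also have "(1 - s)\<^sup>2 * (norm r)\<^sup>2 \<le> (2 - s) * (norm r)\<^sup>2"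
      by (intro mult_right_mono golden_ratio_bound) auto
    finally show ?thesis
      using mono by simp
  qed
  have lam: "1 / (2 * s * \<beta>) * (norm (\<mu> - (s * \<beta>) *\<^sub>R r'))\<^sup>2
      = 1 / (2 * s * \<beta>) * (norm \<mu>)\<^sup>2 - \<mu> \<bullet> r' + s * \<beta> / 2 * (norm r')\<^sup>2"
  proof -
    have "(norm (\<mu> - (s * \<beta>) *\<^sub>R r'))\<^sup>2 = (norm \<mu>)\<^sup>2 - 2 * s * \<beta> * (\<mu> \<bullet> r') + (s * \<beta>)\<^sup>2 * (norm r')\<^sup>2"
      unfolding power2_norm_eq_inner
      by (simp only: inner_diff_left inner_diff_right inner_scaleR_left inner_scaleR_right inner_commute[of r' \<mu>])
        (simp add: power2_eq_square right_diff_distrib)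
    then show ?thesis
      using s_pos \<beta>_pos by (simp add: field_simps power2_eq_square)
  qed
  \<comment> \<open>The \<open>x\<close>-step sees the old residual \<open>r\<close>, the
    \<open>y\<close>-step the new one \<open>r'\<close>; the mismatch is
    \<open>\<beta> * ((dx + dy) \<bullet> a)\<close>. The proximal squares cancel its
    \<open>dx\<close> part, and the \<open>dy\<close> part is matched by the expansion of the
    \<open>y\<close>-distance below.\<close>
  have alg: "(l k - \<beta> *\<^sub>R r) \<bullet> a - \<beta> / 2 * (norm a)\<^sup>2 - \<beta> / 2 * (norm dx)\<^sup>2 + \<beta> / 2 * (norm (dx - a))\<^sup>2
      + (l k - \<beta> *\<^sub>R r') \<bullet> c - \<Lambda> \<bullet> r'
    = \<mu> \<bullet> r' - \<beta> * (norm r')\<^sup>2 + \<beta> * (dy \<bullet> a)"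
    unfolding power2_norm_eq_inner r r' \<mu>_def
    by (simp add: inner_diff_left inner_diff_right inner_add_left inner_add_right inner_commute algebra_simps)
  have alg2: "\<beta> / 2 * (norm (c - dy))\<^sup>2 = \<beta> / 2 * (norm c)\<^sup>2 - \<beta> * (dy \<bullet> r') + \<beta> * (dy \<bullet> a) + \<beta> / 2 * (norm dy)\<^sup>2"
    unfolding power2_norm_eq_inner r'
    by (simp add: inner_diff_left inner_diff_right inner_add_left inner_add_right inner_commute algebra_simps)
  have split: "\<beta> * (2 - s) / 2 * w = \<beta> * w - s * \<beta> / 2 * w" for w
    by (simp add: field_simps)
  have "\<beta> * (dy \<bullet> r') \<le> \<beta> * ((norm dy)\<^sup>2 / 2 + (2 - s) / 2 * (norm r)\<^sup>2)"
    using \<beta>_pos by (intro mult_left_mono young) auto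
  also have "\<dots> = \<beta> / 2 * (norm dy)\<^sup>2 + \<beta> * (2 - s) / 2 * (norm r)\<^sup>2"
    by (simp add: field_simps)
  finally have y: "\<beta> * (dy \<bullet> r') \<le> \<beta> / 2 * (norm dy)\<^sup>2 + (\<beta> * (norm r)\<^sup>2 - s * \<beta> / 2 * (norm r)\<^sup>2)"
    by (simp only: split)
  show ?thesis
    unfolding potential_def r_def[symmetric] r'_def[symmetric] Byv c_def[symmetric] lk' \<mu>_def[symmetric] lam alg2 split
    using x_part[unfolded right_diff_distrib[of "2 / c1"]] y_part D1 D2 alg y
    by linarith
qed

section \<open>Primal-dual solutions and averaging\<close>

lemma solution_properties:
  assumes "(u, v, \<mu>) \<in> primal_dual_solutions X Y f g A B b"
  shows "u \<in> X" "v \<in> Y" "\<bar>g v\<bar> \<noteq> \<infinity>" "residual A B b u v = 0"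
    and "\<And>u' v'. u' \<in> X \<Longrightarrow> v' \<in> Y \<Longrightarrow> \<bar>g v'\<bar> \<noteq> \<infinity> \<Longrightarrow>
      0 \<le> f u' + gr v' - f u - gr v - \<mu> \<bullet> residual A B b u' v'"
proof -
  show in_XY: "u \<in> X" "v \<in> Y" and fin: "\<bar>g v\<bar> \<noteq> \<infinity>"
    using assms by (auto simp: primal_dual_solutions_def objective_def)
  define R where "R = residual A B b u v"
  have VI: "0 \<le> f u' + gr v' - f u - gr v - (transpose A *v \<mu>) \<bullet> (u' - u)
      - (transpose B *v \<mu>) \<bullet> (v' - v) + (\<mu>' - \<mu>) \<bullet> R"
    if w': "u' \<in> X" "v' \<in> Y" "\<bar>g v'\<bar> \<noteq> \<infinity>" for u' v' \<mu>'
  proof -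
    have "0 \<le> objective f g (u', v', \<mu>') - objective f g (u, v, \<mu>)
        + ereal (((u', v', \<mu>') - (u, v, \<mu>)) \<bullet> saddle_op A B b (u, v, \<mu>))"
      using assms w' unfolding primal_dual_solutions_def by blast
    moreover obtain q q' where "g v = ereal q" "g v' = ereal q'"
      using fin w'(3) by (cases "g v"; cases "g v'") auto
    ultimately show ?thesis
      by (simp add: objective_def saddle_op_def R_def inner_diff_right inner_diff_left inner_commute)
  qed
  \<comment> \<open>Feasibility follows by moving only the multiplier, by
    \<open>- R\<close>.\<close>
  have "0 \<le> - (R \<bullet> R)"
    using VI[OF in_XY fin, of "\<mu> - R"] by simp
  then show R0: "residual A B b u v = 0"
    unfolding R_def[symmetric] using inner_gt_zero_iff[of R] by (metis neg_0_le_iff_le not_less)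
  show "0 \<le> f u' + gr v' - f u - gr v - \<mu> \<bullet> residual A B b u' v'"
    if "u' \<in> X" "v' \<in> Y" "\<bar>g v'\<bar> \<noteq> \<infinity>" for u' v'
  proof -
    have "residual A B b u' v' = A *v (u' - u) + B *v (v' - v)"
      using R0 by (simp add: residual_def matrix_vector_mult_diff_distrib algebra_simps)
    then show ?thesis
      using VI[OF that, of \<mu>] unfolding inner_transpose_mult by (simp add: inner_add_right)
  qed
qed

text \<open>The restriction to finite values is essential: \<open>real_of_ereal\<close> sends
  infinity to 0, which in general destroys convexity on all of \<open>Y\<close>.\<close>

lemma convex_gr:
  "convex_on {v \<in> Y. \<bar>g v\<bar> \<noteq> \<infinity>} gr"
proof -
  have "\<bar>g (p *\<^sub>R v + q *\<^sub>R w)\<bar> \<noteq> \<infinity> \<and> p *\<^sub>R v + q *\<^sub>R w \<in> Y \<and> gr (p *\<^sub>R v + q *\<^sub>R w) \<le> p * gr v + q * gr w"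
    if vw: "v \<in> Y" "w \<in> Y" "\<bar>g v\<bar> \<noteq> \<infinity>" "\<bar>g w\<bar> \<noteq> \<infinity>" and pq: "p \<ge> 0" "q \<ge> 0" "p + q = 1" for v w p q
  proof -
    have Y: "p *\<^sub>R v + q *\<^sub>R w \<in> Y"
      using convex_Y vw pq by (simp add: convex_def)
    have "g (p *\<^sub>R v + q *\<^sub>R w) \<le> ereal p * g v + ereal q * g w"
      using convex_g vw pq unfolding ext_convex_on_def by blast
    moreover obtain gv gw where "g v = ereal gv" "g w = ereal gw"
      using vw by (cases "g v"; cases "g w") auto
    moreover have "g (p *\<^sub>R v + q *\<^sub>R w) \<noteq> -\<infinity>"
      using convex_g Y unfolding ext_convex_on_def by blast
    ultimately show ?thesis
      using Y by (cases "g (p *\<^sub>R v + q *\<^sub>R w)") auto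
  qed
  then show ?thesis
    unfolding convex_on_def convex_def by simp
qed

text \<open>A bound on the potential at \<kappa>, uniform over all multipliers of norm at most
  \<open>K\<close>. The multiplier chosen later depends on the realization, whereas the quantity to
  be integrated must not.\<close>

definition initial_bound ::
  "(nat \<Rightarrow> real^'n1) \<Rightarrow> (nat \<Rightarrow> real^'n1) \<Rightarrow> (nat \<Rightarrow> real^'n2) \<Rightarrow> (nat \<Rightarrow> real^'n) \<Rightarrow>
    real^'n1 \<Rightarrow> real^'n2 \<Rightarrow> real \<Rightarrow> real" where
  "initial_bound x xb y l u v K = 2 / c1 * sqnorm_wrt H (u - xb \<kappa>) + sqnorm_wrt (D \<kappa>) (u - x \<kappa>) / 2
     + \<beta> / 2 * (norm (B *v (y \<kappa> - v)))\<^sup>2 + 1 / (s * \<beta>) * ((norm (l \<kappa>))\<^sup>2 + K\<^sup>2)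
     + \<beta> * (2 - s) / 2 * (norm (residual A B b (x \<kappa>) (y \<kappa>)))\<^sup>2"

lemma potential_le_initial_bound:
  assumes "norm \<Lambda> \<le> K"
  shows "potential x xb y l u v \<Lambda> \<kappa> \<le> initial_bound x xb y l u v K"
proof -
  have "(norm (l \<kappa> - \<Lambda>))\<^sup>2 \<le> 2 * ((norm (l \<kappa>))\<^sup>2 + (norm \<Lambda>)\<^sup>2)"
  proof -
    have "(norm (l \<kappa> - \<Lambda>))\<^sup>2 + (norm (l \<kappa> + \<Lambda>))\<^sup>2 = 2 * ((norm (l \<kappa>))\<^sup>2 + (norm \<Lambda>)\<^sup>2)"
      unfolding power2_norm_eq_inner
      by (simp add: inner_diff_left inner_diff_right inner_add_left inner_add_right inner_commute)
    then show ?thesis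
      using zero_le_power2[of "norm (l \<kappa> + \<Lambda>)"] by linarith
  qed
  also have "(norm \<Lambda>)\<^sup>2 \<le> K\<^sup>2"
    using assms by (intro power_mono) auto
  finally have "1 / (2 * s * \<beta>) * (norm (l \<kappa> - \<Lambda>))\<^sup>2 \<le> 1 / (2 * s * \<beta>) * (2 * ((norm (l \<kappa>))\<^sup>2 + K\<^sup>2))"
    using s_pos \<beta>_pos by (intro mult_left_mono) auto
  also have "\<dots> = 1 / (s * \<beta>) * ((norm (l \<kappa>))\<^sup>2 + K\<^sup>2)"
    using s_pos \<beta>_pos by (simp add: field_simps)
  finally show ?thesis
    by (simp add: potential_def initial_bound_def)
qed

definition err_bound where
  "err_bound \<xi> e x xb y l z zb u v K T
    = (initial_bound x xb y l u v K + (\<Sum>k = \<kappa>..\<kappa> + T. noise \<xi> e z zb u k)) / (1 + real T)"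

text \<open>For \<open>\<Lambda>\<close> opposite to \<open>R\<close> with norm at most
  \<open>norm \<mu> + 1\<close>, the summed decrease gives
  \<open>gap + (norm \<mu> + 1) * norm R \<le> U\<close>, while the saddle inequality gives
  \<open>gap \<ge> - norm \<mu> * norm R\<close>. The surplus 1 in the radius is what bounds
  \<open>norm R\<close>; then \<open>\<Lambda> = 0\<close> bounds the gap from above and the saddle
  inequality from below.\<close>

lemma ergodic_bound:
  fixes x xb :: "nat \<Rightarrow> real^'n1" and y :: "nat \<Rightarrow> real^'n2" and l :: "nat \<Rightarrow> real^'n" and T :: nat
  assumes path: "path \<xi> e x xb y l z zb"
    and sol: "(u, v, \<mu>) \<in> primal_dual_solutions X Y f g A B b"
  defines "w \<equiv> ergodic_mean (w_tilde A B b \<beta> x y l) \<kappa> T"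
  defines "R \<equiv> residual A B b (fst w) (fst (snd w))"
  defines "U \<equiv> err_bound \<xi> e x xb y l z zb u v (norm \<mu> + 1) T"
  shows "\<bar>objective f g w\<bar> \<noteq> \<infinity>" and "norm R \<le> U"
    and "\<bar>real_of_ereal (objective f g w - objective f g (u, v, \<mu>))\<bar> \<le> (1 + norm \<mu>) * U"
proof -
  note sp = solution_properties[OF sol]
  have gv: "g v \<noteq> \<infinity>"
    using sp(3) by auto
  define xs where "xs k = x (Suc k)" for k
  define ys where "ys k = y (Suc k)" for k
  have w1: "fst w = ergodic_mean xs \<kappa> T" and w2: "fst (snd w) = ergodic_mean ys \<kappa> T"
    by (simp_all add: w_def ergodic_mean_fst ergodic_mean_snd w_tilde_def xs_def[abs_def] ys_def[abs_def])
  have xs: "xs k \<in> X" for k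
    by (simp add: xs_def path_in_X[OF path])
  \<comment> \<open>The averages start from \<open>y (Suc \<kappa>)\<close>, a minimizer and hence
    of finite value; the starting point \<open>y0\<close> is only known to lie in
    \<open>Y\<close>.\<close>
  have ys: "ys k \<in> {v \<in> Y. \<bar>g v\<bar> \<noteq> \<infinity>}" for k
    by (simp add: ys_def path_y_in_Y[OF path] y_step(1)[OF path sp(2) gv])
  note xc = ergodic_mean_convex[OF convex_f, of xs, OF xs, of \<kappa> T, folded w1]
  note yc = ergodic_mean_convex[OF convex_gr, of ys, OF ys, of \<kappa> T, folded w2]
  obtain gw where gw: "g (fst (snd w)) = ereal gw"
    using yc(1) by (cases "g (fst (snd w))") auto
  obtain g' where g': "g v = ereal g'"
    using sp(3) by (cases "g v") auto
  define gap where "gap = f (fst w) + gr (fst (snd w)) - f u - gr v"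
  have obj: "objective f g w = ereal (f (fst w) + gw)"
    using gw by (simp add: objective_def split_beta)
  then show "\<bar>objective f g w\<bar> \<noteq> \<infinity>"
    by simp
  have gap_eq: "real_of_ereal (objective f g w - objective f g (u, v, \<mu>)) = gap"
    by (simp add: obj gap_def gw g') (simp add: objective_def g')
  have R_eq: "(1 + real T) *\<^sub>R R = (\<Sum>k = \<kappa>..\<kappa> + T. residual A B b (xs k) (ys k))"
  proof -
    have "(\<Sum>k = \<kappa>..\<kappa> + T. residual A B b (xs k) (ys k))
        = A *v (\<Sum>k = \<kappa>..\<kappa> + T. xs k) + B *v (\<Sum>k = \<kappa>..\<kappa> + T. ys k) - (1 + real T) *\<^sub>R b"
      by (simp add: residual_def sum_subtractf sum.distrib linear_sum[OF matrix_vector_mul_linear, symmetric] sum_constant_scaleR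
          del: sum_constant)
    then show ?thesis
      by (simp add: R_def residual_def w1 w2 ergodic_mean_def matrix_vector_mult_scaleR scaleR_right_diff_distrib scaleR_right_distrib)
  qed
  have main: "gap - \<Lambda> \<bullet> R \<le> U" if "norm \<Lambda> \<le> norm \<mu> + 1" for \<Lambda>
  proof -
    let ?P = "potential x xb y l u v \<Lambda>"
    have "(\<Sum>k = \<kappa>..\<kappa> + T. f (xs k) + gr (ys k) - f u - gr v - \<Lambda> \<bullet> residual A B b (xs k) (ys k))
        \<le> (\<Sum>k = \<kappa>..\<kappa> + T. ?P k - ?P (Suc k) + noise \<xi> e z zb u k)"
      unfolding xs_def ys_def using sp gv by (intro sum_mono outer_step path) auto
    also have "\<dots> = ?P \<kappa> - ?P (Suc (\<kappa> + T)) + (\<Sum>k = \<kappa>..\<kappa> + T. noise \<xi> e z zb u k)"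
      using sum_Suc_diff'[of \<kappa> "Suc (\<kappa> + T)" "\<lambda>k. - ?P k"]
      by (simp add: sum.distrib atLeastLessThanSuc_atLeastAtMost)
    also have "\<dots> \<le> initial_bound x xb y l u v (norm \<mu> + 1) + (\<Sum>k = \<kappa>..\<kappa> + T. noise \<xi> e z zb u k)"
      using potential_le_initial_bound[OF that, of x xb y l u v] potential_nonneg[of x xb y l u v \<Lambda> "Suc (\<kappa> + T)"] by simp
    also have "\<dots> = (1 + real T) * U"
      by (simp add: U_def err_bound_def)
    also have "(\<Sum>k = \<kappa>..\<kappa> + T. f (xs k) + gr (ys k) - f u - gr v - \<Lambda> \<bullet> residual A B b (xs k) (ys k))
        = (1 + real T) * (ergodic_mean (\<lambda>k. f (xs k)) \<kappa> T + ergodic_mean (\<lambda>k. gr (ys k)) \<kappa> T - f u - gr v - \<Lambda> \<bullet> R)"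
    proof -
      have "(\<Sum>k = \<kappa>..\<kappa> + T. \<Lambda> \<bullet> residual A B b (xs k) (ys k)) = (1 + real T) * (\<Lambda> \<bullet> R)"
        by (metis R_eq inner_scaleR_right inner_sum_right)
      then show ?thesis
        by (simp add: sum_subtractf sum.distrib ergodic_mean_def right_diff_distrib distrib_left)
    qed
    finally have "ergodic_mean (\<lambda>k. f (xs k)) \<kappa> T + ergodic_mean (\<lambda>k. gr (ys k)) \<kappa> T - f u - gr v - \<Lambda> \<bullet> R \<le> U"
      by (rule mult_left_le_imp_le) simp
    then show ?thesis
      using xc(2) yc(2) by (simp add: gap_def)
  qed
  have lower: "\<mu> \<bullet> R \<le> gap"
    using sp(5)[of "fst w" "fst (snd w)"] xc(1) yc(1) by (simp add: gap_def R_def)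
  have muR: "- (norm \<mu> * norm R) \<le> \<mu> \<bullet> R"
    using Cauchy_Schwarz_ineq2[of \<mu> R] by linarith
  show R_le: "norm R \<le> U"
  proof -
    define \<Lambda> where "\<Lambda> = - ((norm \<mu> + 1) *\<^sub>R sgn R)"
    have "R \<bullet> R = norm R * norm R"
      by (simp add: power2_norm_eq_inner[symmetric] power2_eq_square)
    then have "sgn R \<bullet> R = norm R"
      by (cases "R = 0") (simp_all add: sgn_div_norm)
    then have "\<Lambda> \<bullet> R = - ((norm \<mu> + 1) * norm R)"
      by (simp add: \<Lambda>_def)
    moreover have "norm \<Lambda> \<le> norm \<mu> + 1"
      by (simp add: \<Lambda>_def norm_sgn)
    ultimately show ?thesis
      using main[of \<Lambda>] lower muR by (simp add: algebra_simps)
  qed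
  have "gap \<le> U"
    using main[of 0] by simp
  moreover have "0 \<le> U"
    using R_le norm_ge_zero[of R] by linarith
  moreover have "norm \<mu> * norm R \<le> norm \<mu> * U"
    using R_le by (intro mult_left_mono) auto
  moreover have "0 \<le> norm \<mu> * U"
    using \<open>0 \<le> U\<close> by simp
  ultimately have "\<bar>gap\<bar> \<le> (1 + norm \<mu>) * U"
    using lower muR unfolding ring_distribs by linarith
  then show "\<bar>real_of_ereal (objective f g w - objective f g (u, v, \<mu>))\<bar> \<le> (1 + norm \<mu>) * U"
    by (simp only: gap_eq)
qed

end

section \<open>Square integrability and quadratic variational inequalities\<close>

definition square_integrable :: "'w measure \<Rightarrow> ('w \<Rightarrow> 'a::euclidean_space) \<Rightarrow> bool" where
  "square_integrable M Z \<longleftrightarrow> Z \<in> borel_measurable M \<and> integrable M (\<lambda>\<omega>. (norm (Z \<omega>))\<^sup>2)"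

lemma square_integrable_measurable: "square_integrable M Z \<Longrightarrow> Z \<in> borel_measurable M"
  by (simp add: square_integrable_def)

lemma square_integrable_bound:
  assumes "square_integrable M W" "Z \<in> borel_measurable M" "\<And>\<omega>. \<omega> \<in> space M \<Longrightarrow> norm (Z \<omega>) \<le> norm (W \<omega>)"
  shows "square_integrable M Z"
  using assms unfolding square_integrable_def
  by (auto intro!: Bochner_Integration.integrable_bound[where f="\<lambda>\<omega>. (norm (W \<omega>))\<^sup>2"] AE_I2 power_mono)

lemma square_integrable_norm: "square_integrable M Z \<Longrightarrow> square_integrable M (\<lambda>\<omega>. norm (Z \<omega>))"
  by (auto simp: square_integrable_def)

lemma square_integrable_add:
  assumes "square_integrable M Z" "square_integrable M W"
  shows "square_integrable M (\<lambda>\<omega>. Z \<omega> + W \<omega>)"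
proof -
  have [measurable]: "Z \<in> borel_measurable M" "W \<in> borel_measurable M"
    using assms by (auto simp: square_integrable_def)
  have "(norm (a + b))\<^sup>2 \<le> 2 * (norm a)\<^sup>2 + 2 * (norm b)\<^sup>2" for a b :: 'b
  proof -
    have "(norm (a - b))\<^sup>2 + (norm (a + b))\<^sup>2 = 2 * (norm a)\<^sup>2 + 2 * (norm b)\<^sup>2"
      unfolding power2_norm_eq_inner
      by (simp add: inner_diff_left inner_diff_right inner_add_left inner_add_right inner_commute)
    then show ?thesis
      using zero_le_power2[of "norm (a - b)"] by linarith
  qed
  moreover have "integrable M (\<lambda>\<omega>. 2 * (norm (Z \<omega>))\<^sup>2 + 2 * (norm (W \<omega>))\<^sup>2)"
    using assms by (auto simp: square_integrable_def)
  ultimately show ?thesis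
    unfolding square_integrable_def
    by (auto intro!: Bochner_Integration.integrable_bound[where f="\<lambda>\<omega>. 2 * (norm (Z \<omega>))\<^sup>2 + 2 * (norm (W \<omega>))\<^sup>2"] AE_I2)
qed

lemma square_integrable_linear:
  assumes "square_integrable M Z" "bounded_linear h"
  shows "square_integrable M (\<lambda>\<omega>. h (Z \<omega>))"
proof -
  obtain K where K: "\<And>u. norm (h u) \<le> norm u * K" "K > 0"
    using bounded_linear.pos_bounded[OF assms(2)] by blast
  have "square_integrable M (\<lambda>\<omega>. K * norm (Z \<omega>))"
    using assms(1) K(2) by (auto simp: square_integrable_def power_mult_distrib)
  then show ?thesis
  proof (rule square_integrable_bound)
    show "(\<lambda>\<omega>. h (Z \<omega>)) \<in> borel_measurable M"
      using assms by (auto simp: square_integrable_def intro: borel_measurable_continuous_onI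
          measurable_compose[OF _ borel_measurable_continuous_onI[OF linear_continuous_on]])
    show "norm (h (Z \<omega>)) \<le> norm (K * norm (Z \<omega>))" for \<omega>
      using K by (simp add: mult.commute)
  qed
qed

lemma square_integrable_scaleR: "square_integrable M Z \<Longrightarrow> square_integrable M (\<lambda>\<omega>. r *\<^sub>R Z \<omega>)"
  by (erule square_integrable_linear[where h="\<lambda>a. r *\<^sub>R a"]) (rule bounded_linear_scaleR_right)

lemma square_integrable_matrix:
  fixes Z :: "'w \<Rightarrow> real^'a" and A :: "real^'a^'b"
  shows "square_integrable M Z \<Longrightarrow> square_integrable M (\<lambda>\<omega>. A *v Z \<omega>)"
  by (erule square_integrable_linear[where h="\<lambda>u. A *v u"]) simp

lemma square_integrable_diff:
  "square_integrable M Z \<Longrightarrow> square_integrable M W \<Longrightarrow> square_integrable M (\<lambda>\<omega>. Z \<omega> - W \<omega>)"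
  using square_integrable_add[of M Z "\<lambda>\<omega>. (-1) *\<^sub>R W \<omega>"] square_integrable_scaleR[of M W "-1"] by simp

lemma (in finite_measure) square_integrable_const: "square_integrable M (\<lambda>_. c)"
  by (simp add: square_integrable_def)

lemma square_integrable_inner:
  assumes "square_integrable M Z" "square_integrable M W"
  shows "integrable M (\<lambda>\<omega>. Z \<omega> \<bullet> W \<omega>)"
proof -
  have [measurable]: "Z \<in> borel_measurable M" "W \<in> borel_measurable M"
    using assms by (auto simp: square_integrable_def)
  have "\<bar>a \<bullet> b\<bar> \<le> (norm a)\<^sup>2 + (norm b)\<^sup>2" for a b :: 'b
  proof -
    have "2 * (norm a * norm b) \<le> (norm a)\<^sup>2 + (norm b)\<^sup>2"
      using sum_squares_bound[of "norm a" "norm b"] by simp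
    moreover have "0 \<le> norm a * norm b"
      by simp
    ultimately show ?thesis
      using Cauchy_Schwarz_ineq2[of a b] by linarith
  qed
  moreover have "integrable M (\<lambda>\<omega>. (norm (Z \<omega>))\<^sup>2 + (norm (W \<omega>))\<^sup>2)"
    using assms by (auto simp: square_integrable_def)
  ultimately show ?thesis
    by (auto intro!: Bochner_Integration.integrable_bound[where f="\<lambda>\<omega>. (norm (Z \<omega>))\<^sup>2 + (norm (W \<omega>))\<^sup>2"] AE_I2)
qed

lemma square_integrable_sqnorm_wrt:
  "square_integrable M Z \<Longrightarrow> integrable M (\<lambda>\<omega>. sqnorm_wrt G (Z \<omega>))"
  unfolding sqnorm_wrt_def by (intro square_integrable_inner square_integrable_matrix)

text \<open>Lipschitz maps have affine growth, so this carries square integrability through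
  gradients and proximal steps.\<close>

lemma (in finite_measure) square_integrable_affine_bound:
  fixes Z :: "'a \<Rightarrow> 'b::euclidean_space" and W :: "'a \<Rightarrow> 'c::euclidean_space"
  assumes "square_integrable M W" "Z \<in> borel_measurable M"
    and "\<And>\<omega>. \<omega> \<in> space M \<Longrightarrow> norm (Z \<omega>) \<le> p + q * norm (W \<omega>)"
  shows "square_integrable M Z"
proof (rule square_integrable_bound[OF _ assms(2)])
  show "square_integrable M (\<lambda>\<omega>. p + q *\<^sub>R norm (W \<omega>))"
    by (intro square_integrable_add square_integrable_const square_integrable_scaleR square_integrable_norm assms)
  show "norm (Z \<omega>) \<le> norm (p + q *\<^sub>R norm (W \<omega>))" if "\<omega> \<in> space M" for \<omega>
    using assms(3)[OF that] by simp
qed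

lemma norm_matrix_mult_bound:
  fixes A :: "real^'a^'b"
  obtains K where "K > 0" "\<And>u. norm (A *v u) \<le> K * norm u"
  using bounded_linear.pos_bounded[of "\<lambda>u. A *v u"]
  by (metis linear_linear matrix_vector_mul_linear mult.commute)

text \<open>Writing \<open>a = H *v p\<close> bounds \<open>norm a\<close> by \<open>norm p\<close>,
  and \<open>norm p\<close> by the \<open>H\<close>-norm of \<open>p\<close>, which is the dual norm
  of \<open>a\<close>. It transfers the variance and Lipschitz hypotheses to the Euclidean
  norm.\<close>

lemma norm_wrt_matrix_inv_bounded_below:
  fixes H :: "real^'a^'a"
  assumes "pos_def H"
  obtains K where "K > 0" "\<And>a. norm a \<le> K * norm_wrt (matrix_inv H) a"
proof -
  obtain c where c: "c > 0" "\<And>u. c * (norm u)\<^sup>2 \<le> sqnorm_wrt H u"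
    using pos_def_bounded_below[OF assms] by blast
  obtain L where L: "L > 0" "\<And>u. norm (H *v u) \<le> L * norm u"
    using norm_matrix_mult_bound by blast
  show thesis
  proof (rule that)
    show "L / sqrt c > 0"
      using c L by simp
    show "norm a \<le> L / sqrt c * norm_wrt (matrix_inv H) a" for a
    proof -
      define p where "p = matrix_inv H *v a"
      have "sqrt c * norm p = sqrt (c * (norm p)\<^sup>2)"
        by (simp add: real_sqrt_mult)
      also have "\<dots> \<le> norm_wrt (matrix_inv H) a"
        unfolding norm_wrt_def sqnorm_wrt_matrix_inv[OF assms] p_def by (intro real_sqrt_le_mono c)
      finally have "norm p \<le> norm_wrt (matrix_inv H) a / sqrt c"
        using c(1) by (simp add: field_simps)
      then have "L * norm p \<le> L * (norm_wrt (matrix_inv H) a / sqrt c)"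
        using L(1) by (intro mult_left_mono) auto
      moreover have "norm a \<le> L * norm p"
        using L(2)[of p] by (simp add: p_def pos_def_matrix_inv[OF assms])
      ultimately show ?thesis
        by simp
    qed
  qed
qed

lemma norm_wrt_bounded_above:
  fixes H :: "real^'a^'a"
  obtains K where "K > 0" "\<And>u. norm_wrt H u \<le> K * norm u"
proof -
  obtain L where L: "L > 0" "\<And>u. norm (H *v u) \<le> L * norm u"
    using norm_matrix_mult_bound by blast
  show thesis
  proof (rule that)
    show "sqrt L > 0"
      using L by simp
    show "norm_wrt H u \<le> sqrt L * norm u" for u
    proof -
      have "sqnorm_wrt H u \<le> norm u * norm (H *v u)"
        unfolding sqnorm_wrt_def by (rule norm_cauchy_schwarz)
      also have "\<dots> \<le> norm u * (L * norm u)"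
        by (intro mult_left_mono L) auto
      finally have "norm_wrt H u \<le> sqrt (L * (norm u)\<^sup>2)"
        unfolding norm_wrt_def by (intro real_sqrt_le_mono) (simp add: power2_eq_square mult_ac)
      then show ?thesis
        by (simp add: real_sqrt_mult)
    qed
  qed
qed

text \<open>For positive definite \<open>G\<close> the solution \<open>p\<close> exists and depends Lipschitz continuously on \<open>v\<close>,
  which makes the inner iterates measurable.\<close>

definition quad_VI :: "(real^'a) set \<Rightarrow> real^'a^'a \<Rightarrow> real^'a \<Rightarrow> real^'a \<Rightarrow> bool" where
  "quad_VI X G v p \<longleftrightarrow> p \<in> X \<and> (\<forall>u\<in>X. 0 \<le> (v + G *v p) \<bullet> (u - p))"

text \<open>Each inequality is tested at the other solution and the two are added; strong
  monotonicity of \<open>G\<close> does the rest. Equal data give uniqueness.\<close>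

lemma quad_VI_lipschitz:
  assumes c: "c > 0" "\<And>u. c * (norm u)\<^sup>2 \<le> sqnorm_wrt G u"
    and "quad_VI X G v p" "quad_VI X G w q"
  shows "norm (p - q) \<le> norm (v - w) / c"
proof (cases "p = q")
  case False
  have "0 \<le> (v + G *v p) \<bullet> (q - p)" "0 \<le> (w + G *v q) \<bullet> (p - q)"
    using assms(3,4) by (auto simp: quad_VI_def)
  then have "sqnorm_wrt G (p - q) \<le> (w - v) \<bullet> (p - q)"
    unfolding sqnorm_wrt_def
    by (simp add: inner_diff_left inner_diff_right inner_add_left inner_add_right
        matrix_vector_mult_diff_distrib inner_commute algebra_simps)
  also have "\<dots> \<le> norm (w - v) * norm (p - q)"
    by (rule norm_cauchy_schwarz)
  finally have "(c * norm (p - q)) * norm (p - q) \<le> norm (v - w) * norm (p - q)"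
    using c(2)[of "p - q"] by (simp add: power2_eq_square norm_minus_commute mult_ac)
  then show ?thesis
    using False c(1) by (simp add: field_simps)
qed (use c in simp)

lemma quad_VI_exists:
  fixes G :: "real^'a^'a"
  assumes X: "closed X" "convex X" "x0 \<in> X"
    and G: "transpose G = G" and c: "c > 0" "\<And>u. c * (norm u)\<^sup>2 \<le> sqnorm_wrt G u"
  shows "\<exists>p. quad_VI X G v p"
proof -
  define \<phi> where "\<phi> u = v \<bullet> u + sqnorm_wrt G u / 2" for u
  \<comment> \<open>The ball must contain \<open>x0\<close>. Outside it
    \<open>norm u \<ge> 1\<close>, and the growth \<open>c / 2 * (norm u)\<^sup>2\<close> of the
    quadratic part exceeds the linear part by at least \<open>\<bar>\<phi> x0\<bar>\<close>, so the
    minimum over the ball is global on \<open>X\<close>.\<close>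
  define R where "R = max (norm x0) (max 1 (2 / c * (norm v + \<bar>\<phi> x0\<bar>)))"
  have "continuous_on UNIV \<phi>"
    unfolding \<phi>_def sqnorm_wrt_def
    by (intro continuous_intros linear_continuous_on) (simp_all add: bounded_linear_def)
  moreover have "compact (X \<inter> cball 0 R)" "x0 \<in> X \<inter> cball 0 R"
    using X by (auto simp: R_def intro!: closed_Int_compact)
  ultimately obtain p where p: "p \<in> X \<inter> cball 0 R" "\<And>u. u \<in> X \<inter> cball 0 R \<Longrightarrow> \<phi> p \<le> \<phi> u"
    using continuous_attains_inf[of "X \<inter> cball 0 R" \<phi>] continuous_on_subset by blast
  have min: "\<phi> p \<le> \<phi> u" if "u \<in> X" for u
  proof (cases "norm u \<le> R")
    case False
    then have u: "norm u \<ge> 1" "2 / c * (norm v + \<bar>\<phi> x0\<bar>) \<le> norm u"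
      by (auto simp: R_def)
    have "\<phi> p \<le> \<phi> x0"
      using p(2) \<open>x0 \<in> X \<inter> cball 0 R\<close> by blast
    also have "\<phi> x0 \<le> norm u * \<bar>\<phi> x0\<bar>"
      using u(1) mult_right_mono[of 1 "norm u" "\<bar>\<phi> x0\<bar>"] by linarith
    also have "\<dots> \<le> norm u * (c / 2 * norm u - norm v)"
      using u(2) c(1) by (intro mult_left_mono) (auto simp: field_simps)
    also have "\<dots> = c * (norm u)\<^sup>2 / 2 - norm v * norm u"
      by (simp add: algebra_simps power2_eq_square)
    also have "\<dots> \<le> \<phi> u"
      using c(2)[of u] Cauchy_Schwarz_ineq2[of v u] by (simp add: \<phi>_def)
    finally show ?thesis .
  qed (use p that in auto)
  \<comment> \<open>A second quadratic term with zero matrix brings the problem into the form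
    treated by \<open>arg_min_quadratic_VI\<close>.\<close>
  have "is_arg_min (\<lambda>u. v \<bullet> u + 1 / 2 * sqnorm_wrt G (u - 0) + 1 / 2 * sqnorm_wrt (0::real^'a^'a) (u - 0)) (\<lambda>u. u \<in> X) p"
    using min p by (auto simp: is_arg_min_linorder \<phi>_def sqnorm_wrt_def)
  from arg_min_quadratic_VI[OF X(2) G _ this] show ?thesis
    using p by (intro exI[of _ p]) (auto simp: quad_VI_def inner_add_left transpose_def vec_eq_iff)
qed

text \<open>Merging both proximal terms moves all random data into the linear part, while the matrix
  stays deterministic; this is the form in which the solution map is a fixed function.\<close>

lemma arg_min_quad_VI:
  fixes H K :: "real^'a^'a"
  assumes "convex X" "transpose H = H" "transpose K = K"
    and "is_arg_min (\<lambda>u. q \<bullet> u + \<gamma> / 2 * sqnorm_wrt H (u - a) + 1 / 2 * sqnorm_wrt K (u - c))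
      (\<lambda>u. u \<in> X) p"
  shows "quad_VI X (\<gamma> *\<^sub>R H + K) (q - \<gamma> *\<^sub>R (H *v a) - K *v c) p"
  unfolding quad_VI_def
proof (intro conjI ballI)
  show "p \<in> X"
    using assms(4) by (simp add: is_arg_min_def)
  fix u assume "u \<in> X"
  from arg_min_quadratic_VI[OF assms this]
  show "0 \<le> (q - \<gamma> *\<^sub>R (H *v a) - K *v c + (\<gamma> *\<^sub>R H + K) *v p) \<bullet> (u - p)"
    by (simp add: matrix_vector_mult_diff_distrib matrix_vector_mult_add_rdistrib scaleR_matrix_vector_assoc[symmetric]
        inner_add_left inner_diff_left right_diff_distrib)
qed

lemma quad_VI_measurable:
  fixes G :: "real^'a^'a"
  assumes X: "closed X" "convex X" "x0 \<in> X" and G: "pos_def G"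
    and v: "v \<in> borel_measurable F" and p: "\<And>\<omega>. \<omega> \<in> space F \<Longrightarrow> quad_VI X G (v \<omega>) (p \<omega>)"
  shows "p \<in> borel_measurable F"
    and "\<exists>a r. \<forall>\<omega>\<in>space F. norm (p \<omega>) \<le> a + r * norm (v \<omega>)"
proof -
  obtain c where c: "c > 0" "\<And>u. c * (norm u)\<^sup>2 \<le> sqnorm_wrt G u"
    using pos_def_bounded_below[OF G] by blast
  define \<pi> where "\<pi> w = (SOME q. quad_VI X G w q)" for w
  have \<pi>: "quad_VI X G w (\<pi> w)" for w
    unfolding \<pi>_def by (rule someI_ex) (rule quad_VI_exists[OF X pos_defD(1)[OF G] c])
  \<comment> \<open>Equal data force equal solutions, so \<open>p\<close> is the fixed map
    \<open>\<pi>\<close> applied to \<open>v\<close>, whatever its origin.\<close>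
  have eq: "p \<omega> = \<pi> (v \<omega>)" if "\<omega> \<in> space F" for \<omega>
    using quad_VI_lipschitz[OF c p[OF that] \<pi>[of "v \<omega>"]] by simp
  have lip: "norm (\<pi> w - \<pi> w') \<le> norm (w - w') / c" for w w'
    by (rule quad_VI_lipschitz[OF c \<pi> \<pi>])
  have "(1 / c)-lipschitz_on UNIV \<pi>"
    using c(1) lip by (intro lipschitz_onI) (auto simp: dist_norm)
  then have "\<pi> \<in> borel_measurable borel"
    by (intro borel_measurable_continuous_onI lipschitz_on_continuous_on)
  then have "(\<lambda>\<omega>. \<pi> (v \<omega>)) \<in> borel_measurable F"
    using v by (rule measurable_compose[rotated])
  then show "p \<in> borel_measurable F"
    using eq by (subst measurable_cong) auto
  have "norm (p \<omega>) \<le> norm (\<pi> 0) + 1 / c * norm (v \<omega>)" if "\<omega> \<in> space F" for \<omega>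
    using lip[of "v \<omega>" 0] norm_triangle_ineq2[of "\<pi> (v \<omega>)" "\<pi> 0"] by (simp add: eq[OF that])
  then show "\<exists>a r. \<forall>\<omega>\<in>space F. norm (p \<omega>) \<le> a + r * norm (v \<omega>)"
    by blast
qed

section \<open>Adaptedness of the iterates\<close>

text \<open>One primal-dual solution is fixed as a parameter, because the noise and the moment
  bounds for \<open>y\<close> are measured relative to it.\<close>

locale as_admm_random =
  as_admm_problem X Y N fs f g A B b \<beta> s \<nu> c1 c2 c3 \<rho> M \<kappa> H MM D m \<eta> x0 y0 l0 + prob_space P
  for X :: "(real^'n1) set" and Y :: "(real^'n2) set"
    and N :: nat and fs :: "nat \<Rightarrow> real^'n1 \<Rightarrow> real" and f :: "real^'n1 \<Rightarrow> real"
    and g :: "real^'n2 \<Rightarrow> ereal"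
    and A :: "real^'n1^'n" and B :: "real^'n2^'n" and b :: "real^'n"
    and \<beta> s \<nu> c1 c2 c3 \<rho> :: real and M \<kappa> :: nat
    and H :: "real^'n1^'n1" and MM D :: "nat \<Rightarrow> real^'n1^'n1"
    and m :: "nat \<Rightarrow> nat" and \<eta> :: "nat \<Rightarrow> real"
    and x0 :: "real^'n1" and y0 :: "real^'n2" and l0 :: "real^'n" and P :: "'w measure" +
  fixes \<sigma> :: real
    and \<xi> :: "nat \<Rightarrow> nat \<Rightarrow> 'w \<Rightarrow> nat" and e :: "nat \<Rightarrow> nat \<Rightarrow> 'w \<Rightarrow> real^'n1"
    and x xb :: "nat \<Rightarrow> 'w \<Rightarrow> real^'n1" and y :: "nat \<Rightarrow> 'w \<Rightarrow> real^'n2"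
    and l :: "nat \<Rightarrow> 'w \<Rightarrow> real^'n" and z zb :: "nat \<Rightarrow> nat \<Rightarrow> 'w \<Rightarrow> real^'n1"
    and us :: "real^'n1" and vs :: "real^'n2" and \<mu>s :: "real^'n"
    and gerr :: "nat \<Rightarrow> nat \<Rightarrow> 'w \<Rightarrow> real^'n1"
  assumes \<xi>_measurable: "\<And>k t. t \<in> {1..m k} \<Longrightarrow> \<xi> k t \<in> P \<rightarrow>\<^sub>M count_space {1..N}"
    and \<xi>_uniform: "\<And>k t. t \<in> {1..m k} \<Longrightarrow>
           distr P (count_space {1..N}) (\<xi> k t) = uniform_count_measure {1..N}"
    and \<xi>_indep: "\<And>k t. t \<in> {1..m k} \<Longrightarrow>
           indep_set (sets (history P m \<xi> e y k t))
             (sets (vimage_algebra (space P) (\<xi> k t) (count_space {1..N})))"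
    and e_integrable: "\<And>k t. t \<in> {1..m k} \<Longrightarrow> integrable P (e k t)"
    and e_cond_exp: "\<And>k t i. t \<in> {1..m k} \<Longrightarrow>
           AE \<omega> in P. real_cond_exp P (history P m \<xi> e y k t) (\<lambda>\<omega>'. e k t \<omega>' $ i) \<omega> = 0"
    and y_measurable: "\<And>k. y k \<in> borel_measurable P"
    and all_paths: "\<And>\<omega>. \<omega> \<in> space P \<Longrightarrow>
           as_admm_path X Y fs g A B b \<beta> s H m \<eta> MM x0 y0 l0
             (\<lambda>k t. \<xi> k t \<omega>) (\<lambda>k t. e k t \<omega>)
             (\<lambda>k. x k \<omega>) (\<lambda>k. xb k \<omega>) (\<lambda>k. y k \<omega>) (\<lambda>k. l k \<omega>)
             (\<lambda>k t. z k t \<omega>) (\<lambda>k t. zb k t \<omega>)"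
    and gerr_eq: "\<And>k t \<omega>. gerr k t \<omega> = gradient f (accel t (zb k t \<omega>) (z k t \<omega>))
           - stoch_grad fs (\<xi> k t \<omega>) (e k t \<omega>) (accel t (zb k t \<omega>) (z k t \<omega>))"
    and gerr_variance: "\<And>k t. t \<in> {1..m k} \<Longrightarrow>
           integrable P (\<lambda>\<omega>. (norm_wrt (matrix_inv H) (gerr k t \<omega>))\<^sup>2) \<and>
           (\<integral>\<omega>. (norm_wrt (matrix_inv H) (gerr k t \<omega>))\<^sup>2 \<partial>P) \<le> \<sigma>\<^sup>2"
    and solution: "(us, vs, \<mu>s) \<in> primal_dual_solutions X Y f g A B b"
begin

abbreviation hist :: "nat \<Rightarrow> nat \<Rightarrow> 'w measure" where
  "hist \<equiv> history P m \<xi> e y"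

lemma space_hist: "space (hist k t) = space P"
  unfolding history_def Let_def by (rule space_measure_of) auto

definition past :: "nat \<Rightarrow> nat \<Rightarrow> (nat \<times> nat) set" where
  "past k t = {(i, r). 1 \<le> r \<and> r \<le> m i \<and> (i < k \<or> i = k \<and> r < t)}"

definition hist_gen :: "nat \<Rightarrow> nat \<Rightarrow> 'w set set" where
  "hist_gen k t = {\<xi> i r -` S \<inter> space P | i r S. (i, r) \<in> past k t} \<union>
            {e i r -` S \<inter> space P | i r S. (i, r) \<in> past k t \<and> S \<in> sets borel} \<union>
            {y i -` S \<inter> space P | i S. i \<le> k \<and> S \<in> sets borel}"

lemma sets_hist: "sets (hist k t) = sigma_sets (space P) (hist_gen k t)"
  unfolding history_def Let_def hist_gen_def past_def by (rule sets_measure_of) auto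

lemma hist_gen_intros:
  shows "(i, r) \<in> past k t \<Longrightarrow> \<xi> i r -` S \<inter> space P \<in> hist_gen k t"
    and "(i, r) \<in> past k t \<Longrightarrow> S' \<in> sets borel \<Longrightarrow> e i r -` S' \<inter> space P \<in> hist_gen k t"
    and "i \<le> k \<Longrightarrow> S'' \<in> sets borel \<Longrightarrow> y i -` S'' \<inter> space P \<in> hist_gen k t"
proof -
  show "\<xi> i r -` S \<inter> space P \<in> hist_gen k t" if "(i, r) \<in> past k t"
    unfolding hist_gen_def by (rule UnI1, rule UnI1, rule CollectI, rule exI[of _ i], rule exI[of _ r], rule exI[of _ S]) (simp add: that)
  show "e i r -` S' \<inter> space P \<in> hist_gen k t" if "(i, r) \<in> past k t" "S' \<in> sets borel"
    unfolding hist_gen_def by (rule UnI1, rule UnI2, rule CollectI, rule exI[of _ i], rule exI[of _ r], rule exI[of _ S']) (simp add: that)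
  show "y i -` S'' \<inter> space P \<in> hist_gen k t" if "i \<le> k" "S'' \<in> sets borel"
    unfolding hist_gen_def by (rule UnI2, rule CollectI, rule exI[of _ i], rule exI[of _ S'']) (simp add: that)
qed

lemma hist_gen_subsetI:
  assumes "\<And>i r S. (i, r) \<in> past k t \<Longrightarrow> \<xi> i r -` S \<inter> space P \<in> C"
    and "\<And>i r S. (i, r) \<in> past k t \<Longrightarrow> S \<in> sets borel \<Longrightarrow> e i r -` S \<inter> space P \<in> C"
    and "\<And>i S. i \<le> k \<Longrightarrow> S \<in> sets borel \<Longrightarrow> y i -` S \<inter> space P \<in> C"
  shows "hist_gen k t \<subseteq> C"
  unfolding hist_gen_def using assms by auto

lemma hist_mono:
  assumes "k < k' \<or> k = k' \<and> t \<le> t'"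
  shows "subalgebra (hist k' t') (hist k t)"
proof -
  have "past k t \<subseteq> past k' t'" and k: "k \<le> k'"
    using assms unfolding past_def by auto
  then have "hist_gen k t \<subseteq> hist_gen k' t'"
    by (intro hist_gen_subsetI; intro hist_gen_intros) (auto intro: le_trans[OF _ k])
  then have "sigma_sets (space P) (hist_gen k t) \<subseteq> sigma_sets (space P) (hist_gen k' t')"
    by (rule sigma_sets_mono')
  then show ?thesis
    unfolding subalgebra_def sets_hist by (simp only: space_hist)
qed

lemma hist_subalgebra: "subalgebra P (hist k t)"
proof -
  have "\<xi> i r -` S \<inter> space P \<in> sets P" if "(i, r) \<in> past k t" for i r S
  proof -
    have r: "r \<in> {1..m i}"
      using that by (simp add: past_def)
    \<comment> \<open>The history admits all sets of naturals, whereas \<open>\<xi>\<close> is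
      measurable into \<open>{1..N}\<close>; cutting \<open>S\<close> down does not change the
      preimage.\<close>
    have "\<xi> i r -` S \<inter> space P = \<xi> i r -` (S \<inter> {1..N}) \<inter> space P"
      using measurable_space[OF \<xi>_measurable[OF r]] by auto
    then show ?thesis
      using measurable_sets[OF \<xi>_measurable[OF r], of "S \<inter> {1..N}"] by simp
  qed
  moreover have "e i r -` S \<inter> space P \<in> sets P" if "(i, r) \<in> past k t" "S \<in> sets borel" for i r S
    using that measurable_sets[OF borel_measurable_integrable[OF e_integrable[of r i]]] by (simp add: past_def)
  moreover have "y i -` S \<inter> space P \<in> sets P" if "i \<le> k" "S \<in> sets borel" for i S
    using that measurable_sets[OF y_measurable] by simp
  ultimately have "hist_gen k t \<subseteq> sets P"
    by (rule hist_gen_subsetI)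
  then show ?thesis
    unfolding subalgebra_def sets_hist space_hist by (simp add: sets.sigma_sets_subset)
qed

lemma hist_measurable_P: "h \<in> borel_measurable (hist k t) \<Longrightarrow> h \<in> borel_measurable P"
  by (rule measurable_from_subalg[OF hist_subalgebra])

lemma hist_y: "y k \<in> borel_measurable (hist k t)"
proof (rule measurableI)
  fix S :: "(real^'n2) set" assume "S \<in> sets borel"
  then have "y k -` S \<inter> space P \<in> hist_gen k t"
    by (intro hist_gen_intros) auto
  then show "y k -` S \<inter> space (hist k t) \<in> sets (hist k t)"
    unfolding sets_hist space_hist by (rule sigma_sets.Basic)
qed simp

lemma hist_e:
  assumes "r \<in> {1..m k}" "r < t"
  shows "e k r \<in> borel_measurable (hist k t)"
proof (rule measurableI)
  fix S :: "(real^'n1) set" assume "S \<in> sets borel"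
  moreover have "(k, r) \<in> past k t"
    using assms by (simp add: past_def)
  ultimately have "e k r -` S \<inter> space P \<in> hist_gen k t"
    by (intro hist_gen_intros)
  then show "e k r -` S \<inter> space (hist k t) \<in> sets (hist k t)"
    unfolding sets_hist space_hist by (rule sigma_sets.Basic)
qed simp

lemma hist_\<xi>:
  assumes "r \<in> {1..m k}" "r < t"
  shows "\<xi> k r \<in> hist k t \<rightarrow>\<^sub>M count_space UNIV"
proof (rule measurableI)
  fix S :: "nat set"
  have "(k, r) \<in> past k t"
    using assms by (simp add: past_def)
  then have "\<xi> k r -` S \<inter> space P \<in> hist_gen k t"
    by (intro hist_gen_intros)
  then show "\<xi> k r -` S \<inter> space (hist k t) \<in> sets (hist k t)"
    unfolding sets_hist space_hist by (rule sigma_sets.Basic)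
qed simp

lemma \<xi>_range: "t \<in> {1..m k} \<Longrightarrow> \<omega> \<in> space P \<Longrightarrow> \<xi> k t \<omega> \<in> {1..N}"
  using measurable_space[OF \<xi>_measurable] by simp

section \<open>Gradients along random points\<close>

lemma gradient_lipschitz:
  obtains L where "L > 0" "\<And>j u v. j \<in> {1..N} \<Longrightarrow> u \<in> X \<Longrightarrow> v \<in> X \<Longrightarrow>
    norm (gradient (fs j) u - gradient (fs j) v) \<le> L * norm (u - v)"
proof -
  obtain K where K: "K > 0" "\<And>a. norm a \<le> K * norm_wrt (matrix_inv H) a"
    using norm_wrt_matrix_inv_bounded_below[OF pos_def_H] by blast
  obtain K' where K': "K' > 0" "\<And>u. norm_wrt H u \<le> K' * norm u"
    using norm_wrt_bounded_above by blast
  show thesis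
  proof (rule that)
    show "K * \<nu> * K' > 0"
      using K K' \<nu>_pos by simp
    fix j u v assume *: "j \<in> {1..N}" "u \<in> X" "v \<in> X"
    have "norm (gradient (fs j) u - gradient (fs j) v) \<le> K * norm_wrt (matrix_inv H) (gradient (fs j) u - gradient (fs j) v)"
      by (rule K)
    also have "\<dots> \<le> K * (\<nu> * norm_wrt H (u - v))"
      using K(1) lipschitz_fs[OF *] by (intro mult_left_mono) auto
    also have "\<dots> \<le> K * (\<nu> * (K' * norm (u - v)))"
      using K(1) \<nu>_pos K'(2) by (intro mult_left_mono) auto
    finally show "norm (gradient (fs j) u - gradient (fs j) v) \<le> K * \<nu> * K' * norm (u - v)"
      by (simp add: mult_ac)
  qed
qed

text \<open>The gradient is known to be continuous only on \<open>X\<close>, so \<open>w\<close> is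
  regarded as a map into that subspace.\<close>

lemma gradient_measurable:
  assumes j: "j \<in> {1..N}" and w: "w \<in> borel_measurable F" "\<And>\<omega>. \<omega> \<in> space F \<Longrightarrow> w \<omega> \<in> X"
  shows "(\<lambda>\<omega>. gradient (fs j) (w \<omega>)) \<in> borel_measurable F"
proof -
  obtain L where L: "L > 0" "\<And>j u v. j \<in> {1..N} \<Longrightarrow> u \<in> X \<Longrightarrow> v \<in> X \<Longrightarrow>
    norm (gradient (fs j) u - gradient (fs j) v) \<le> L * norm (u - v)"
    using gradient_lipschitz by blast
  have "L-lipschitz_on X (gradient (fs j))"
    using L j by (intro lipschitz_onI) (auto simp: dist_norm)
  then have "gradient (fs j) \<in> borel_measurable (restrict_space borel X)"
    by (intro borel_measurable_continuous_on_restrict lipschitz_on_continuous_on)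
  moreover have "w \<in> F \<rightarrow>\<^sub>M restrict_space borel X"
    using w by (intro measurable_restrict_space2) auto
  ultimately show ?thesis
    by (rule measurable_compose[rotated])
qed

lemma gradient_square_integrable:
  assumes w: "square_integrable P w" "\<And>\<omega>. \<omega> \<in> space P \<Longrightarrow> w \<omega> \<in> X" and j: "j \<in> {1..N}"
  shows "square_integrable P (\<lambda>\<omega>. gradient (fs j) (w \<omega>))"
proof -
  obtain L where L: "L > 0" "\<And>j u v. j \<in> {1..N} \<Longrightarrow> u \<in> X \<Longrightarrow> v \<in> X \<Longrightarrow>
    norm (gradient (fs j) u - gradient (fs j) v) \<le> L * norm (u - v)"
    using gradient_lipschitz by blast
  show ?thesis
  proof (rule square_integrable_affine_bound[OF w(1)])
    show "(\<lambda>\<omega>. gradient (fs j) (w \<omega>)) \<in> borel_measurable P"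
      using w j by (intro gradient_measurable) (auto simp: square_integrable_def)
    fix \<omega> assume "\<omega> \<in> space P"
    then have "norm (gradient (fs j) (w \<omega>) - gradient (fs j) x0) \<le> L * norm (w \<omega> - x0)"
      using w(2) x0_in j by (intro L) auto
    also have "\<dots> \<le> L * (norm (w \<omega>) + norm x0)"
      using L(1) by (intro mult_left_mono norm_triangle_ineq4) auto
    finally show "norm (gradient (fs j) (w \<omega>)) \<le> (norm (gradient (fs j) x0) + L * norm x0) + L * norm (w \<omega>)"
      using norm_triangle_ineq2[of "gradient (fs j) (w \<omega>)" "gradient (fs j) x0"] by (simp add: distrib_left)
  qed
qed

lemma gradient_f_square_integrable:
  assumes w: "square_integrable P w" "\<And>\<omega>. \<omega> \<in> space P \<Longrightarrow> w \<omega> \<in> X"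
  shows "square_integrable P (\<lambda>\<omega>. gradient f (w \<omega>))"
proof -
  have "square_integrable P (\<lambda>\<omega>. \<Sum>j\<in>J. gradient (fs j) (w \<omega>))" if "finite J" "J \<subseteq> {1..N}" for J
    using that
  proof (induction J)
    case empty
    show ?case by (simp add: square_integrable_const)
  next
    case (insert j J)
    then show ?case
      using square_integrable_add[OF gradient_square_integrable[OF w, of j]] by simp
  qed
  then have "square_integrable P (\<lambda>\<omega>. (1 / real N) *\<^sub>R (\<Sum>j = 1..N. gradient (fs j) (w \<omega>)))"
    by (intro square_integrable_scaleR) auto
  then show ?thesis
  proof (rule square_integrable_bound)
    have "(\<lambda>\<omega>. (1 / real N) *\<^sub>R (\<Sum>j = 1..N. gradient (fs j) (w \<omega>))) \<in> borel_measurable P"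
      using square_integrable_measurable[OF w(1)] w(2)
      by (intro borel_measurable_scaleR borel_measurable_sum gradient_measurable) auto
    then show "(\<lambda>\<omega>. gradient f (w \<omega>)) \<in> borel_measurable P"
      by (subst measurable_cong[OF gradient_f[OF w(2)]])
  qed (simp add: gradient_f w(2))
qed

text \<open>Known just before the sample with index \<open>t\<close> of outer iteration
  \<open>k\<close> is drawn. Square integrability is carried along because the cross terms of the
  noise are inner products.\<close>

definition adapted :: "nat \<Rightarrow> nat \<Rightarrow> ('w \<Rightarrow> 'b::euclidean_space) \<Rightarrow> bool" where
  "adapted k t Z \<longleftrightarrow> Z \<in> borel_measurable (hist k t) \<and> square_integrable P Z"

lemma adapted_const: "adapted k t (\<lambda>_. c)"
  by (simp add: adapted_def square_integrable_const)

lemma adapted_add: "adapted k t Z \<Longrightarrow> adapted k t W \<Longrightarrow> adapted k t (\<lambda>\<omega>. Z \<omega> + W \<omega>)"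
  unfolding adapted_def by (intro conjI borel_measurable_add borel_measurable_const square_integrable_add; elim conjE)

lemma adapted_diff: "adapted k t Z \<Longrightarrow> adapted k t W \<Longrightarrow> adapted k t (\<lambda>\<omega>. Z \<omega> - W \<omega>)"
  unfolding adapted_def by (intro conjI borel_measurable_diff borel_measurable_const square_integrable_diff; elim conjE)

lemma adapted_scaleR: "adapted k t Z \<Longrightarrow> adapted k t (\<lambda>\<omega>. r *\<^sub>R Z \<omega>)"
  unfolding adapted_def by (intro conjI borel_measurable_scaleR borel_measurable_const square_integrable_scaleR; elim conjE)

lemma adapted_matrix:
  fixes G :: "real^'a^'b"
  shows "adapted k t Z \<Longrightarrow> adapted k t (\<lambda>\<omega>. G *v Z \<omega>)"
  unfolding adapted_def
  by (auto intro: square_integrable_matrix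
      measurable_compose[OF _ borel_measurable_continuous_onI[OF matrix_vector_mult_linear_continuous_on]])

lemma adapted_mono: "adapted k t Z \<Longrightarrow> k < k' \<or> k = k' \<and> t \<le> t' \<Longrightarrow> adapted k' t' Z"
  unfolding adapted_def using measurable_from_subalg[OF hist_mono] by blast

lemma adapted_L2: "adapted k t Z \<Longrightarrow> square_integrable P Z"
  by (simp add: adapted_def)

text \<open>The recursions of the algorithm are available only on \<open>space P\<close>, so
  equality there must suffice.\<close>

lemma adapted_cong:
  assumes Z: "adapted k t Z" and eq: "\<And>\<omega>. \<omega> \<in> space P \<Longrightarrow> W \<omega> = Z \<omega>"
  shows "adapted k t W"
proof -
  have "W \<in> borel_measurable (hist k t) \<longleftrightarrow> Z \<in> borel_measurable (hist k t)"
    by (rule measurable_cong) (unfold space_hist, rule eq)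
  with Z have W: "W \<in> borel_measurable (hist k t)"
    unfolding adapted_def by blast
  have "norm (W \<omega>) \<le> norm (Z \<omega>)" if "\<omega> \<in> space P" for \<omega>
    unfolding eq[OF that] by (rule order_refl)
  from square_integrable_bound[OF adapted_L2[OF Z] hist_measurable_P[OF W] this]
  show ?thesis
    unfolding adapted_def using W by blast
qed

lemma adapted_accel: "adapted k t Z \<Longrightarrow> adapted k t W \<Longrightarrow> adapted k t (\<lambda>\<omega>. accel r (Z \<omega>) (W \<omega>))"
  unfolding accel_def by (intro adapted_add adapted_scaleR)

lemmas paths = pathD[OF all_paths]
lemmas paths_in_X = path_in_X[OF all_paths]
lemmas paths_in_Y = path_y_in_Y[OF all_paths]

definition xh :: "nat \<Rightarrow> nat \<Rightarrow> 'w \<Rightarrow> real^'n1" where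
  "xh k t \<omega> = accel t (zb k t \<omega>) (z k t \<omega>)"

definition sample_grad :: "nat \<Rightarrow> nat \<Rightarrow> 'w \<Rightarrow> real^'n1" where
  "sample_grad k t \<omega> = stoch_grad fs (\<xi> k t \<omega>) (e k t \<omega>) (xh k t \<omega>)"

lemma gerr_eq_diff: "gerr k t \<omega> = gradient f (xh k t \<omega>) - sample_grad k t \<omega>"
  by (simp add: gerr_eq sample_grad_def xh_def)

lemma xh_in_X: "\<omega> \<in> space P \<Longrightarrow> t \<in> {1..m k} \<Longrightarrow> xh k t \<omega> \<in> X"
  unfolding xh_def by (intro accel_in_X) (auto intro!: paths_in_X)

lemma adapted_gradient:
  assumes "adapted k t w" "\<And>\<omega>. \<omega> \<in> space P \<Longrightarrow> w \<omega> \<in> X" "j \<in> {1..N}"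
  shows "adapted k t (\<lambda>\<omega>. gradient (fs j) (w \<omega>))"
  using assms unfolding adapted_def
  by (auto intro!: gradient_measurable gradient_square_integrable simp: space_hist)

lemma adapted_gradient_f:
  assumes "adapted k t w" "\<And>\<omega>. \<omega> \<in> space P \<Longrightarrow> w \<omega> \<in> X"
  shows "adapted k t (\<lambda>\<omega>. gradient f (w \<omega>))"
proof -
  have "(\<lambda>\<omega>. (1 / real N) *\<^sub>R (\<Sum>j = 1..N. gradient (fs j) (w \<omega>))) \<in> borel_measurable (hist k t)"
    using assms adapted_gradient[OF assms]
    by (intro borel_measurable_scaleR borel_measurable_sum) (auto simp: adapted_def)
  then have "(\<lambda>\<omega>. gradient f (w \<omega>)) \<in> borel_measurable (hist k t)"
    using assms(2) by (subst measurable_cong[OF gradient_f]) (auto simp: space_hist)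
  then show ?thesis
    using assms by (auto simp: adapted_def intro!: gradient_f_square_integrable)
qed

lemma selected_gradient_measurable:
  assumes t: "t \<in> {1..m k}" and w: "w \<in> borel_measurable (hist k t)" "\<And>\<omega>. \<omega> \<in> space P \<Longrightarrow> w \<omega> \<in> X"
  shows "(\<lambda>\<omega>. gradient (fs (\<xi> k t \<omega>)) (w \<omega>)) \<in> borel_measurable (hist k (t + 1))"
proof -
  have w': "w \<in> borel_measurable (hist k (t + 1))"
    using w(1) by (rule measurable_from_subalg[OF hist_mono, rotated]) simp
  \<comment> \<open>The random index takes countably many values, so measurability is checked for
    each fixed index; the value 0 fills in for indices at which nothing is known about
    \<open>fs j\<close>.\<close>
  have "(\<lambda>\<omega>. if j \<in> {1..N} then gradient (fs j) (w \<omega>) else 0) \<in> borel_measurable (hist k (t + 1))" for j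
  proof (cases "j \<in> {1..N}")
    case True
    have "(\<lambda>\<omega>. gradient (fs j) (w \<omega>)) \<in> borel_measurable (hist k (t + 1))"
      by (rule gradient_measurable[OF True w']) (simp only: space_hist w(2))
    then show ?thesis
      by (simp only: True if_True)
  qed (simp only: if_False borel_measurable_const)
  moreover have "\<xi> k t \<in> hist k (t + 1) \<rightarrow>\<^sub>M count_space UNIV"
    using t by (intro hist_\<xi>) auto
  ultimately have "(\<lambda>\<omega>. if \<xi> k t \<omega> \<in> {1..N} then gradient (fs (\<xi> k t \<omega>)) (w \<omega>) else 0) \<in> borel_measurable (hist k (t + 1))"
    by (rule measurable_compose_countable)
  then show ?thesis
    using \<xi>_range[OF t] by (subst measurable_cong) (auto simp: space_hist)
qed

text \<open>The hypothesis on \<open>e\<close> gives only a first moment. The second moment comes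
  from the variance bound on \<open>gerr\<close>, since the sampled gradient equals the full
  gradient minus \<open>gerr\<close>.\<close>

lemma adapted_sample_grad:
  assumes t: "t \<in> {1..m k}" and xh: "adapted k t (xh k t)"
  shows "adapted k (t + 1) (sample_grad k t)" "square_integrable P (gerr k t)"
proof -
  have gf: "adapted k t (\<lambda>\<omega>. gradient f (xh k t \<omega>))"
    using xh xh_in_X[OF _ t] by (intro adapted_gradient_f)
  have "e k t \<in> borel_measurable (hist k (t + 1))"
    using t by (intro hist_e) auto
  moreover have "(\<lambda>\<omega>. gradient (fs (\<xi> k t \<omega>)) (xh k t \<omega>)) \<in> borel_measurable (hist k (t + 1))"
    using xh xh_in_X[OF _ t] by (intro selected_gradient_measurable t) (auto simp: adapted_def)
  ultimately have sample_grad: "sample_grad k t \<in> borel_measurable (hist k (t + 1))"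
    unfolding sample_grad_def stoch_grad_def by simp
  then have sample_grad': "sample_grad k t \<in> borel_measurable P"
    by (rule hist_measurable_P)
  obtain K where K: "K > 0" "\<And>a. norm a \<le> K * norm_wrt (matrix_inv H) a"
    using norm_wrt_matrix_inv_bounded_below[OF pos_def_H] by blast
  have nonneg: "norm_wrt (matrix_inv H) a \<ge> 0" for a
    using pos_defD(2)[OF pos_def_H] by (simp add: norm_wrt_def sqnorm_wrt_matrix_inv[OF pos_def_H])
  have gerr: "gerr k t \<in> borel_measurable P"
    unfolding gerr_eq_diff[abs_def] using sample_grad' square_integrable_measurable[OF adapted_L2[OF gf]]
    by (intro borel_measurable_diff)
  show g2: "square_integrable P (gerr k t)"
    unfolding square_integrable_def
  proof (intro conjI gerr)
    have "integrable P (\<lambda>\<omega>. K\<^sup>2 * (norm_wrt (matrix_inv H) (gerr k t \<omega>))\<^sup>2)"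
      using gerr_variance[OF t] by auto
    then show "integrable P (\<lambda>\<omega>. (norm (gerr k t \<omega>))\<^sup>2)"
    proof (rule Bochner_Integration.integrable_bound)
      show "(\<lambda>\<omega>. (norm (gerr k t \<omega>))\<^sup>2) \<in> borel_measurable P"
        using gerr by simp
      have "(norm (gerr k t \<omega>))\<^sup>2 \<le> (K * norm_wrt (matrix_inv H) (gerr k t \<omega>))\<^sup>2" for \<omega>
        by (intro power_mono K) auto
      then show "AE \<omega> in P. norm ((norm (gerr k t \<omega>))\<^sup>2) \<le> norm (K\<^sup>2 * (norm_wrt (matrix_inv H) (gerr k t \<omega>))\<^sup>2)"
        by (auto simp: power_mult_distrib)
    qed
  qed
  have "square_integrable P (\<lambda>\<omega>. gradient f (xh k t \<omega>) - gerr k t \<omega>)"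
    using g2 adapted_L2[OF gf] by (intro square_integrable_diff)
  then show "adapted k (t + 1) (sample_grad k t)"
    using sample_grad by (simp add: adapted_def gerr_eq_diff)
qed

text \<open>Feasibility of \<open>(us, vs)\<close> rewrites the residual as
  \<open>A *v (x - us) + B *v (y - vs)\<close>, so \<open>y\<close> enters only through
  \<open>B\<close>.\<close>

lemma adapted_residual:
  assumes "adapted k t (x i)" "adapted k t (\<lambda>\<omega>. B *v (y j \<omega> - vs))"
  shows "adapted k t (\<lambda>\<omega>. residual A B b (x i \<omega>) (y j \<omega>))"
proof -
  have "adapted k t (\<lambda>\<omega>. A *v (x i \<omega> - us) + B *v (y j \<omega> - vs))"
    by (intro adapted_add[OF adapted_matrix[OF adapted_diff[OF assms(1) adapted_const]] assms(2)])
  then show ?thesis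
    using solution_properties(4)[OF solution]
    by (elim adapted_cong) (simp add: residual_def matrix_vector_mult_diff_distrib algebra_simps)
qed

lemma pos_def_prox:
  assumes "\<gamma> > 0"
  shows "pos_def (\<gamma> *\<^sub>R H + MM k)"
proof -
  have "transpose (\<gamma> *\<^sub>R H + MM k) = \<gamma> *\<^sub>R H + MM k"
    using pos_defD(1)[OF pos_def_H] sym_MM[of k] by (simp add: transpose_def vec_eq_iff)
  moreover have "0 < u \<bullet> ((\<gamma> *\<^sub>R H + MM k) *v u)" if "u \<noteq> 0" for u
  proof -
    have "0 < \<gamma> * (u \<bullet> (H *v u))"
      using pos_def_H that assms by (simp add: pos_def_def)
    moreover have "0 \<le> u \<bullet> (MM k *v u)"
      using MM_psd[of k] by (simp add: pos_semidef_def)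
    ultimately show ?thesis
      by (simp add: matrix_vector_mult_add_rdistrib scaleR_matrix_vector_assoc[symmetric] inner_add_right)
  qed
  ultimately show ?thesis
    by (simp add: pos_def_def)
qed

lemma adapted_prox_step:
  assumes t: "t \<in> {1..m k}"
    and z: "adapted k t (z k t)" "adapted k t (zb k t)"
    and x: "adapted k t (x k)" and l: "adapted k t (l k)" and y: "adapted k t (\<lambda>\<omega>. B *v (y k \<omega> - vs))"
  shows "adapted k (t + 1) (z k (t + 1))" "adapted k (t + 1) (zb k (t + 1))"
proof -
  have up: "adapted k (t + 1) w" if "adapted k t w" for w :: "'w \<Rightarrow> 'c::euclidean_space"
    using that by (rule adapted_mono) simp
  define \<gamma> where "\<gamma> = 2 / (real t * \<eta> k)"
  have \<gamma>: "\<gamma> > 0"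
    using t \<eta>_pos[of k] by (simp add: \<gamma>_def)
  have "adapted k t (xh k t)"
    unfolding xh_def[abs_def] using z by (intro adapted_accel)
  note d = adapted_sample_grad(1)[OF t this]
  define v where "v \<omega> = (sample_grad k t \<omega> + hvec (x k \<omega>) (y k \<omega>) (l k \<omega>)) - \<gamma> *\<^sub>R (H *v zb k t \<omega>) - MM k *v x k \<omega>" for \<omega>
  have h: "adapted k t (\<lambda>\<omega>. hvec (x k \<omega>) (y k \<omega>) (l k \<omega>))"
  proof (rule adapted_cong)
    show "adapted k t (\<lambda>\<omega>. (-1) *\<^sub>R (transpose A *v (l k \<omega> - \<beta> *\<^sub>R residual A B b (x k \<omega>) (y k \<omega>))))"
      by (intro adapted_scaleR adapted_matrix adapted_diff l adapted_residual[OF x y])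
  qed simp
  have v: "adapted k (t + 1) v"
    unfolding v_def
    by (intro adapted_diff[OF adapted_diff[OF adapted_add[OF d up[OF h]]
          adapted_scaleR[OF adapted_matrix[OF up[OF z(2)]]]] adapted_matrix[OF up[OF x]]])
  have sg: "sgrad (\<lambda>k t. \<xi> k t \<omega>) (\<lambda>k t. e k t \<omega>) (\<lambda>k t. z k t \<omega>) (\<lambda>k t. zb k t \<omega>) k t = sample_grad k t \<omega>" for \<omega>
    by (simp only: sgrad_def sample_grad_def xh_def)
  have VI: "quad_VI X (\<gamma> *\<^sub>R H + MM k) (v \<omega>) (zb k (t + 1) \<omega>)" if "\<omega> \<in> space P" for \<omega>
    unfolding v_def
    by (rule arg_min_quad_VI[OF convex_X pos_defD(1)[OF pos_def_H] sym_MM paths(7)[OF that t, folded \<gamma>_def, unfolded sg]])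
  have v_meas: "v \<in> borel_measurable (hist k (t + 1))"
    using v unfolding adapted_def by blast
  note prox = quad_VI_measurable[OF closed_X convex_X x0_in pos_def_prox[OF \<gamma>]]
  have meas: "zb k (t + 1) \<in> borel_measurable (hist k (t + 1))"
    by (rule prox(1)[OF v_meas VI]) (simp only: space_hist)
  obtain a r where "\<forall>\<omega>\<in>space P. norm (zb k (t + 1) \<omega>) \<le> a + r * norm (v \<omega>)"
    using prox(2)[OF hist_measurable_P[OF v_meas] VI] by blast
  then have "square_integrable P (zb k (t + 1))"
    by (intro square_integrable_affine_bound[OF adapted_L2[OF v] hist_measurable_P[OF meas], of a r]) blast
  with meas show zb': "adapted k (t + 1) (zb k (t + 1))"
    by (simp add: adapted_def)
  have "adapted k (t + 1) (\<lambda>\<omega>. accel t (zb k (t + 1) \<omega>) (z k t \<omega>))"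
    using zb' z up by (intro adapted_accel)
  then show "adapted k (t + 1) (z k (t + 1))"
    using paths(8)[OF _ t] by (rule adapted_cong)
qed

text \<open>The optimality of \<open>y\<close> tested at \<open>vs\<close> and the saddle inequality
  at \<open>(us, y)\<close> add up to \<open>c \<bullet> c \<le> w \<bullet> c\<close>, where
  \<open>c\<close> is the image under \<open>B\<close> and \<open>w\<close> the vector on the right.
  The values of \<open>g\<close> cancel, and only the image under \<open>B\<close> is
  controlled.\<close>

lemma y_bound:
  assumes \<omega>: "\<omega> \<in> space P"
  shows "norm (B *v (y (Suc k) \<omega> - vs))
    \<le> norm ((1 / \<beta>) *\<^sub>R (l k \<omega> - \<mu>s) - A *v (x (Suc k) \<omega> - us))"
proof -
  note sp = solution_properties[OF solution]
  define c where "c = B *v (y (Suc k) \<omega> - vs)"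
  define a where "a = A *v (x (Suc k) \<omega> - us)"
  define r where "r = residual A B b (x (Suc k) \<omega>) (y (Suc k) \<omega>)"
  have vs: "g vs \<noteq> \<infinity>"
    using sp(3) by auto
  have r: "r = a + c"
    using sp(4) by (simp add: r_def a_def c_def residual_def matrix_vector_mult_diff_distrib algebra_simps)
  have "gr (y (Suc k) \<omega>) - gr vs \<le> (l k \<omega> - \<beta> *\<^sub>R r) \<bullet> c"
    using y_step(2)[OF all_paths[OF \<omega>] sp(2) vs, of k] by (simp add: r_def c_def)
  moreover have "0 \<le> gr (y (Suc k) \<omega>) - gr vs - \<mu>s \<bullet> residual A B b us (y (Suc k) \<omega>)"
    using sp(5)[OF sp(1) paths_in_Y[OF \<omega>, of "Suc k"]] y_step(1)[OF all_paths[OF \<omega>] sp(2) vs, of k] by simp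
  moreover have "residual A B b us (y (Suc k) \<omega>) = c"
    using sp(4) by (simp add: c_def residual_def matrix_vector_mult_diff_distrib algebra_simps)
  ultimately have "0 \<le> (l k \<omega> - \<beta> *\<^sub>R r) \<bullet> c - \<mu>s \<bullet> c"
    by simp
  also have "\<dots> = \<beta> * (((1 / \<beta>) *\<^sub>R (l k \<omega> - \<mu>s) - a) \<bullet> c - c \<bullet> c)"
    using \<beta>_pos by (simp add: r inner_diff_left inner_add_left field_simps)
  finally have "c \<bullet> c \<le> ((1 / \<beta>) *\<^sub>R (l k \<omega> - \<mu>s) - a) \<bullet> c"
    using \<beta>_pos by (simp add: zero_le_mult_iff)
  also have "\<dots> \<le> norm ((1 / \<beta>) *\<^sub>R (l k \<omega> - \<mu>s) - a) * norm c"
    by (rule norm_cauchy_schwarz)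
  finally have "norm c * norm c \<le> norm ((1 / \<beta>) *\<^sub>R (l k \<omega> - \<mu>s) - a) * norm c"
    by (simp add: power2_norm_eq_inner[symmetric] power2_eq_square)
  then show ?thesis
    by (cases "c = 0") (auto simp: c_def[symmetric] a_def[symmetric])
qed

lemma adapted_inner:
  assumes "adapted k 1 (x k)" "adapted k 1 (xb k)" "adapted k 1 (l k)" "adapted k 1 (\<lambda>\<omega>. B *v (y k \<omega> - vs))"
    and "t \<in> {1..m k + 1}"
  shows "adapted k t (z k t) \<and> adapted k t (zb k t)"
  using assms(5)
proof (induction t)
  case (Suc t)
  show ?case
  proof (cases "t = 0")
    case True
    then show ?thesis
      using adapted_cong[OF assms(1) paths(5)] adapted_cong[OF assms(2) paths(6)] by simp
  next
    case False
    then have t: "t \<in> {1..m k}"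
      using Suc.prems by simp
    have up: "adapted k t w" if "adapted k 1 w" for w :: "'w \<Rightarrow> 'c::euclidean_space"
      using that t by (intro adapted_mono[OF that]) auto
    show ?thesis
      using adapted_prox_step[OF t _ _ up[OF assms(1)] up[OF assms(3)] up[OF assms(4)]] Suc.IH t by simp
  qed
qed simp

text \<open>For the new \<open>y\<close>, measurability holds because the history lists it, and the
  second moment comes from \<open>y_bound\<close>; the other outer iterates are built from adapted
  ones.\<close>

lemma adapted_outer:
  "adapted k 1 (x k) \<and> adapted k 1 (xb k) \<and> adapted k 1 (l k) \<and> adapted k 1 (\<lambda>\<omega>. B *v (y k \<omega> - vs))"
proof (induction k)
  case 0
  have "B *v (y 0 \<omega> - vs) = B *v (y0 - vs)" if "\<omega> \<in> space P" for \<omega>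
    unfolding paths(3)[OF that] by (rule refl)
  then show ?case
    by (intro conjI adapted_cong[OF adapted_const paths(1)] adapted_cong[OF adapted_const paths(2)]
        adapted_cong[OF adapted_const paths(4)] adapted_cong[OF adapted_const])
next
  case (Suc k)
  have up: "adapted (Suc k) 1 w" if "adapted k t w" for w :: "'w \<Rightarrow> 'c::euclidean_space" and t
    using that by (rule adapted_mono) simp
  have z: "adapted k (m k + 1) (z k (m k + 1))" "adapted k (m k + 1) (zb k (m k + 1))"
    using adapted_inner[of k "m k + 1"] Suc.IH by auto
  have x: "adapted (Suc k) 1 (x (Suc k))"
    by (rule adapted_cong[OF up[OF z(1)] paths(9)])
  have xb: "adapted (Suc k) 1 (xb (Suc k))"
    by (rule adapted_cong[OF up[OF z(2)] paths(10)])
  have l: "adapted (Suc k) 1 (l k)"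
    using Suc.IH by (intro up[of 1]) simp
  have W: "adapted (Suc k) 1 (\<lambda>\<omega>. (1 / \<beta>) *\<^sub>R (l k \<omega> - \<mu>s) - A *v (x (Suc k) \<omega> - us))"
    by (intro adapted_diff[OF adapted_scaleR[OF adapted_diff[OF l adapted_const]]
          adapted_matrix[OF adapted_diff[OF x adapted_const]]])
  have "(\<lambda>\<omega>. y (Suc k) \<omega> - vs) \<in> borel_measurable (hist (Suc k) 1)"
    by (intro borel_measurable_diff hist_y borel_measurable_const)
  then have meas: "(\<lambda>\<omega>. B *v (y (Suc k) \<omega> - vs)) \<in> borel_measurable (hist (Suc k) 1)"
    by (rule measurable_compose[OF _ borel_measurable_continuous_onI[OF matrix_vector_mult_linear_continuous_on]])
  have By: "adapted (Suc k) 1 (\<lambda>\<omega>. B *v (y (Suc k) \<omega> - vs))"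
    unfolding adapted_def
    by (intro conjI meas square_integrable_bound[OF adapted_L2[OF W] hist_measurable_P[OF meas]] y_bound)
  have "adapted (Suc k) 1 (\<lambda>\<omega>. l k \<omega> - (s * \<beta>) *\<^sub>R residual A B b (x (Suc k) \<omega>) (y (Suc k) \<omega>))"
    by (intro adapted_diff[OF l adapted_scaleR[OF adapted_residual[OF x By]]])
  then have "adapted (Suc k) 1 (l (Suc k))"
    using paths(12) by (rule adapted_cong)
  with x xb By show ?case
    by simp
qed

section \<open>Expected errors\<close>

lemma \<xi>_probability:
  assumes t: "t \<in> {1..m k}" and j: "j \<in> {1..N}"
  shows "expectation (\<lambda>\<omega>. indicator {j} (\<xi> k t \<omega>)) = 1 / real N"
proof -
  have "expectation (\<lambda>\<omega>. indicator {j} (\<xi> k t \<omega>))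
      = (\<integral>i. (indicator {j} i :: real) \<partial>distr P (count_space {1..N}) (\<xi> k t))"
    by (rule integral_distr[OF \<xi>_measurable[OF t], of "indicator {j} :: nat \<Rightarrow> real", symmetric]) simp
  also have "\<dots> = measure (uniform_count_measure {1..N}) ({j} \<inter> {1..N})"
    unfolding \<xi>_uniform[OF t] by (subst Bochner_Integration.integral_indicator) (simp only: space_uniform_count_measure)
  also have "\<dots> = 1 / real N"
    using j by (subst measure_uniform_count_measure) auto
  finally show ?thesis .
qed

lemma \<xi>_indep_expectation:
  assumes t: "t \<in> {1..m k}" and j: "j \<in> {1..N}"
    and V: "V \<in> borel_measurable (hist k t)" "integrable P V"
  shows "integrable P (\<lambda>\<omega>. indicator {j} (\<xi> k t \<omega>) * V \<omega>)"
    and "expectation (\<lambda>\<omega>. indicator {j} (\<xi> k t \<omega>) * V \<omega>) = expectation V / real N"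
proof -
  define I :: "'w \<Rightarrow> real" where "I \<omega> = indicator {j} (\<xi> k t \<omega>)" for \<omega>
  let ?F = "vimage_algebra (space P) (\<xi> k t) (count_space {1..N})"
  have "\<xi> k t \<in> ?F \<rightarrow>\<^sub>M count_space {1..N}"
    using \<xi>_range[OF t] by (intro measurable_vimage_algebra1) auto
  then have IF: "I \<in> borel_measurable ?F"
    unfolding I_def by (rule measurable_compose) simp
  have IP: "I \<in> borel_measurable P"
    unfolding I_def by (rule measurable_compose[OF \<xi>_measurable[OF t]]) simp
  have I_int: "integrable P I"
    by (intro integrable_const_bound[of _ 1] IP) (simp add: I_def indicator_def)
  \<comment> \<open>Independence of random variables concerns the \<sigma>-algebras they generate;
    these lie in the history and in the \<sigma>-algebra of \<open>\<xi>\<close>, which are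
    independent by hypothesis.\<close>
  have sub_V: "sigma_sets (space P) {V -` S \<inter> space P | S. S \<in> sets borel} \<subseteq> sets (hist k t)"
    using sets.sigma_sets_subset[of "{V -` S \<inter> space P | S. S \<in> sets borel}" "hist k t"]
      measurable_sets[OF V(1)] unfolding space_hist by blast
  have sub_I: "sigma_sets (space P) {I -` S \<inter> space P | S. S \<in> sets borel} \<subseteq> sets ?F"
    using sets.sigma_sets_subset[of "{I -` S \<inter> space P | S. S \<in> sets borel}" ?F]
      measurable_sets[OF IF] unfolding space_vimage_algebra by blast
  have "indep_set (sigma_sets (space P) {V -` S \<inter> space P | S. S \<in> sets borel})
      (sigma_sets (space P) {I -` S \<inter> space P | S. S \<in> sets borel})"
    using \<xi>_indep[OF t] sub_V sub_I unfolding indep_sets2_eq by blast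
  then have indep: "indep_var borel V borel I"
    unfolding indep_var_eq using hist_measurable_P[OF V(1)] IP by blast
  have "integrable P (\<lambda>\<omega>. V \<omega> * I \<omega>)"
    by (rule indep_var_integrable[OF indep V(2) I_int])
  then show "integrable P (\<lambda>\<omega>. indicator {j} (\<xi> k t \<omega>) * V \<omega>)"
    by (simp add: I_def mult.commute)
  have "expectation (\<lambda>\<omega>. V \<omega> * I \<omega>) = expectation V * expectation I"
    by (rule indep_var_lebesgue_integral[OF indep V(2) I_int])
  also have "expectation I = 1 / real N"
    unfolding I_def by (rule \<xi>_probability[OF t j])
  finally show "expectation (\<lambda>\<omega>. indicator {j} (\<xi> k t \<omega>) * V \<omega>) = expectation V / real N"
    by (simp add: I_def mult.commute)
qed

lemma selected_gradient_square_integrable: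
  assumes t: "t \<in> {1..m k}" and w: "adapted k t w" "\<And>\<omega>. \<omega> \<in> space P \<Longrightarrow> w \<omega> \<in> X"
  shows "square_integrable P (\<lambda>\<omega>. gradient (fs (\<xi> k t \<omega>)) (w \<omega>))"
proof -
  obtain L where L: "L > 0" "\<And>j u v. j \<in> {1..N} \<Longrightarrow> u \<in> X \<Longrightarrow> v \<in> X \<Longrightarrow>
    norm (gradient (fs j) u - gradient (fs j) v) \<le> L * norm (u - v)"
    using gradient_lipschitz by blast
  \<comment> \<open>Summing over all \<open>j\<close> gives a constant that bounds the gradient at
    \<open>x0\<close> for whichever index is drawn.\<close>
  define C where "C = (\<Sum>j = 1..N. norm (gradient (fs j) x0))"
  have w_meas: "w \<in> borel_measurable (hist k t)"
    using w(1) unfolding adapted_def by blast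
  show ?thesis
  proof (rule square_integrable_affine_bound[OF adapted_L2[OF w(1)]])
    show "(\<lambda>\<omega>. gradient (fs (\<xi> k t \<omega>)) (w \<omega>)) \<in> borel_measurable P"
      by (rule hist_measurable_P[OF selected_gradient_measurable[OF t w_meas w(2)]])
    fix \<omega> assume \<omega>: "\<omega> \<in> space P"
    let ?j = "\<xi> k t \<omega>"
    have j: "?j \<in> {1..N}"
      by (rule \<xi>_range[OF t \<omega>])
    have "norm (gradient (fs ?j) (w \<omega>) - gradient (fs ?j) x0) \<le> L * norm (w \<omega> - x0)"
      by (rule L(2)[OF j w(2)[OF \<omega>] x0_in])
    also have "\<dots> \<le> L * (norm (w \<omega>) + norm x0)"
      using L(1) by (intro mult_left_mono norm_triangle_ineq4) auto
    finally have "norm (gradient (fs ?j) (w \<omega>)) \<le> norm (gradient (fs ?j) x0) + L * norm x0 + L * norm (w \<omega>)"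
      using norm_triangle_ineq2[of "gradient (fs ?j) (w \<omega>)" "gradient (fs ?j) x0"] by (simp add: distrib_left)
    moreover have "norm (gradient (fs ?j) x0) \<le> C"
      unfolding C_def using j by (intro member_le_sum) auto
    ultimately show "norm (gradient (fs ?j) (w \<omega>)) \<le> (C + L * norm x0) + L * norm (w \<omega>)"
      by linarith
  qed
qed

text \<open>Split according to the drawn index: each indicator is independent of the history and has
  mean \<open>1 / N\<close>, so the pieces reassemble to the gradient of the average
  \<open>f\<close>.\<close>

lemma selected_gradient_unbiased:
  assumes t: "t \<in> {1..m k}" and w: "adapted k t w" "\<And>\<omega>. \<omega> \<in> space P \<Longrightarrow> w \<omega> \<in> X" and W: "adapted k t W"
  shows "expectation (\<lambda>\<omega>. gradient (fs (\<xi> k t \<omega>)) (w \<omega>) \<bullet> W \<omega>) = expectation (\<lambda>\<omega>. gradient f (w \<omega>) \<bullet> W \<omega>)"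
proof -
  define V where "V j \<omega> = gradient (fs j) (w \<omega>) \<bullet> W \<omega>" for j \<omega>
  have V: "V j \<in> borel_measurable (hist k t)" "integrable P (V j)" if j: "j \<in> {1..N}" for j
  proof -
    have g: "adapted k t (\<lambda>\<omega>. gradient (fs j) (w \<omega>))"
      by (rule adapted_gradient[OF w j])
    then show "V j \<in> borel_measurable (hist k t)"
      unfolding V_def using W unfolding adapted_def by (intro borel_measurable_inner) blast+
    show "integrable P (V j)"
      unfolding V_def by (rule square_integrable_inner[OF adapted_L2[OF g] adapted_L2[OF W]])
  qed
  have "expectation (\<lambda>\<omega>. gradient (fs (\<xi> k t \<omega>)) (w \<omega>) \<bullet> W \<omega>)
      = expectation (\<lambda>\<omega>. \<Sum>j = 1..N. indicator {j} (\<xi> k t \<omega>) * V j \<omega>)"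
  proof (rule Bochner_Integration.integral_cong[OF refl])
    fix \<omega> assume \<omega>: "\<omega> \<in> space P"
    have "(\<Sum>j = 1..N. indicator {j} (\<xi> k t \<omega>) * V j \<omega>) = (\<Sum>j = 1..N. if j = \<xi> k t \<omega> then V j \<omega> else 0)"
      by (intro sum.cong) (auto simp: indicator_def)
    also have "\<dots> = V (\<xi> k t \<omega>) \<omega>"
      using \<xi>_range[OF t \<omega>] by (simp add: sum.delta)
    finally show "gradient (fs (\<xi> k t \<omega>)) (w \<omega>) \<bullet> W \<omega> = (\<Sum>j = 1..N. indicator {j} (\<xi> k t \<omega>) * V j \<omega>)"
      by (simp add: V_def)
  qed
  also have "\<dots> = (\<Sum>j = 1..N. expectation (\<lambda>\<omega>. indicator {j} (\<xi> k t \<omega>) * V j \<omega>))"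
    using \<xi>_indep_expectation(1)[OF t] V by (intro Bochner_Integration.integral_sum) blast
  also have "\<dots> = (\<Sum>j = 1..N. expectation (V j) / real N)"
    using \<xi>_indep_expectation(2)[OF t] V by (intro sum.cong refl) blast
  also have "\<dots> = (\<Sum>j = 1..N. expectation (V j)) / real N"
    by (rule sum_divide_distrib[symmetric])
  also have "(\<Sum>j = 1..N. expectation (V j)) = expectation (\<lambda>\<omega>. \<Sum>j = 1..N. V j \<omega>)"
    using V by (intro Bochner_Integration.integral_sum[symmetric]) blast
  also have "expectation (\<lambda>\<omega>. \<Sum>j = 1..N. V j \<omega>) / real N = expectation (\<lambda>\<omega>. (\<Sum>j = 1..N. V j \<omega>) / real N)"
    by simp
  also have "\<dots> = expectation (\<lambda>\<omega>. gradient f (w \<omega>) \<bullet> W \<omega>)"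
    by (rule Bochner_Integration.integral_cong[OF refl]) (simp add: gradient_f[OF w(2)] V_def inner_sum_left)
  finally show ?thesis .
qed

text \<open>Conditional expectations are real-valued here, so the inner product is expanded into
  components; each component of \<open>W\<close> is known to the history and multiplies a
  conditional mean of zero.\<close>

lemma e_orthogonal:
  assumes t: "t \<in> {1..m k}" and e: "square_integrable P (e k t)" and W: "adapted k t W"
  shows "expectation (\<lambda>\<omega>. e k t \<omega> \<bullet> W \<omega>) = 0"
proof -
  interpret S: finite_measure_subalgebra P "hist k t"
    by unfold_locales (rule hist_subalgebra)
  have comp: "integrable P (\<lambda>\<omega>. W \<omega> $ i * e k t \<omega> $ i)"
    "expectation (\<lambda>\<omega>. W \<omega> $ i * e k t \<omega> $ i) = 0" for i
  proof -
    have "square_integrable P (\<lambda>\<omega>. W \<omega> $ i)" "square_integrable P (\<lambda>\<omega>. e k t \<omega> $ i)"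
      by (rule square_integrable_linear[OF _ bounded_linear_vec_nth], rule adapted_L2[OF W] e)+
    from square_integrable_inner[OF this] show int: "integrable P (\<lambda>\<omega>. W \<omega> $ i * e k t \<omega> $ i)"
      by simp
    have Wi: "(\<lambda>\<omega>. W \<omega> $ i) \<in> borel_measurable (hist k t)"
      using W unfolding adapted_def
      by (intro measurable_compose[OF _ borel_measurable_continuous_onI[OF linear_continuous_on[OF bounded_linear_vec_nth]]]) blast
    have ei: "(\<lambda>\<omega>. e k t \<omega> $ i) \<in> borel_measurable P"
      by (rule measurable_compose[OF square_integrable_measurable[OF e] borel_measurable_continuous_onI[OF linear_continuous_on[OF bounded_linear_vec_nth]]])
    have "expectation (\<lambda>\<omega>. W \<omega> $ i * e k t \<omega> $ i)
        = expectation (\<lambda>\<omega>. W \<omega> $ i * real_cond_exp P (hist k t) (\<lambda>\<omega>. e k t \<omega> $ i) \<omega>)"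
      by (rule S.real_cond_exp_intg(2)[OF int Wi ei, symmetric])
    also have "\<dots> = expectation (\<lambda>_. 0)"
    proof (rule integral_cong_AE)
      show "(\<lambda>\<omega>. W \<omega> $ i * real_cond_exp P (hist k t) (\<lambda>\<omega>. e k t \<omega> $ i) \<omega>) \<in> borel_measurable P"
        by (intro borel_measurable_times hist_measurable_P[OF Wi] borel_measurable_cond_exp2)
      show "AE \<omega> in P. W \<omega> $ i * real_cond_exp P (hist k t) (\<lambda>\<omega>. e k t \<omega> $ i) \<omega> = 0"
        using e_cond_exp[OF t, of i] by eventually_elim simp
    qed simp
    finally show "expectation (\<lambda>\<omega>. W \<omega> $ i * e k t \<omega> $ i) = 0"
      by simp
  qed
  have "expectation (\<lambda>\<omega>. e k t \<omega> \<bullet> W \<omega>) = expectation (\<lambda>\<omega>. \<Sum>i\<in>UNIV. W \<omega> $ i * e k t \<omega> $ i)"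
    by (simp add: inner_vec_def mult.commute)
  also have "\<dots> = 0"
    using comp by (simp add: Bochner_Integration.integral_sum)
  finally show ?thesis .
qed

lemma adapted_iterates:
  assumes "t \<in> {1..m k}"
  shows "adapted k t (zb k t)" "adapted k t (xh k t)"
proof -
  have "adapted k t (z k t) \<and> adapted k t (zb k t)"
    using adapted_outer[of k] assms by (intro adapted_inner) auto
  then show "adapted k t (zb k t)" "adapted k t (xh k t)"
    unfolding xh_def[abs_def] by (auto intro: adapted_accel)
qed

text \<open>The two parts of the error vanish for different reasons: the sampling error by
  independence and uniformity of the index, the perturbation \<open>e\<close> by its zero
  conditional mean.\<close>

lemma gerr_orthogonal:
  assumes t: "t \<in> {1..m k}"
  shows "integrable P (\<lambda>\<omega>. gerr k t \<omega> \<bullet> (zb k t \<omega> - us))"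
    and "expectation (\<lambda>\<omega>. gerr k t \<omega> \<bullet> (zb k t \<omega> - us)) = 0"
proof -
  note a = adapted_iterates[OF t]
  note X = xh_in_X[OF _ t]
  define W where "W \<omega> = zb k t \<omega> - us" for \<omega>
  have W: "adapted k t W"
    unfolding W_def by (rule adapted_diff[OF a(1) adapted_const])
  define G where "G \<omega> = gradient f (xh k t \<omega>)" for \<omega>
  define S where "S \<omega> = gradient (fs (\<xi> k t \<omega>)) (xh k t \<omega>)" for \<omega>
  have G: "square_integrable P G"
    unfolding G_def by (rule adapted_L2[OF adapted_gradient_f[OF a(2) X]])
  have S: "square_integrable P S"
    unfolding S_def by (rule selected_gradient_square_integrable[OF t a(2) X])
  have gerr: "square_integrable P (gerr k t)"
    by (rule adapted_sample_grad(2)[OF t a(2)])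
  have split: "gerr k t \<omega> = G \<omega> - S \<omega> - e k t \<omega>" for \<omega>
    by (simp add: gerr_eq_diff sample_grad_def stoch_grad_def G_def S_def)
  \<comment> \<open>Solving for \<open>e\<close> yields its square integrability from that of the
    other three terms.\<close>
  have e_eq: "e k t = (\<lambda>\<omega>. G \<omega> - S \<omega> - gerr k t \<omega>)"
    by (simp add: split)
  have e: "square_integrable P (e k t)"
    by (subst e_eq) (intro square_integrable_diff G S gerr)
  note i = square_integrable_inner[OF _ adapted_L2[OF W]]
  show "integrable P (\<lambda>\<omega>. gerr k t \<omega> \<bullet> (zb k t \<omega> - us))"
    using i[OF gerr] by (simp only: W_def)
  have "expectation (\<lambda>\<omega>. gerr k t \<omega> \<bullet> W \<omega>)
      = expectation (\<lambda>\<omega>. G \<omega> \<bullet> W \<omega> - S \<omega> \<bullet> W \<omega> - e k t \<omega> \<bullet> W \<omega>)"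
    by (simp only: split inner_diff_left)
  also have "\<dots> = expectation (\<lambda>\<omega>. G \<omega> \<bullet> W \<omega>) - expectation (\<lambda>\<omega>. S \<omega> \<bullet> W \<omega>) - expectation (\<lambda>\<omega>. e k t \<omega> \<bullet> W \<omega>)"
    using i[OF G] i[OF S] i[OF e] by simp
  also have "\<dots> = 0"
    using selected_gradient_unbiased[OF t a(2) X W] e_orthogonal[OF t e W] by (simp add: G_def S_def)
  finally show "expectation (\<lambda>\<omega>. gerr k t \<omega> \<bullet> (zb k t \<omega> - us)) = 0"
    by (simp only: W_def)
qed

section \<open>Expected noise and the initial potential\<close>

definition noise_rv :: "nat \<Rightarrow> 'w \<Rightarrow> real" where
  "noise_rv k \<omega> = noise (\<lambda>k t. \<xi> k t \<omega>) (\<lambda>k t. e k t \<omega>) (\<lambda>k t. z k t \<omega>) (\<lambda>k t. zb k t \<omega>) us k"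

lemma noise_rv_eq:
  "noise_rv k \<omega> = (\<Sum>t = 1..m k. 2 * real t * (gerr k t \<omega> \<bullet> (zb k t \<omega> - us))
     + (real t)\<^sup>2 * \<eta> k * (norm_wrt (matrix_inv H) (gerr k t \<omega>))\<^sup>2) / (real (m k) * (real (m k) + 1))"
  by (simp add: noise_rv_def noise_def noise_term_def grad_error_def sgrad_def gerr_eq)

text \<open>In expectation only the quadratic terms remain. Their sum is at most
  \<open>m\<^sup>3 * \<eta> * \<sigma>\<^sup>2\<close> with
  \<open>\<eta> = c1 / (m * (m + 1))\<close>, so division by \<open>m * (m + 1)\<close> leaves at
  most \<open>c1 * \<sigma>\<^sup>2 / m\<close>.\<close>

lemma noise_rv_bound:
  assumes k: "\<kappa> \<le> k"
  shows "integrable P (noise_rv k)"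
    and "expectation (noise_rv k) \<le> c1 * \<sigma>\<^sup>2 / c3 * real k powr (- \<rho>)"
proof -
  let ?n = "\<lambda>t \<omega>. 2 * real t * (gerr k t \<omega> \<bullet> (zb k t \<omega> - us))
     + (real t)\<^sup>2 * \<eta> k * (norm_wrt (matrix_inv H) (gerr k t \<omega>))\<^sup>2"
  have int: "integrable P (?n t)" if t: "t \<in> {1..m k}" for t
    using gerr_orthogonal(1)[OF t] gerr_variance[OF t] by simp
  have exp: "expectation (?n t) \<le> (real (m k))\<^sup>2 * \<eta> k * \<sigma>\<^sup>2" if t: "t \<in> {1..m k}" for t
  proof -
    have "expectation (?n t) = (real t)\<^sup>2 * \<eta> k * expectation (\<lambda>\<omega>. (norm_wrt (matrix_inv H) (gerr k t \<omega>))\<^sup>2)"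
      using gerr_orthogonal[OF t] gerr_variance[OF t] by simp
    also have "\<dots> \<le> (real t)\<^sup>2 * \<eta> k * \<sigma>\<^sup>2"
      using gerr_variance[OF t] \<eta>_pos[of k] by (intro mult_left_mono) auto
    \<comment> \<open>Replacing \<open>t\<close> by \<open>m k\<close> costs only a constant factor
      in the sum.\<close>
    also have "\<dots> \<le> (real (m k))\<^sup>2 * \<eta> k * \<sigma>\<^sup>2"
      using t \<eta>_pos[of k] by (intro mult_right_mono power_mono) auto
    finally show ?thesis .
  qed
  have "integrable P (\<lambda>\<omega>. (\<Sum>t = 1..m k. ?n t \<omega>) / (real (m k) * (real (m k) + 1)))"
    using int by (intro Bochner_Integration.integrable_divide Bochner_Integration.integrable_sum) blast
  then show "integrable P (noise_rv k)"
    unfolding noise_rv_eq[abs_def] .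
  have M: "real (m k) > 0"
    using m_pos[of k] by simp
  have "expectation (noise_rv k) = expectation (\<lambda>\<omega>. \<Sum>t = 1..m k. ?n t \<omega>) / (real (m k) * (real (m k) + 1))"
    unfolding noise_rv_eq[abs_def] by (rule integral_divide_zero)
  also have "expectation (\<lambda>\<omega>. \<Sum>t = 1..m k. ?n t \<omega>) = (\<Sum>t = 1..m k. expectation (?n t))"
    using int by (intro Bochner_Integration.integral_sum) blast
  also have "(\<Sum>t = 1..m k. expectation (?n t)) / (real (m k) * (real (m k) + 1))
      \<le> (\<Sum>t = 1..m k. (real (m k))\<^sup>2 * \<eta> k * \<sigma>\<^sup>2) / (real (m k) * (real (m k) + 1))"
    using M exp by (intro divide_right_mono sum_mono) auto
  also have "\<dots> = c1 * \<sigma>\<^sup>2 * ((real (m k))\<^sup>2 / (real (m k) + 1)\<^sup>2) / real (m k)"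
  proof -
    have "n * (n\<^sup>2 * (c1 / (n * a)) * q) / (n * a) = c1 * q * (n\<^sup>2 / a\<^sup>2) / n" if "n > 0" "a > 0" for n a q :: real
      using that by (simp add: field_simps power2_eq_square)
    from this[OF M, of "real (m k) + 1" "\<sigma>\<^sup>2"] show ?thesis
      by (simp add: \<eta>_tail(1)[OF k])
  qed
  also have "\<dots> \<le> c1 * \<sigma>\<^sup>2 * 1 / real (m k)"
    using M c1_pos by (intro divide_right_mono mult_left_mono) (auto intro: power_mono)
  also have "\<dots> \<le> c1 * \<sigma>\<^sup>2 / (c3 * real k powr \<rho>)"
    using m_ge[of k] M c1_pos c3_pos k \<kappa>_pos by (auto intro!: divide_left_mono)
  also have "\<dots> = c1 * \<sigma>\<^sup>2 / c3 * real k powr (- \<rho>)"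
    by (simp add: powr_minus_divide)
  finally show "expectation (noise_rv k) \<le> c1 * \<sigma>\<^sup>2 / c3 * real k powr (- \<rho>)" .
qed

definition initial_bound_rv :: "'w \<Rightarrow> real" where
  "initial_bound_rv \<omega> = initial_bound (\<lambda>k. x k \<omega>) (\<lambda>k. xb k \<omega>) (\<lambda>k. y k \<omega>) (\<lambda>k. l k \<omega>) us vs (norm \<mu>s + 1)"

lemma initial_bound_rv_integrable: "integrable P initial_bound_rv"
proof -
  note a = adapted_outer[of \<kappa>]
  have x: "square_integrable P (x \<kappa>)" and xb: "square_integrable P (xb \<kappa>)" and l: "square_integrable P (l \<kappa>)"
    and y: "square_integrable P (\<lambda>\<omega>. B *v (y \<kappa> \<omega> - vs))"
    using a adapted_L2 by blast+
  have r: "square_integrable P (\<lambda>\<omega>. residual A B b (x \<kappa> \<omega>) (y \<kappa> \<omega>))"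
    using a by (intro adapted_L2[OF adapted_residual]) blast+
  have sq: "integrable P (\<lambda>\<omega>. (norm (Z \<omega>))\<^sup>2)" if "square_integrable P Z" for Z :: "'w \<Rightarrow> real^'n"
    using that by (simp add: square_integrable_def)
  note d = square_integrable_sqnorm_wrt[OF square_integrable_diff[OF square_integrable_const]]
  show ?thesis
    unfolding initial_bound_rv_def initial_bound_def
    by (intro Bochner_Integration.integrable_add integrable_mult_right Bochner_Integration.integrable_divide
        d[OF xb] d[OF x] sq[OF y] sq[OF l] sq[OF r] integrable_const)
qed

definition mean_bound :: "nat \<Rightarrow> real" where
  "mean_bound T = (expectation initial_bound_rv
     + c1 * \<sigma>\<^sup>2 / c3 * (\<Sum>k = \<kappa>..\<kappa> + T. real k powr (- \<rho>))) / (1 + real T)"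

definition err_rv :: "nat \<Rightarrow> 'w \<Rightarrow> real" where
  "err_rv T \<omega> = (initial_bound_rv \<omega> + (\<Sum>k = \<kappa>..\<kappa> + T. noise_rv k \<omega>)) / (1 + real T)"

lemma err_rv_expectation:
  "integrable P (err_rv T)" "expectation (err_rv T) \<le> mean_bound T"
proof -
  have int: "integrable P (\<lambda>\<omega>. \<Sum>k = \<kappa>..\<kappa> + T. noise_rv k \<omega>)"
    by (intro Bochner_Integration.integrable_sum noise_rv_bound) simp
  show "integrable P (err_rv T)"
    unfolding err_rv_def by (intro Bochner_Integration.integrable_divide Bochner_Integration.integrable_add initial_bound_rv_integrable int)
  have "expectation (err_rv T) = (expectation initial_bound_rv + expectation (\<lambda>\<omega>. \<Sum>k = \<kappa>..\<kappa> + T. noise_rv k \<omega>)) / (1 + real T)"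
    unfolding err_rv_def using initial_bound_rv_integrable int by simp
  also have "expectation (\<lambda>\<omega>. \<Sum>k = \<kappa>..\<kappa> + T. noise_rv k \<omega>) = (\<Sum>k = \<kappa>..\<kappa> + T. expectation (noise_rv k))"
    by (intro Bochner_Integration.integral_sum noise_rv_bound) simp
  also have "\<dots> \<le> (\<Sum>k = \<kappa>..\<kappa> + T. c1 * \<sigma>\<^sup>2 / c3 * real k powr (- \<rho>))"
    by (intro sum_mono noise_rv_bound) simp
  also have "\<dots> = c1 * \<sigma>\<^sup>2 / c3 * (\<Sum>k = \<kappa>..\<kappa> + T. real k powr (- \<rho>))"
    by (rule sum_distrib_left[symmetric])
  finally show "expectation (err_rv T) \<le> mean_bound T"
    by (simp add: mean_bound_def divide_right_mono)
qed

section \<open>Rates of the averaged bound\<close>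

lemma mean_bound_superlinear:
  assumes "\<rho> > 1"
  shows "mean_bound \<in> O(\<lambda>T. 1 / real T)"
proof -
  have sum: "summable (\<lambda>k. real k powr (- \<rho>))"
    using assms by (simp add: summable_real_powr_iff)
  define C where "C = \<bar>expectation initial_bound_rv\<bar> + c1 * \<sigma>\<^sup>2 / c3 * (\<Sum>k. real k powr (- \<rho>))"
  have "norm (mean_bound T) \<le> C * norm (1 / real T)" if "T > 0" for T
  proof -
    have S: "(\<Sum>k = \<kappa>..\<kappa> + T. real k powr (- \<rho>)) \<le> (\<Sum>k. real k powr (- \<rho>))" "0 \<le> (\<Sum>k = \<kappa>..\<kappa> + T. real k powr (- \<rho>))"
      using sum by (auto intro!: sum_le_suminf sum_nonneg)
    have q: "0 \<le> c1 * \<sigma>\<^sup>2 / c3"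
      using c1_pos c3_pos by simp
    have "c1 * \<sigma>\<^sup>2 / c3 * (\<Sum>k = \<kappa>..\<kappa> + T. real k powr (- \<rho>)) \<le> c1 * \<sigma>\<^sup>2 / c3 * (\<Sum>k. real k powr (- \<rho>))"
      by (intro mult_left_mono S q)
    moreover have "0 \<le> c1 * \<sigma>\<^sup>2 / c3 * (\<Sum>k = \<kappa>..\<kappa> + T. real k powr (- \<rho>))"
      by (intro mult_nonneg_nonneg S q)
    ultimately have "\<bar>expectation initial_bound_rv + c1 * \<sigma>\<^sup>2 / c3 * (\<Sum>k = \<kappa>..\<kappa> + T. real k powr (- \<rho>))\<bar> \<le> C"
      unfolding C_def by linarith
    then have "norm (mean_bound T) \<le> C / (1 + real T)"
      unfolding mean_bound_def by (simp add: abs_divide divide_right_mono)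
    also have "\<dots> \<le> C / real T"
      using that \<open>_ \<le> C\<close> by (intro divide_left_mono) auto
    finally show ?thesis
      by simp
  qed
  then show ?thesis
    by (intro bigoI[of _ C] eventually_mono[OF eventually_gt_at_top[of 0]])
qed

lemma mean_bound_linear:
  assumes "\<rho> = 1"
  shows "mean_bound \<in> O(\<lambda>T. ln (real T) / real T)"
proof -
  define q where "q = c1 * \<sigma>\<^sup>2 / c3"
  have q: "0 \<le> q"
    using c1_pos c3_pos by (simp add: q_def)
  define C where "C = 2 * \<bar>expectation initial_bound_rv\<bar> + q * 4"
  \<comment> \<open>For such \<open>T\<close> one has \<open>\<kappa> + T \<le> T\<^sup>2\<close>,
    so the shift by \<kappa> at most doubles the logarithm, and \<open>T \<ge> 3\<close> gives
    \<open>ln T \<ge> 1\<close>, which absorbs the additive constants.\<close>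
  have "norm (mean_bound T) \<le> C * norm (ln (real T) / real T)" if T: "T > \<kappa> + 2" for T
  proof -
    let ?S = "\<Sum>k = \<kappa>..\<kappa> + T. real k powr (- \<rho>)"
    have S0: "0 \<le> ?S"
      by (intro sum_nonneg) auto
    have "?S = (\<Sum>k = \<kappa>..\<kappa> + T. inverse (real k))"
      using \<kappa>_pos assms by (intro sum.cong) (auto simp: powr_minus)
    also have "\<dots> \<le> harm (\<kappa> + T)"
      unfolding harm_def using \<kappa>_pos by (intro sum_mono2) auto
    also have "\<dots> \<le> 1 + ln (real (\<kappa> + T))"
      using T by (intro harm_le_ln) auto
    also have "real (\<kappa> + T) \<le> real T * real T"
    proof -
      have "\<kappa> + T \<le> 2 * T"
        using T by simp
      also have "\<dots> \<le> T * T"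
        using T by (intro mult_right_mono) auto
      finally show ?thesis
        by (metis of_nat_le_iff of_nat_mult)
    qed
    then have "ln (real (\<kappa> + T)) \<le> ln (real T * real T)"
      using T by (subst ln_le_cancel_iff) auto
    also have "\<dots> = 2 * ln (real T)"
      using T by (simp add: ln_mult)
    finally have S: "?S \<le> 1 + 2 * ln (real T)"
      by simp
    have "ln (exp 1) \<le> ln (real T)"
      using T exp_le by (subst ln_le_cancel_iff) (auto intro: order_trans)
    then have ln1: "1 \<le> ln (real T)"
      by simp
    have "q * ?S \<le> q * (4 * ln (real T))"
      using S ln1 q by (intro mult_left_mono) auto
    moreover have "0 \<le> q * ?S"
      by (intro mult_nonneg_nonneg q S0)
    moreover have "\<bar>expectation initial_bound_rv\<bar> * 1 \<le> \<bar>expectation initial_bound_rv\<bar> * ln (real T)"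
      using ln1 by (intro mult_left_mono) auto
    ultimately have "\<bar>expectation initial_bound_rv + q * ?S\<bar> \<le> \<bar>expectation initial_bound_rv\<bar> * ln (real T) + q * (4 * ln (real T))"
      by linarith
    also have "\<dots> \<le> C * ln (real T)"
      using ln1 by (simp add: C_def ring_distribs)
    finally have "norm (mean_bound T) \<le> C * ln (real T) / (1 + real T)"
      unfolding mean_bound_def q_def[symmetric] by (simp add: abs_divide divide_right_mono)
    also have "\<dots> \<le> C * ln (real T) / real T"
      using T ln1 q by (intro divide_left_mono mult_nonneg_nonneg) (auto simp: C_def)
    finally show ?thesis
      using ln1 by simp
  qed
  then show ?thesis
    by (intro bigoI[of _ C] eventually_mono[OF eventually_gt_at_top[of "\<kappa> + 2"]])
qed

definition w_mean :: "nat \<Rightarrow> 'w \<Rightarrow> (real^'n1) \<times> (real^'n2) \<times> (real^'n)" where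
  "w_mean T \<omega> = ergodic_mean (w_tilde A B b \<beta> (\<lambda>k. x k \<omega>) (\<lambda>k. y k \<omega>) (\<lambda>k. l k \<omega>)) \<kappa> T"

definition infeasibility :: "nat \<Rightarrow> 'w \<Rightarrow> real" where
  "infeasibility T \<omega> = norm (residual A B b (fst (w_mean T \<omega>)) (fst (snd (w_mean T \<omega>))))"

definition objective_gap :: "nat \<Rightarrow> 'w \<Rightarrow> real" where
  "objective_gap T \<omega> = real_of_ereal (objective f g (w_mean T \<omega>) - objective f g (us, vs, \<mu>s))"

lemma pathwise_bounds:
  assumes "\<omega> \<in> space P"
  shows "\<bar>objective f g (w_mean T \<omega>)\<bar> \<noteq> \<infinity>" "infeasibility T \<omega> \<le> err_rv T \<omega>"
    "\<bar>objective_gap T \<omega>\<bar> \<le> (1 + norm \<mu>s) * err_rv T \<omega>"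
  using ergodic_bound[OF all_paths[OF assms] solution, of T]
  unfolding w_mean_def infeasibility_def objective_gap_def err_rv_def err_bound_def initial_bound_rv_def noise_rv_def
  by auto

lemma infeasibility_measurable: "infeasibility T \<in> borel_measurable P"
proof -
  have x: "x k \<in> borel_measurable P" for k
    using adapted_outer[of k] adapted_L2 square_integrable_measurable by blast
  have "(\<lambda>\<omega>. (1 / (1 + real T)) *\<^sub>R (\<Sum>k = \<kappa>..\<kappa> + T. x (k + 1) \<omega>)) \<in> borel_measurable P"
    "(\<lambda>\<omega>. (1 / (1 + real T)) *\<^sub>R (\<Sum>k = \<kappa>..\<kappa> + T. y (k + 1) \<omega>)) \<in> borel_measurable P"
    by (intro borel_measurable_scaleR borel_measurable_const borel_measurable_sum x y_measurable)+
  then have "(\<lambda>\<omega>. fst (w_mean T \<omega>)) \<in> borel_measurable P" "(\<lambda>\<omega>. fst (snd (w_mean T \<omega>))) \<in> borel_measurable P"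
    unfolding w_mean_def ergodic_mean_fst ergodic_mean_snd by (simp_all add: w_tilde_def ergodic_mean_def)
  note mean = this
  note lin = measurable_compose[OF _ borel_measurable_continuous_onI[OF matrix_vector_mult_linear_continuous_on]]
  show ?thesis
    unfolding infeasibility_def residual_def
    by (rule measurable_compose[OF borel_measurable_diff[OF
          borel_measurable_add[OF lin[OF mean(1)] lin[OF mean(2)]] borel_measurable_const] borel_measurable_norm])
qed

lemma infeasibility_expectation:
  "integrable P (infeasibility T)" "\<bar>expectation (infeasibility T)\<bar> \<le> mean_bound T"
proof -
  have nonneg: "0 \<le> infeasibility T \<omega>" for \<omega>
    by (simp add: infeasibility_def)
  show int: "integrable P (infeasibility T)"
    by (rule Bochner_Integration.integrable_bound[OF err_rv_expectation(1)[of T] infeasibility_measurable])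
      (rule AE_I2, use pathwise_bounds(2)[of _ T] nonneg in fastforce)
  have "expectation (infeasibility T) \<le> expectation (err_rv T)"
    by (intro integral_mono int err_rv_expectation pathwise_bounds)
  moreover have "0 \<le> expectation (infeasibility T)"
    by (intro Bochner_Integration.integral_nonneg nonneg)
  ultimately show "\<bar>expectation (infeasibility T)\<bar> \<le> mean_bound T"
    using err_rv_expectation(2)[of T] by linarith
qed

text \<open>Measurability of the averaged objective is an input; integrability and the bound then
  follow by domination with the integrable \<open>err_rv\<close>.\<close>

lemma objective_gap_expectation:
  assumes meas: "(\<lambda>\<omega>. objective f g (w_mean T \<omega>)) \<in> borel_measurable P"
  shows "integrable P (objective_gap T)" "\<bar>expectation (objective_gap T)\<bar> \<le> (1 + norm \<mu>s) * mean_bound T"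
proof -
  have gap: "objective_gap T \<in> borel_measurable P"
    unfolding objective_gap_def
    by (intro borel_measurable_real_of_ereal borel_measurable_ereal_diff meas borel_measurable_const)
  have int: "integrable P (\<lambda>\<omega>. (1 + norm \<mu>s) * err_rv T \<omega>)"
    by (intro integrable_mult_right err_rv_expectation)
  have bound: "\<bar>objective_gap T \<omega>\<bar> \<le> \<bar>(1 + norm \<mu>s) * err_rv T \<omega>\<bar>" if "\<omega> \<in> space P" for \<omega>
    using pathwise_bounds(3)[OF that, of T] by linarith
  show gap_int: "integrable P (objective_gap T)"
    by (rule Bochner_Integration.integrable_bound[OF int gap]) (rule AE_I2, simp only: real_norm_def bound)
  have "\<bar>expectation (objective_gap T)\<bar> \<le> expectation (\<lambda>\<omega>. \<bar>objective_gap T \<omega>\<bar>)"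
    using integral_norm_bound[of P "objective_gap T"] by simp
  also have "\<dots> \<le> expectation (\<lambda>\<omega>. (1 + norm \<mu>s) * err_rv T \<omega>)"
    by (intro integral_mono integrable_abs gap_int int pathwise_bounds)
  also have "\<dots> = (1 + norm \<mu>s) * expectation (err_rv T)"
    by simp
  also have "\<dots> \<le> (1 + norm \<mu>s) * mean_bound T"
    by (intro mult_left_mono err_rv_expectation) simp
  finally show "\<bar>expectation (objective_gap T)\<bar> \<le> (1 + norm \<mu>s) * mean_bound T" .
qed

lemma expectation_rates:
  assumes meas: "\<And>T. T > 0 \<Longrightarrow> (\<lambda>\<omega>. objective f g (w_mean T \<omega>)) \<in> borel_measurable P"
    and rate: "mean_bound \<in> O(r)"
  shows "(\<lambda>T. \<bar>expectation (objective_gap T)\<bar>) \<in> O(r)" "(\<lambda>T. expectation (infeasibility T)) \<in> O(r)"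
proof -
  \<comment> \<open>Measurability of the averaged objective is available for positive
    \<open>T\<close> only, which is enough for an asymptotic statement.\<close>
  have "eventually (\<lambda>T. norm \<bar>expectation (objective_gap T)\<bar> \<le> (1 + norm \<mu>s) * norm (mean_bound T)) at_top"
    using eventually_gt_at_top[of 0]
  proof eventually_elim
    case (elim T)
    have "\<bar>expectation (objective_gap T)\<bar> \<le> (1 + norm \<mu>s) * mean_bound T"
      by (rule objective_gap_expectation(2)[OF meas[OF elim]])
    also have "\<dots> \<le> (1 + norm \<mu>s) * norm (mean_bound T)"
      by (intro mult_left_mono) auto
    finally show ?case
      by simp
  qed
  then have "(\<lambda>T. \<bar>expectation (objective_gap T)\<bar>) \<in> O(mean_bound)"
    by (rule bigoI)
  then show "(\<lambda>T. \<bar>expectation (objective_gap T)\<bar>) \<in> O(r)"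
    using rate by (rule landau_o.big.trans)
  have "norm (expectation (infeasibility T)) \<le> 1 * norm (mean_bound T)" for T
    using infeasibility_expectation(2)[of T] by simp
  then have "(\<lambda>T. expectation (infeasibility T)) \<in> O(mean_bound)"
    by (intro bigoI[of _ 1] always_eventually allI)
  then show "(\<lambda>T. expectation (infeasibility T)) \<in> O(r)"
    using rate by (rule landau_o.big.trans)
qed

end

theorem theorem4p2:
  fixes P :: "'w measure"
    and X :: "(real^'n1) set" and Y :: "(real^'n2) set"
    and N :: nat and fs :: "nat \<Rightarrow> real^'n1 \<Rightarrow> real" and f :: "real^'n1 \<Rightarrow> real"
    and g :: "real^'n2 \<Rightarrow> ereal"
    and A :: "real^'n1^'n" and B :: "real^'n2^'n" and b :: "real^'n"
    and \<beta> s \<nu> \<sigma> c1 c2 c3 \<rho> :: real and M \<kappa> :: nat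
    and H :: "real^'n1^'n1" and MM D :: "nat \<Rightarrow> real^'n1^'n1"
    and m :: "nat \<Rightarrow> nat" and \<eta> :: "nat \<Rightarrow> real"
    and x0 :: "real^'n1" and y0 :: "real^'n2" and l0 :: "real^'n"
    and \<xi> :: "nat \<Rightarrow> nat \<Rightarrow> 'w \<Rightarrow> nat" and e \<delta> :: "nat \<Rightarrow> nat \<Rightarrow> 'w \<Rightarrow> real^'n1"
    and x xb :: "nat \<Rightarrow> 'w \<Rightarrow> real^'n1" and y :: "nat \<Rightarrow> 'w \<Rightarrow> real^'n2"
    and l :: "nat \<Rightarrow> 'w \<Rightarrow> real^'n" and z zb :: "nat \<Rightarrow> nat \<Rightarrow> 'w \<Rightarrow> real^'n1"
    and wT :: "nat \<Rightarrow> 'w \<Rightarrow> (real^'n1) \<times> (real^'n2) \<times> (real^'n)"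
  \<comment> \<open>the problem\<close>
  assumes "closed X" "convex X" "closed Y" "convex Y"
    and "ext_convex_on Y g"
    and "N > 0"
    and "\<And>j. j \<in> {1..N} \<Longrightarrow> convex_on X (fs j)"
    and "\<And>j u. j \<in> {1..N} \<Longrightarrow> u \<in> X \<Longrightarrow> fs j differentiable (at u)"
    and "\<And>u. f u = (1 / real N) * (\<Sum>j = 1..N. fs j u)"
  \<comment> \<open>standing assumptions\<close>
    and "\<beta> > 0" and "0 < s" "s \<le> (1 + sqrt 5) / 2" and "pos_def H"
    and "primal_dual_solutions X Y f g A B b \<noteq> {}"
    and "\<And>q. \<exists>u. is_arg_min
           (\<lambda>v. g v + ereal (\<beta> / 2 * (v \<bullet> ((transpose B ** B) *v v)) + q \<bullet> v)) (\<lambda>v. v \<in> Y) u"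
    and "\<nu> > 0"
    and "\<And>j u v. j \<in> {1..N} \<Longrightarrow> u \<in> X \<Longrightarrow> v \<in> X \<Longrightarrow>
           norm_wrt (matrix_inv H) (gradient (fs j) u - gradient (fs j) v)
             \<le> \<nu> * norm_wrt H (u - v)"
  \<comment> \<open>the parameters of the algorithm\<close>
    and "c1 > 0" "c2 > 0" "c3 > 0" and "\<rho> \<ge> 1" and "M > 0"
    and "\<And>k. m k = max (nat \<lceil>c3 * real k powr \<rho>\<rceil>) M"
    and "\<And>k. \<eta> k = min (c1 / (real (m k) * (real (m k) + 1))) c2"
    and "\<And>k. transpose (MM k) = MM k"
    and "\<And>k. D k = MM k - \<beta> *\<^sub>R (transpose A ** A)"
    and "\<And>k. loewner_ge (D k) (D (k + 1))" and "\<And>k. pos_semidef (D k)"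
    and "x0 \<in> X" "y0 \<in> Y"
  \<comment> \<open>the random iterates\<close>
    and "prob_space P"
    and "\<And>k t. t \<in> {1..m k} \<Longrightarrow> \<xi> k t \<in> P \<rightarrow>\<^sub>M count_space {1..N}"
    and "\<And>k t. t \<in> {1..m k} \<Longrightarrow>
           distr P (count_space {1..N}) (\<xi> k t) = uniform_count_measure {1..N}"
    and "\<And>k t. t \<in> {1..m k} \<Longrightarrow>
           prob_space.indep_set P (sets (history P m \<xi> e y k t))
             (sets (vimage_algebra (space P) (\<xi> k t) (count_space {1..N})))"
    and "\<And>k t. t \<in> {1..m k} \<Longrightarrow> integrable P (e k t)"
    and "\<And>k t i. t \<in> {1..m k} \<Longrightarrow>
           AE \<omega> in P. real_cond_exp P (history P m \<xi> e y k t) (\<lambda>\<omega>'. e k t \<omega>' $ i) \<omega> = 0"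
    and "\<And>k. y k \<in> borel_measurable P"
    and "\<And>\<omega>. \<omega> \<in> space P \<Longrightarrow>
           as_admm_path X Y fs g A B b \<beta> s H m \<eta> MM x0 y0 l0
             (\<lambda>k t. \<xi> k t \<omega>) (\<lambda>k t. e k t \<omega>)
             (\<lambda>k. x k \<omega>) (\<lambda>k. xb k \<omega>) (\<lambda>k. y k \<omega>) (\<lambda>k. l k \<omega>)
             (\<lambda>k t. z k t \<omega>) (\<lambda>k t. zb k t \<omega>)"
  \<comment> \<open>bounded variance\<close>
    and "\<And>k t \<omega>. \<delta> k t \<omega> = gradient f (accel t (zb k t \<omega>) (z k t \<omega>))
           - stoch_grad fs (\<xi> k t \<omega>) (e k t \<omega>) (accel t (zb k t \<omega>) (z k t \<omega>))"
    and "\<sigma> > 0"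
    and "\<And>k t. t \<in> {1..m k} \<Longrightarrow>
           integrable P (\<lambda>\<omega>. (norm_wrt (matrix_inv H) (\<delta> k t \<omega>))\<^sup>2) \<and>
           (\<integral>\<omega>. (norm_wrt (matrix_inv H) (\<delta> k t \<omega>))\<^sup>2 \<partial>P) \<le> \<sigma>\<^sup>2"
  \<comment> \<open>the averages\<close>
    and "m \<kappa> = nat \<lceil>c3 * real \<kappa> powr \<rho>\<rceil>"
    and "\<eta> \<kappa> = c1 / (real (m \<kappa>) * (real (m \<kappa>) + 1))" and "\<eta> \<kappa> \<le> 1 / (2 * \<nu>)"
    and "\<And>T \<omega>. wT T \<omega> =
           ergodic_mean (w_tilde A B b \<beta> (\<lambda>k. x k \<omega>) (\<lambda>k. y k \<omega>) (\<lambda>k. l k \<omega>)) \<kappa> T"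
    and "\<And>T. T > 0 \<Longrightarrow> (\<lambda>\<omega>. objective f g (wT T \<omega>)) \<in> borel_measurable P"
  shows "\<forall>ws \<in> primal_dual_solutions X Y f g A B b.
    (let objgap = (\<lambda>T \<omega>. real_of_ereal (objective f g (wT T \<omega>) - objective f g ws));
         infeas = (\<lambda>T \<omega>. norm (residual A B b (fst (wT T \<omega>)) (fst (snd (wT T \<omega>)))))
     in (\<forall>T>0. (\<forall>\<omega>\<in>space P. \<bar>objective f g (wT T \<omega>)\<bar> \<noteq> \<infinity>)
               \<and> integrable P (objgap T) \<and> integrable P (infeas T)) \<and>
        (\<rho> > 1 \<longrightarrow>
           (\<lambda>T. \<bar>\<integral>\<omega>. objgap T \<omega> \<partial>P\<bar>) \<in> O(\<lambda>T. 1 / real T) \<and>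
           (\<lambda>T. \<integral>\<omega>. infeas T \<omega> \<partial>P) \<in> O(\<lambda>T. 1 / real T)) \<and>
        (\<rho> = 1 \<longrightarrow>
           (\<lambda>T. \<bar>\<integral>\<omega>. objgap T \<omega> \<partial>P\<bar>) \<in> O(\<lambda>T. ln (real T) / real T) \<and>
           (\<lambda>T. \<integral>\<omega>. infeas T \<omega> \<partial>P) \<in> O(\<lambda>T. ln (real T) / real T)))"
proof
  note hyps = assms
  fix ws assume ws: "ws \<in> primal_dual_solutions X Y f g A B b"
  obtain us vs \<mu>s where ws_eq: "ws = (us, vs, \<mu>s)"
    by (cases ws) auto
  \<comment> \<open>The solution is fixed before the bounds are formed, so the constants hidden in
    the rates may depend on \<open>ws\<close>.\<close>
  interpret R: as_admm_random X Y N fs f g A B b \<beta> s \<nu> c1 c2 c3 \<rho> M \<kappa> H MM D m \<eta> x0 y0 l0 P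
    \<sigma> \<xi> e x xb y l z zb us vs \<mu>s \<delta>
  proof (intro as_admm_random.intro as_admm_problem.intro as_admm_random_axioms.intro)
    show "(us, vs, \<mu>s) \<in> primal_dual_solutions X Y f g A B b"
      using ws by (simp only: ws_eq)
  qed (fact hyps)+
  \<comment> \<open>\<open>hyps(45)\<close> is the definition of \<open>wT\<close>;
    \<open>hyps(46)\<close> below is the measurability of its objective.\<close>
  have w: "wT = R.w_mean"
    using hyps(45) by (intro ext) (simp add: R.w_mean_def)
  have meas: "(\<lambda>\<omega>. objective f g (R.w_mean T \<omega>)) \<in> borel_measurable P" if "T > 0" for T
    using hyps(46)[OF that] by (simp only: w)
  have objgap: "(\<lambda>T \<omega>. real_of_ereal (objective f g (wT T \<omega>) - objective f g ws)) = R.objective_gap"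
    by (intro ext) (simp only: w ws_eq R.objective_gap_def)
  have infeas: "(\<lambda>T \<omega>. norm (residual A B b (fst (wT T \<omega>)) (fst (snd (wT T \<omega>))))) = R.infeasibility"
    by (intro ext) (simp only: w R.infeasibility_def)
  show "let objgap = (\<lambda>T \<omega>. real_of_ereal (objective f g (wT T \<omega>) - objective f g ws));
         infeas = (\<lambda>T \<omega>. norm (residual A B b (fst (wT T \<omega>)) (fst (snd (wT T \<omega>)))))
     in (\<forall>T>0. (\<forall>\<omega>\<in>space P. \<bar>objective f g (wT T \<omega>)\<bar> \<noteq> \<infinity>)
               \<and> integrable P (objgap T) \<and> integrable P (infeas T)) \<and>
        (\<rho> > 1 \<longrightarrow>
           (\<lambda>T. \<bar>\<integral>\<omega>. objgap T \<omega> \<partial>P\<bar>) \<in> O(\<lambda>T. 1 / real T) \<and>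
           (\<lambda>T. \<integral>\<omega>. infeas T \<omega> \<partial>P) \<in> O(\<lambda>T. 1 / real T)) \<and>
        (\<rho> = 1 \<longrightarrow>
           (\<lambda>T. \<bar>\<integral>\<omega>. objgap T \<omega> \<partial>P\<bar>) \<in> O(\<lambda>T. ln (real T) / real T) \<and>
           (\<lambda>T. \<integral>\<omega>. infeas T \<omega> \<partial>P) \<in> O(\<lambda>T. ln (real T) / real T))"
    unfolding objgap infeas Let_def
    using R.pathwise_bounds(1) R.objective_gap_expectation(1)[OF meas] R.infeasibility_expectation(1)
      R.expectation_rates[OF meas R.mean_bound_superlinear] R.expectation_rates[OF meas R.mean_bound_linear]
    by (simp add: w)
qed

end
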